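(* Let $G=(V,E,m,\omega)$ be a complete weighted graph with non-degenerate measure $m$, and assume $\omega_{\min}:=\inf_{x,y\in V,\,x\sim y}\omega_{xy}>0$ and $m_{\max}:=\sup_{x\in V}m(x)<\infty$. Suppose $G$ satisfies $CDE'(n,0)$, $n>0$. Then there exists a constant $C>0$, depending on $n$ (and on $m_{\max}$ and $\omega_{\min}$), such that for all $x,y\in V$ and all $t>0$, $$p(t,x,y)\leq \frac{C}{V(x,\sqrt{t})}.$$
   Context: Setting: $G=(V,E,m,\omega)$ is an infinite connected weighted graph (loops allowed): $V$ is the vertex set, $E$ a symmetric set of edges, $x\sim y$ means $\{x,y\}\in E$, $m:V\to(0,\infty)$ is a vertex measure, and $\omega_{xy}=\omega_{yx}>0$ is the weight of the edge $\{x,y\}$. The graph is locally finite: every vertex has finitely many neighbours, so $\deg(x)=\sum_{y\sim x}\omega_{xy}<\infty$ for all $x$. $C_0(V)$ is the set of finitely supported real functions on $V$; $\ell^p_m$ is the $\ell^p$ space on $V$ with respect to $m$. The measure $m$ is non-degenerate if $\inf_{x\in V}m(x)>0$. Laplacian and semigroup: $\Delta f(x)=\frac{1}{m(x)}\sum_{y\sim x}\omega_{xy}(f(y)-f(x))$. Let $Q(f,g)=\frac12\sum_{x,y\in V}\omega_{xy}(f(y)-f(x))(g(y)-g(x))$ (with $\omega_{xy}=0$ if $x\not\sim y$), with domain $D(Q)$ the completion of $C_0(V)$ under $\|f\|_Q=(\|f\|_{\ell^2_m}^2+Q(f,f))^{1/2}$. The associated self-adjoint generator on $\ell^2_m$ is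 $\Delta$ with domain $D(\Delta)=\{f\in D(Q):\Delta f\in\ell^2_m\}$. $P_t=e^{t\Delta}$ is the heat semigroup on $\ell^2_m$. The heat kernel is $p(t,x,y)=P_t\left(\frac{\delta_y}{m(y)}\right)(x)$, where $\delta_y$ is the indicator function of $\{y\}$. Balls: $d$ is the graph distance (number of edges of a shortest path), $B(x,r)=\{y\in V:d(x,y)\le r\}$, and $V(x,r)=\sum_{y\in B(x,r)}m(y)$. Gradient forms: $\Gamma(f,g)(x)=\frac{1}{2m(x)}\sum_{y\sim x}\omega_{xy}(f(y)-f(x))(g(y)-g(x))$, $\Gamma(f)=\Gamma(f,f)$. For positive $f$, $\widetilde{\Gamma_2}(f)=\frac12\Delta\Gamma(f)-\Gamma\left(f,\frac{\Delta (f^2)}{2f}\right)$. $G$ satisfies $CDE'(n,K)$ if for every positive function $f:V\to(0,\infty)$ and every $x\in V$, $\widetilde{\Gamma_2}(f)(x)\ge\frac1n f(x)^2(\Delta\log f)(x)^2+K\Gamma(f)(x)$. $G$ is complete if there is a non-decreasing sequence $\{\eta_k\}$ in $C_0(V)$ with $\eta_k\to\mathbf 1$ pointwise and $\Gamma(\eta_k)\le\frac1k$ on $V$ for all $k\ge1$. *)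

theory Defs
  imports "HOL-Analysis.Analysis"
begin

text \<open>The vertex set is the whole type \<open>'v\<close>. An undirected edge \<open>{x, y}\<close> is represented by both
  pairs \<open>(x, y)\<close> and \<open>(y, x)\<close>, a loop by \<open>(x, x)\<close>.\<close>

record 'v wgraph =
  edges :: "('v \<times> 'v) set"
  vmeas :: "'v \<Rightarrow> real"
  weight :: "'v \<Rightarrow> 'v \<Rightarrow> real"

definition nbrs :: "'v wgraph \<Rightarrow> 'v \<Rightarrow> 'v set" where
  "nbrs G x = {y. (x, y) \<in> edges G}"

definition weighted_graph :: "'v wgraph \<Rightarrow> bool" where
  "weighted_graph G \<longleftrightarrow>
     infinite (UNIV :: 'v set) \<and>
     sym (edges G) \<and>
     (\<forall>x y. (x, y) \<in> (edges G)\<^sup>*) \<and>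
     (\<forall>x. finite (nbrs G x)) \<and>
     (\<forall>x. 0 < vmeas G x) \<and>
     (\<forall>x y. weight G x y = weight G y x) \<and>
     (\<forall>x y. (x, y) \<in> edges G \<longrightarrow> 0 < weight G x y) \<and>
     (\<forall>x y. (x, y) \<notin> edges G \<longrightarrow> weight G x y = 0)"

definition nondegenerate_measure :: "'v wgraph \<Rightarrow> bool" where
  "nondegenerate_measure G \<longleftrightarrow> 0 < (INF x. vmeas G x)"

definition m_max :: "'v wgraph \<Rightarrow> real" where
  "m_max G = (SUP x. vmeas G x)"

definition omega_min :: "'v wgraph \<Rightarrow> real" where
  "omega_min G = (INF (x, y) \<in> edges G. weight G x y)"


definition gdist :: "'v wgraph \<Rightarrow> 'v \<Rightarrow> 'v \<Rightarrow> nat" where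
  "gdist G x y = (LEAST k. (x, y) \<in> edges G ^^ k)"

definition gball :: "'v wgraph \<Rightarrow> 'v \<Rightarrow> real \<Rightarrow> 'v set" where
  "gball G x r = {y. real (gdist G x y) \<le> r}"

definition vol :: "'v wgraph \<Rightarrow> 'v \<Rightarrow> real \<Rightarrow> real" where
  "vol G x r = (\<Sum>y\<in>gball G x r. vmeas G y)"


definition laplacian :: "'v wgraph \<Rightarrow> ('v \<Rightarrow> real) \<Rightarrow> 'v \<Rightarrow> real" where
  "laplacian G f x = (\<Sum>y\<in>nbrs G x. weight G x y * (f y - f x)) / vmeas G x"

definition grad_form :: "'v wgraph \<Rightarrow> ('v \<Rightarrow> real) \<Rightarrow> ('v \<Rightarrow> real) \<Rightarrow> 'v \<Rightarrow> real" where
  "grad_form G f g x =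
     (\<Sum>y\<in>nbrs G x. weight G x y * (f y - f x) * (g y - g x)) / (2 * vmeas G x)"

definition Gamma2_tilde :: "'v wgraph \<Rightarrow> ('v \<Rightarrow> real) \<Rightarrow> 'v \<Rightarrow> real" where
  "Gamma2_tilde G f x =
     laplacian G (grad_form G f f) x / 2
     - grad_form G f (\<lambda>y. laplacian G (\<lambda>z. (f z)\<^sup>2) y / (2 * f y)) x"

definition CDE' :: "'v wgraph \<Rightarrow> real \<Rightarrow> real \<Rightarrow> bool" where
  "CDE' G n K \<longleftrightarrow>
     (\<forall>f. (\<forall>x. 0 < f x) \<longrightarrow>
       (\<forall>x. Gamma2_tilde G f x \<ge>
              1 / n * (f x)\<^sup>2 * (laplacian G (\<lambda>y. ln (f y)) x)\<^sup>2 + K * grad_form G f f x))"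


definition C0 :: "('v \<Rightarrow> real) set" where
  "C0 = {f. finite {x. f x \<noteq> 0}}"

definition complete_graph :: "'v wgraph \<Rightarrow> bool" where
  "complete_graph G \<longleftrightarrow>
     (\<exists>\<eta> :: nat \<Rightarrow> 'v \<Rightarrow> real.
        (\<forall>k\<ge>1. \<eta> k \<in> C0) \<and>
        (\<forall>k\<ge>1. \<forall>x. \<eta> k x \<le> \<eta> (Suc k) x) \<and>
        (\<forall>x. (\<lambda>k. \<eta> k x) \<longlonglongrightarrow> 1) \<and>
        (\<forall>k\<ge>1. \<forall>x. grad_form G (\<eta> k) (\<eta> k) x \<le> 1 / real k))"


definition l2 :: "'v wgraph \<Rightarrow> ('v \<Rightarrow> real) set" where
  "l2 G = {f. (\<lambda>x. (f x)\<^sup>2 * vmeas G x) summable_on UNIV}"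

definition l2_norm :: "'v wgraph \<Rightarrow> ('v \<Rightarrow> real) \<Rightarrow> real" where
  "l2_norm G f = sqrt (\<Sum>\<^sub>\<infinity>x. (f x)\<^sup>2 * vmeas G x)"

definition Q_form :: "'v wgraph \<Rightarrow> ('v \<Rightarrow> real) \<Rightarrow> ('v \<Rightarrow> real) \<Rightarrow> real" where
  "Q_form G f g =
     (\<Sum>\<^sub>\<infinity>(x, y). weight G x y * (f y - f x) * (g y - g x)) / 2"

definition finite_energy :: "'v wgraph \<Rightarrow> ('v \<Rightarrow> real) \<Rightarrow> bool" where
  "finite_energy G f \<longleftrightarrow> (\<lambda>(x, y). weight G x y * (f y - f x)\<^sup>2) summable_on UNIV"

definition Q_norm :: "'v wgraph \<Rightarrow> ('v \<Rightarrow> real) \<Rightarrow> real" where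
  "Q_norm G f = sqrt ((l2_norm G f)\<^sup>2 + Q_form G f f)"

text \<open>The completion of \<^term>\<open>C0\<close> under \<^term>\<open>Q_norm G\<close>, realised inside \<^term>\<open>l2 G\<close>: a Cauchy sequence
  for the form norm converges in \<^term>\<open>l2 G\<close>, and by Fatou it converges in the form norm to that same
  limit. Summability is required explicitly because \<^const>\<open>infsum\<close> is \<open>0\<close> on
  non-summable families, so that \<^term>\<open>Q_norm G\<close> is meaningful only on functions of finite energy
  in \<^term>\<open>l2 G\<close>.\<close>

definition dom_Q :: "'v wgraph \<Rightarrow> ('v \<Rightarrow> real) set" where
  "dom_Q G =
     {f \<in> l2 G. finite_energy G f \<and>
        (\<exists>\<phi> :: nat \<Rightarrow> 'v \<Rightarrow> real.
           (\<forall>k. \<phi> k \<in> C0) \<and> (\<lambda>k. Q_norm G (\<lambda>x. \<phi> k x - f x)) \<longlonglongrightarrow> 0)}"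

definition dom_laplacian :: "'v wgraph \<Rightarrow> ('v \<Rightarrow> real) set" where
  "dom_laplacian G = {f \<in> dom_Q G. laplacian G f \<in> l2 G}"

definition C0_semigroup_on_l2 ::
    "'v wgraph \<Rightarrow> (real \<Rightarrow> ('v \<Rightarrow> real) \<Rightarrow> 'v \<Rightarrow> real) \<Rightarrow> bool" where
  "C0_semigroup_on_l2 G P \<longleftrightarrow>
     (\<forall>t\<ge>0. \<forall>f\<in>l2 G. P t f \<in> l2 G) \<and>
     (\<forall>t\<ge>0. \<forall>f\<in>l2 G. \<forall>g\<in>l2 G. \<forall>a b.
        P t (\<lambda>x. a * f x + b * g x) = (\<lambda>x. a * P t f x + b * P t g x)) \<and>
     (\<forall>t\<ge>0. \<exists>c. \<forall>f\<in>l2 G. l2_norm G (P t f) \<le> c * l2_norm G f) \<and>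
     (\<forall>f\<in>l2 G. P 0 f = f) \<and>
     (\<forall>s\<ge>0. \<forall>t\<ge>0. \<forall>f\<in>l2 G. P (s + t) f = P s (P t f)) \<and>
     (\<forall>f\<in>l2 G. ((\<lambda>h. l2_norm G (\<lambda>x. P h f x - f x)) \<longlongrightarrow> 0) (at_right 0))"

text \<open>The infinitesimal generator of \<open>P\<close>, domain included, is the Laplacian on
  \<^term>\<open>dom_laplacian G\<close>: the difference quotients at \<open>f\<close> converge in \<open>l2\<close> exactly when \<open>f\<close> lies in
  that domain, and then the limit is \<^term>\<open>laplacian G f\<close>.\<close>

definition generated_by_laplacian ::
    "'v wgraph \<Rightarrow> (real \<Rightarrow> ('v \<Rightarrow> real) \<Rightarrow> 'v \<Rightarrow> real) \<Rightarrow> bool" where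
  "generated_by_laplacian G P \<longleftrightarrow>
     (\<forall>f\<in>l2 G. \<forall>g\<in>l2 G.
        ((\<lambda>h. l2_norm G (\<lambda>x. (P h f x - f x) / h - g x)) \<longlongrightarrow> 0) (at_right 0)
        \<longleftrightarrow> f \<in> dom_laplacian G \<and> g = laplacian G f)"

text \<open>\<open>P\<^sub>t = e\<^bsup>t\<Delta>\<^esup>\<close> is the strongly continuous semigroup generated by the self-adjoint, nonpositive
  operator \<open>\<Delta>\<close> on \<^term>\<open>dom_laplacian G\<close>. A strongly continuous semigroup is determined by its
  generator, so the choice only concerns the irrelevant values at \<open>t < 0\<close> and outside
  \<^term>\<open>l2 G\<close>.\<close>

definition heat_semigroup :: "'v wgraph \<Rightarrow> real \<Rightarrow> ('v \<Rightarrow> real) \<Rightarrow> 'v \<Rightarrow> real" where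
  "heat_semigroup G = (SOME P. C0_semigroup_on_l2 G P \<and> generated_by_laplacian G P)"

definition heat_kernel :: "'v wgraph \<Rightarrow> real \<Rightarrow> 'v \<Rightarrow> 'v \<Rightarrow> real" where
  "heat_kernel G t x y = heat_semigroup G t (\<lambda>z. indicator {y} z / vmeas G y) x"

end

theory Submission
  imports Defs
begin

text \<open>
Write \<open>u\<^sub>t = p(t, \<cdot>, y)\<close>. The bound follows from three facts. Curvature gives the Li-Yau inequality
\<open>\<Gamma>(\<surd>u) - \<Delta>u/2 \<le> n u/(2t)\<close> (\<open>li_yau\<close>). Since \<open>\<Delta>u = \<partial>\<^sub>t u\<close>, it controls the time derivative of \<open>u\<close> from below
by a square of the spatial increments, and following \<open>\<surd>u\<close> along a path that moves from \<open>x\<close> to \<open>z\<close> while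
time runs from \<open>t\<close> to \<open>2t\<close> yields the Harnack inequality \<open>u\<^sub>t(x) \<le> C u\<^bsub>2t\<^esub>(z)\<close> whenever
\<open>d(x, z) \<le> \<surd>t\<close>, with \<open>C = 2\<^sup>n exp(m_max / omega_min)\<close> (\<open>harnack_ball\<close>). Multiplying by
\<open>m(z)\<close>, summing over the ball \<open>B(x, \<surd>t)\<close> and using that the heat kernel has total mass at most one
gives \<open>V(x, \<surd>t) p(t, x, y) \<le> C\<close> (\<open>heat_kernel_upper_bound\<close>).

The weighted degrees are not controlled uniformly, so the Laplacian is treated as an unbounded operator
throughout, both in the Li-Yau inequality and in the heat semigroup.

For the Li-Yau inequality put \<open>v = u + \<epsilon>\<close>, \<open>h = \<surd>v\<close> and \<open>H = \<Gamma>(h) - \<Delta>v/2 = -h \<Delta>h\<close>. The curvature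
condition says that \<open>(\<Delta> - \<partial>\<^sub>t) H \<ge> 2H\<^sup>2/(n v)\<close> where \<open>H > 0\<close>, so \<open>K = tH - n v/2\<close> is a subsolution of
the heat equation wherever it is positive, and \<open>K \<le> 0\<close> at time zero. Lifting the solution by \<open>\<epsilon>\<close> costs
nothing in the heat equation but gives \<open>\<Gamma>(\<surd>v) \<le> \<Gamma>(u)/(4\<epsilon>)\<close>; with the energy bound for \<open>u\<close> and the
non-degenerate measure this bounds the positive part of \<open>K\<close> in \<open>l2\<close> uniformly in time. For such subsolutions the
cutoff functions of a complete graph are exactly what a Caccioppoli estimate needs to conclude \<open>K \<le> 0\<close>
(\<open>parabolic_maximum_principle\<close>).

The heat semigroup is obtained as the increasing limit of the Dirichlet semigroups \<open>exp(t \<Delta>\<^sub>F)\<close> of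
finite vertex sets \<open>F\<close>. The Laplacian maps finitely supported functions to finitely supported ones, so
the first-order Taylor expansion of \<open>exp(t \<Delta>\<^sub>F) \<phi>\<close> has an error of at most the \<open>l2\<close> norm of
\<open>\<Delta>\<^sup>2\<phi>\<close> times the square of the time step, uniformly in \<open>F\<close>, and the expansion survives in the limit (\<open>heat_taylor\<close>).
On a complete graph the operator domain is the set of all \<open>f\<close> in \<open>l2\<close> with \<open>\<Delta>f\<close> in \<open>l2\<close>
(\<open>dom_laplacian_eq\<close>), and the Laplacian is symmetric and dissipative there (\<open>green_Dmax\<close>,
\<open>laplacian_dissipative\<close>); this identifies the generator of the limit (\<open>heat_generated\<close>) and shows that no other
semigroup has it (\<open>semigroup_unique\<close>). Positivity, symmetry and the mass bound of the heat kernel are then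
inherited from the finite sets.
\<close>

section \<open>Calculus on a locally finite weighted graph\<close>

locale weighted =
  fixes G :: "'v wgraph"
  assumes wg: "weighted_graph G"
begin

abbreviation "m \<equiv> vmeas G"
abbreviation "w \<equiv> weight G"
abbreviation "L \<equiv> laplacian G"
abbreviation "\<Gamma> f \<equiv> grad_form G f f"

lemma m_pos [simp]: "0 < m x"
  and w_sym: "w x y = w y x"
  and w_pos: "(x, y) \<in> edges G \<Longrightarrow> 0 < w x y"
  and w_zero: "(x, y) \<notin> edges G \<Longrightarrow> w x y = 0"
  and finite_nbrs [simp]: "finite (nbrs G x)"
  and connected_edges: "(x, y) \<in> (edges G)\<^sup>*"
  using wg unfolding weighted_graph_def by auto

lemma m_nonneg [simp]: "0 \<le> m x" and m_neq0 [simp]: "m x \<noteq> 0"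
  using m_pos[of x] by linarith+

lemma w_nonneg [simp]: "0 \<le> w x y"
  using w_pos[of x y] w_zero[of x y] by (cases "(x, y) \<in> edges G") auto

lemma nbrs_sym: "y \<in> nbrs G x \<longleftrightarrow> x \<in> nbrs G y"
  using wg unfolding weighted_graph_def nbrs_def by (auto dest: symD)

lemma w_zero_nbrs: "y \<notin> nbrs G x \<Longrightarrow> w x y = 0"
  by (simp add: nbrs_def w_zero)

lemma laplacian_superset:
  assumes "finite A" "nbrs G x \<subseteq> A"
  shows "L f x = (\<Sum>y\<in>A. w x y * (f y - f x)) / m x"
  unfolding laplacian_def using assms
  by (subst sum.mono_neutral_left[of A "nbrs G x"]) (auto simp: w_zero_nbrs)

lemma grad_form_superset:
  assumes "finite A" "nbrs G x \<subseteq> A"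
  shows "grad_form G f g x = (\<Sum>y\<in>A. w x y * (f y - f x) * (g y - g x)) / (2 * m x)"
  unfolding grad_form_def using assms
  by (subst sum.mono_neutral_left[of A "nbrs G x"]) (auto simp: w_zero_nbrs)

lemma laplacian_lin: "L (\<lambda>x. a * f x + b * g x) x = a * L f x + b * L g x"
proof -
  have "(\<Sum>y\<in>nbrs G x. w x y * (a * f y + b * g y - (a * f x + b * g x)))
      = a * (\<Sum>y\<in>nbrs G x. w x y * (f y - f x)) + b * (\<Sum>y\<in>nbrs G x. w x y * (g y - g x))"
    unfolding sum_distrib_left sum.distrib[symmetric]
    by (rule sum.cong) (auto simp: algebra_simps)
  then show ?thesis by (simp add: laplacian_def add_divide_distrib)
qed

lemma laplacian_diff: "L (\<lambda>x. f x - g x) x = L f x - L g x"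
  using laplacian_lin[of 1 f "-1" g x] by simp

lemma laplacian_cmult: "L (\<lambda>x. a * f x) x = a * L f x"
  using laplacian_lin[of a f 0 "\<lambda>_. 0" x] by simp

lemma laplacian_add_const: "L (\<lambda>x. f x + c) x = L f x"
  by (simp add: laplacian_def)

text \<open>The discrete maximum principle at a point: raising \<open>f\<close> away from \<open>x\<close> raises its
Laplacian at \<open>x\<close>. It is used to pass from a function to its positive part.\<close>

lemma laplacian_mono_at:
  assumes "f x = g x" "\<And>y. f y \<le> g y"
  shows "L f x \<le> L g x"
  unfolding laplacian_def using assms
  by (intro divide_right_mono sum_mono mult_left_mono) auto

lemma laplacian_tendsto:
  assumes "\<And>x. ((\<lambda>k. f k x) \<longlongrightarrow> g x) F"
  shows "((\<lambda>k. L (f k) x) \<longlongrightarrow> L g x) F"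
  unfolding laplacian_def by (intro tendsto_intros assms) auto

lemma laplacian_has_derivative:
  assumes "\<And>x. ((\<lambda>t. u t x) has_real_derivative v x) (at t within T)"
  shows "((\<lambda>t. L (u t) x) has_real_derivative L v x) (at t within T)"
  unfolding laplacian_def
  by (intro DERIV_cdivide DERIV_sum DERIV_cmult DERIV_diff assms)

lemma laplacian_square: "L (\<lambda>x. (h x)\<^sup>2) x = 2 * h x * L h x + 2 * \<Gamma> h x"
proof -
  have "(\<Sum>y\<in>nbrs G x. w x y * ((h y)\<^sup>2 - (h x)\<^sup>2)) =
     2 * h x * (\<Sum>y\<in>nbrs G x. w x y * (h y - h x)) + (\<Sum>y\<in>nbrs G x. w x y * (h y - h x) * (h y - h x))"
    unfolding sum_distrib_left sum.distrib[symmetric]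
    by (rule sum.cong) (auto simp: algebra_simps power2_eq_square)
  then show ?thesis by (simp add: laplacian_def grad_form_def add_divide_distrib)
qed

lemma grad_form_nonneg [simp]: "0 \<le> \<Gamma> f x"
  unfolding grad_form_def by (intro divide_nonneg_nonneg sum_nonneg) (auto simp: mult.assoc)

text \<open>Sums over such a set \<open>A\<close> see every edge that meets the support of \<open>g\<close>, so that summation by parts
over \<open>A\<close> produces no boundary terms.\<close>

definition absorbs :: "'v set \<Rightarrow> ('v \<Rightarrow> real) \<Rightarrow> bool" where
  "absorbs A g \<longleftrightarrow> finite A \<and> (\<forall>x. g x \<noteq> 0 \<longrightarrow> x \<in> A \<and> nbrs G x \<subseteq> A)"

definition nbhd :: "'v set \<Rightarrow> 'v set" where
  "nbhd A = A \<union> (\<Union>x\<in>A. nbrs G x)"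

lemma finite_nbhd [simp]: "finite A \<Longrightarrow> finite (nbhd A)"
  by (simp add: nbhd_def)

lemma nbhd_subset: "A \<subseteq> nbhd A" and nbrs_subset_nbhd: "x \<in> A \<Longrightarrow> nbrs G x \<subseteq> nbhd A"
  by (auto simp: nbhd_def)

lemma absorbs_nbhd:
  assumes "finite A" "\<And>x. g x \<noteq> 0 \<Longrightarrow> x \<in> A"
  shows "absorbs (nbhd A) g"
  using assms unfolding absorbs_def nbhd_def by auto

lemma C0_absorbed:
  assumes "g \<in> C0" "finite F"
  obtains A where "absorbs A g" "F \<subseteq> A"
proof
  show "absorbs (nbhd ({x. g x \<noteq> 0} \<union> F)) g"
    using assms by (intro absorbs_nbhd) (auto simp: C0_def)
  show "F \<subseteq> nbhd ({x. g x \<noteq> 0} \<union> F)" by (auto simp: nbhd_def)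
qed

lemma laplacian_support: "x \<notin> nbhd {x. g x \<noteq> 0} \<Longrightarrow> L g x = 0"
proof -
  assume "x \<notin> nbhd {x. g x \<noteq> 0}"
  then have "g x = 0" "\<And>y. y \<in> nbrs G x \<Longrightarrow> g y = 0"
    using nbrs_sym[of _ x] by (auto simp: nbhd_def)
  then show "L g x = 0" by (simp add: laplacian_def)
qed

text \<open>Local finiteness makes the finitely supported functions invariant under the Laplacian. All estimates for
the semigroup on these functions may therefore involve arbitrary powers of the Laplacian.\<close>

lemma laplacian_C0: "g \<in> C0 \<Longrightarrow> L g \<in> C0"
  using laplacian_support[of _ g] unfolding C0_def
  by (auto intro: finite_subset[OF _ finite_nbhd[of "{x. g x \<noteq> 0}"]])

text \<open>Summation by parts: exchanging the two summation variables and averaging turns the one-sided sum into the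
symmetric one.\<close>

lemma green:
  assumes "absorbs A g"
  shows "(\<Sum>x\<in>A. g x * L f x * m x) = - (\<Sum>x\<in>A. \<Sum>y\<in>A. w x y * (f y - f x) * (g y - g x)) / 2"
proof -
  let ?T = "\<Sum>x\<in>A. \<Sum>y\<in>A. g x * (w x y * (f y - f x))"
  have fin: "finite A" using assms by (simp add: absorbs_def)
  have "g x * L f x * m x = (\<Sum>y\<in>A. g x * (w x y * (f y - f x)))" for x
  proof (cases "g x = 0")
    case False
    then have "L f x = (\<Sum>y\<in>A. w x y * (f y - f x)) / m x"
      using assms by (intro laplacian_superset) (auto simp: absorbs_def)
    then show ?thesis by (simp add: sum_distrib_left)
  qed simp
  then have T: "(\<Sum>x\<in>A. g x * L f x * m x) = ?T" by simp
  have "?T = (\<Sum>x\<in>A. \<Sum>y\<in>A. g y * (w y x * (f x - f y)))"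
    by (rule sum.swap)
  also have "\<dots> = (\<Sum>x\<in>A. \<Sum>y\<in>A. - (g y * (w x y * (f y - f x))))"
    by (intro sum.cong refl) (auto simp: w_sym algebra_simps)
  finally have "2 * ?T = ?T + (\<Sum>x\<in>A. \<Sum>y\<in>A. - (g y * (w x y * (f y - f x))))" by simp
  also have "\<dots> = (\<Sum>x\<in>A. \<Sum>y\<in>A. - (w x y * (f y - f x) * (g y - g x)))"
    unfolding sum.distrib[symmetric] by (intro sum.cong refl) (auto simp: algebra_simps)
  finally show ?thesis unfolding T by (simp add: sum_negf)
qed

section \<open>The weighted l2 space through finite partial norms\<close>

definition nrm :: "'v set \<Rightarrow> ('v \<Rightarrow> real) \<Rightarrow> real" where
  "nrm F f = L2_set (\<lambda>x. f x * sqrt (m x)) F"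

definition ip :: "('v \<Rightarrow> real) \<Rightarrow> ('v \<Rightarrow> real) \<Rightarrow> real" where
  "ip f g = (\<Sum>\<^sub>\<infinity>x. f x * g x * m x)"

abbreviation N where "N \<equiv> l2_norm G"

lemma nrm_nonneg [simp]: "0 \<le> nrm F f" by (simp add: nrm_def)

lemma nrm_square: "(nrm F f)\<^sup>2 = (\<Sum>x\<in>F. (f x)\<^sup>2 * m x)"
  by (simp add: nrm_def L2_set_def sum_nonneg power_mult_distrib)

lemma nrm_triangle: "nrm F (\<lambda>x. f x + g x) \<le> nrm F f + nrm F g"
  unfolding nrm_def distrib_right by (rule L2_set_triangle_ineq)

lemma nrm_scale: "nrm F (\<lambda>x. a * f x) = \<bar>a\<bar> * nrm F f"
proof -
  have "nrm F (\<lambda>x. a * f x) = sqrt (a\<^sup>2 * (\<Sum>x\<in>F. (f x * sqrt (m x))\<^sup>2))"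
    by (simp add: nrm_def L2_set_def power_mult_distrib sum_distrib_left mult.assoc)
  then show ?thesis by (simp add: real_sqrt_mult nrm_def L2_set_def)
qed

lemma nrm_mult_le: "(\<Sum>x\<in>F. \<bar>f x * g x * m x\<bar>) \<le> nrm F f * nrm F g"
proof -
  have "(\<Sum>x\<in>F. \<bar>f x * g x * m x\<bar>) = (\<Sum>x\<in>F. \<bar>f x * sqrt (m x)\<bar> * \<bar>g x * sqrt (m x)\<bar>)"
    by (intro sum.cong refl) (simp add: abs_mult algebra_simps flip: power2_eq_square)
  also have "\<dots> \<le> nrm F f * nrm F g" unfolding nrm_def by (rule L2_set_mult_ineq)
  finally show ?thesis .
qed

lemma N_nonneg [simp]: "0 \<le> N f"
  unfolding l2_norm_def by (intro real_sqrt_ge_zero infsum_nonneg) auto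

lemma nrm_le_N:
  assumes "f \<in> l2 G" "finite F" shows "nrm F f \<le> N f"
proof -
  have "(\<Sum>x\<in>F. (f x)\<^sup>2 * m x) \<le> (\<Sum>\<^sub>\<infinity>x. (f x)\<^sup>2 * m x)"
    using assms by (intro finite_sum_le_infsum) (auto simp: l2_def)
  then have "(nrm F f)\<^sup>2 \<le> (N f)\<^sup>2"
    unfolding nrm_square l2_norm_def by (subst real_sqrt_pow2) (auto intro!: infsum_nonneg)
  then show ?thesis by (rule power2_le_imp_le) simp
qed

text \<open>Membership in \<open>l2\<close> and norm bounds reduce to uniform bounds on finite vertex sets. In this form
they are stable under pointwise limits and need only finite sums.\<close>

lemma l2_boundI:
  assumes "\<And>F. finite F \<Longrightarrow> nrm F f \<le> c"
  shows "f \<in> l2 G" and "N f \<le> c"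
proof -
  have c: "0 \<le> c" using assms[of "{}"] by (simp add: nrm_def)
  have le: "(\<Sum>x\<in>F. (f x)\<^sup>2 * m x) \<le> c\<^sup>2" if "finite F" for F
    using assms[OF that] by (simp flip: nrm_square add: power_mono)
  have sm: "(\<lambda>x. (f x)\<^sup>2 * m x) summable_on UNIV"
    by (rule nonneg_bdd_above_summable_on) (use le in \<open>auto intro!: bdd_aboveI[of _ "c\<^sup>2"]\<close>)
  then show "f \<in> l2 G" by (simp add: l2_def)
  have "(\<Sum>\<^sub>\<infinity>x. (f x)\<^sup>2 * m x) \<le> c\<^sup>2"
    by (rule infsum_le_finite_sums[OF sm]) (use le in auto)
  then show "N f \<le> c" unfolding l2_norm_def using c real_sqrt_le_mono by fastforce
qed

lemma l2_add: assumes "f \<in> l2 G" "g \<in> l2 G"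
  shows "(\<lambda>x. f x + g x) \<in> l2 G" "N (\<lambda>x. f x + g x) \<le> N f + N g"
proof -
  have "nrm F (\<lambda>x. f x + g x) \<le> N f + N g" if "finite F" for F
    using nrm_triangle[of F f g] nrm_le_N[OF assms(1) that] nrm_le_N[OF assms(2) that] by linarith
  from l2_boundI[OF this] show "(\<lambda>x. f x + g x) \<in> l2 G" "N (\<lambda>x. f x + g x) \<le> N f + N g" by auto
qed

lemma l2_scale: assumes "f \<in> l2 G"
  shows "(\<lambda>x. a * f x) \<in> l2 G" "N (\<lambda>x. a * f x) = \<bar>a\<bar> * N f"
proof -
  have *: "nrm F (\<lambda>x. a * f x) \<le> \<bar>a\<bar> * N f" if "finite F" "f \<in> l2 G" for F a f
    unfolding nrm_scale using that by (intro mult_left_mono nrm_le_N) auto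
  from l2_boundI[OF *] assms have 1: "(\<lambda>x. a * f x) \<in> l2 G" "N (\<lambda>x. a * f x) \<le> \<bar>a\<bar> * N f" by auto
  show "(\<lambda>x. a * f x) \<in> l2 G" by fact
  show "N (\<lambda>x. a * f x) = \<bar>a\<bar> * N f"
  proof (cases "a = 0")
    case True then show ?thesis by (simp add: l2_norm_def)
  next
    case False
    from l2_boundI(2)[OF *[OF _ 1(1), of _ "1/a"]] False
    have "N f \<le> N (\<lambda>x. a * f x) / \<bar>a\<bar>" by simp
    with False 1(2) show ?thesis by (simp add: field_simps)
  qed
qed

lemma l2_lin: assumes "f \<in> l2 G" "g \<in> l2 G"
  shows "(\<lambda>x. a * f x + b * g x) \<in> l2 G" "N (\<lambda>x. a * f x + b * g x) \<le> \<bar>a\<bar> * N f + \<bar>b\<bar> * N g"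
  using l2_add[of "\<lambda>x. a * f x" "\<lambda>x. b * g x"] l2_scale[OF assms(1), of a] l2_scale[OF assms(2), of b] by auto

lemma l2_diff: assumes "f \<in> l2 G" "g \<in> l2 G"
  shows "(\<lambda>x. f x - g x) \<in> l2 G" "N (\<lambda>x. f x - g x) \<le> N f + N g"
  using l2_lin[OF assms, of 1 "-1"] by auto

lemma l2_triangle_diff:
  assumes "(\<lambda>x. f x - g x) \<in> l2 G" "g \<in> l2 G"
  shows "f \<in> l2 G" "N f \<le> N (\<lambda>x. f x - g x) + N g"
  using l2_add[OF assms] by auto

lemma l2_point: assumes "f \<in> l2 G" shows "\<bar>f x\<bar> * sqrt (m x) \<le> N f"
  using nrm_le_N[OF assms, of "{x}"] by (simp add: nrm_def abs_mult)

lemma l2_minus_commute: "N (\<lambda>x. f x - g x) = N (\<lambda>x. g x - f x)"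
  by (simp add: l2_norm_def power2_commute)

lemma nrm_tendsto:
  assumes "\<And>x. x \<in> F \<Longrightarrow> ((\<lambda>k. f k x) \<longlongrightarrow> g x) H"
  shows "((\<lambda>k. nrm F (f k)) \<longlongrightarrow> nrm F g) H"
  unfolding nrm_def L2_set_def by (intro tendsto_intros assms)

text \<open>Fatou's lemma. The bound on each finite set is required only eventually, because the approximating
functions will live on an exhaustion and see a given finite set only from some index on.\<close>

lemma l2_fatou:
  assumes "\<And>x. (\<lambda>k. f k x) \<longlonglongrightarrow> g x"
    and "\<And>F. finite F \<Longrightarrow> \<forall>\<^sub>F k in sequentially. nrm F (f k) \<le> c"
  shows "g \<in> l2 G" "N g \<le> c"
proof -
  have "nrm F g \<le> c" if "finite F" for F
    by (rule tendsto_upperbound[OF nrm_tendsto[OF assms(1)] assms(2)[OF that]]) auto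
  from l2_boundI[OF this] show "g \<in> l2 G" "N g \<le> c" by auto
qed

lemma C0_l2: assumes "g \<in> C0" shows "g \<in> l2 G"
proof -
  have "(\<lambda>x. (g x)\<^sup>2 * m x) summable_on UNIV"
    using assms by (intro finite_nonzero_values_imp_summable_on) (auto simp: C0_def elim: rev_finite_subset)
  then show ?thesis by (simp add: l2_def)
qed

lemma ip_abs_summable: assumes "f \<in> l2 G" "g \<in> l2 G"
  shows "(\<lambda>x. \<bar>f x * g x * m x\<bar>) summable_on UNIV"
    and "(\<Sum>\<^sub>\<infinity>x. \<bar>f x * g x * m x\<bar>) \<le> N f * N g"
proof -
  have le: "(\<Sum>x\<in>F. \<bar>f x * g x * m x\<bar>) \<le> N f * N g" if "finite F" for F
    by (rule order_trans[OF nrm_mult_le]) (intro mult_mono nrm_le_N assms that nrm_nonneg N_nonneg)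
  show 1: "(\<lambda>x. \<bar>f x * g x * m x\<bar>) summable_on UNIV"
    by (rule nonneg_bdd_above_summable_on) (use le in \<open>auto intro!: bdd_aboveI[of _ "N f * N g"]\<close>)
  show "(\<Sum>\<^sub>\<infinity>x. \<bar>f x * g x * m x\<bar>) \<le> N f * N g"
    by (rule infsum_le_finite_sums[OF 1]) (use le in auto)
qed

lemma ip_summable: assumes "f \<in> l2 G" "g \<in> l2 G"
  shows "(\<lambda>x. f x * g x * m x) summable_on UNIV"
  by (subst summable_on_iff_abs_summable_on_real) (use ip_abs_summable(1)[OF assms] in simp)

lemma ip_le: assumes "f \<in> l2 G" "g \<in> l2 G" shows "\<bar>ip f g\<bar> \<le> N f * N g"
proof -
  have "\<bar>ip f g\<bar> \<le> (\<Sum>\<^sub>\<infinity>x. \<bar>f x * g x * m x\<bar>)"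
    unfolding ip_def using norm_infsum_bound[of "\<lambda>x. f x * g x * m x" UNIV] ip_abs_summable(1)[OF assms] by simp
  then show ?thesis using ip_abs_summable(2)[OF assms] by linarith
qed

lemma ip_sym: "ip f g = ip g f"
  unfolding ip_def by (simp add: mult.commute)

lemma ip_lin: assumes "f \<in> l2 G" "g \<in> l2 G" "h \<in> l2 G"
  shows "ip h (\<lambda>x. a * f x + b * g x) = a * ip h f + b * ip h g"
proof -
  have "ip h (\<lambda>x. a * f x + b * g x) = (\<Sum>\<^sub>\<infinity>x. a * (h x * f x * m x) + b * (h x * g x * m x))"
    unfolding ip_def by (rule infsum_cong) (auto simp: algebra_simps)
  also have "\<dots> = a * ip h f + b * ip h g"
    unfolding ip_def using ip_summable[of h f] ip_summable[of h g] assms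
    by (subst infsum_add) (auto intro: summable_on_cmult_right simp: infsum_cmult_right)
  finally show ?thesis .
qed

lemma ip_diff: assumes "f \<in> l2 G" "g \<in> l2 G" "h \<in> l2 G"
  shows "ip h (\<lambda>x. f x - g x) = ip h f - ip h g"
  using ip_lin[OF assms, of 1 "-1"] by simp

lemma ip_self: "ip f f = (N f)\<^sup>2"
  unfolding ip_def l2_norm_def by (subst real_sqrt_pow2) (auto intro!: infsum_nonneg simp: power2_eq_square)

lemma ip_finite:
  assumes "finite A" "\<And>x. x \<notin> A \<Longrightarrow> f x * g x = 0"
  shows "ip f g = (\<Sum>x\<in>A. f x * g x * m x)"
proof -
  have "ip f g = (\<Sum>\<^sub>\<infinity>x\<in>A. f x * g x * m x)"
    unfolding ip_def by (rule infsum_cong_neutral) (use assms in auto)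
  then show ?thesis using assms(1) by simp
qed

definition restr :: "'v set \<Rightarrow> ('v \<Rightarrow> real) \<Rightarrow> 'v \<Rightarrow> real" where
  "restr A f x = (if x \<in> A then f x else 0)"

lemma restr_C0: "finite A \<Longrightarrow> restr A f \<in> C0"
  by (auto simp: C0_def restr_def elim: rev_finite_subset)

lemma restr_nrm: "finite F \<Longrightarrow> N (restr F f) = nrm F f"
proof -
  assume F: "finite F"
  have "(N (restr F f))\<^sup>2 = (nrm F f)\<^sup>2"
    unfolding ip_self[symmetric] nrm_square
    by (subst ip_finite[OF F]) (auto simp: restr_def power2_eq_square intro!: sum.cong)
  then show ?thesis by (simp add: power2_eq_iff_nonneg)
qed

end

lemma infsum_finite_approx:
  fixes g :: "'a \<Rightarrow> real"
  assumes "g summable_on UNIV" "0 < e"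
  obtains A where "finite A" "(\<Sum>\<^sub>\<infinity>x. g x) - e < sum g A"
proof -
  have "(sum g \<longlongrightarrow> (\<Sum>\<^sub>\<infinity>x. g x)) (finite_subsets_at_top UNIV)"
    using has_sum_infsum[OF assms(1)] by (simp add: has_sum_def)
  then have "\<forall>\<^sub>F A in finite_subsets_at_top UNIV. (\<Sum>\<^sub>\<infinity>x. g x) - e < sum g A"
    using assms(2) by (intro order_tendstoD) auto
  then have "\<exists>X. finite X \<and> (\<forall>Y. finite Y \<and> X \<subseteq> Y \<and> Y \<subseteq> UNIV \<longrightarrow> (\<Sum>\<^sub>\<infinity>x. g x) - e < sum g Y)"
    unfolding eventually_finite_subsets_at_top by auto
  then show ?thesis using that by blast
qed

text \<open>Dominated convergence for damping factors. Splitting off a finite set that carries almost the whole sum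
leaves finitely many terms, each of which tends to zero.\<close>

lemma infsum_damped_tendsto_0:
  fixes g :: "'a \<Rightarrow> real" and d :: "nat \<Rightarrow> 'a \<Rightarrow> real"
  assumes g: "g summable_on UNIV" "\<And>x. 0 \<le> g x"
    and d: "\<And>k x. 0 \<le> d k x" "\<And>k x. d k x \<le> 1" "\<And>x. (\<lambda>k. d k x) \<longlonglongrightarrow> 0"
  shows "(\<lambda>k. \<Sum>\<^sub>\<infinity>x. d k x * g x) \<longlonglongrightarrow> 0"
proof (rule LIMSEQ_I)
  fix e :: real assume e: "0 < e"
  obtain A where A: "finite A" "(\<Sum>\<^sub>\<infinity>x. g x) - e/2 < sum g A"
    using infsum_finite_approx[OF g(1), of "e/2"] e by auto
  have sm: "(\<lambda>x. d k x * g x) summable_on UNIV" for k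
    by (rule summable_on_comparison_test[OF g(1)]) (use d g in \<open>auto intro: mult_left_le_one_le\<close>)
  have bd: "(\<Sum>\<^sub>\<infinity>x. d k x * g x) \<le> (\<Sum>x\<in>A. d k x * g x) + e/2" for k
  proof (rule infsum_le_finite_sums[OF sm])
    fix F :: "'a set" assume F: "finite F"
    have "(\<Sum>x\<in>F. d k x * g x) \<le> (\<Sum>x\<in>F\<union>A. d k x * g x)"
      using F A d g by (intro sum_mono2) auto
    also have "\<dots> = (\<Sum>x\<in>A. d k x * g x) + (\<Sum>x\<in>F - A. d k x * g x)"
      using F A by (subst sum.union_disjoint[symmetric]) (auto intro: sum.cong)
    also have "(\<Sum>x\<in>F - A. d k x * g x) \<le> (\<Sum>x\<in>F - A. g x)"
      using d g by (intro sum_mono mult_left_le_one_le) auto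
    also have "(\<Sum>x\<in>F - A. g x) = (\<Sum>x\<in>F\<union>A. g x) - sum g A"
      using F A sum.union_disjoint[of "F - A" A g] by (simp add: Diff_Int_distrib2 Un_commute)
    also have "(\<Sum>x\<in>F\<union>A. g x) \<le> (\<Sum>\<^sub>\<infinity>x. g x)"
      using F A g by (intro finite_sum_le_infsum) auto
    finally show "(\<Sum>x\<in>F. d k x * g x) \<le> (\<Sum>x\<in>A. d k x * g x) + e/2" using A by simp
  qed
  have "(\<lambda>k. \<Sum>x\<in>A. d k x * g x) \<longlonglongrightarrow> (\<Sum>x\<in>A. 0 * g x)"
    by (intro tendsto_intros d)
  then have "\<forall>\<^sub>F k in sequentially. (\<Sum>x\<in>A. d k x * g x) < e/2"
    using e by (intro order_tendstoD) auto
  then obtain k0 where "\<And>k. k \<ge> k0 \<Longrightarrow> (\<Sum>x\<in>A. d k x * g x) < e/2"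
    by (auto simp: eventually_sequentially)
  moreover have "0 \<le> (\<Sum>\<^sub>\<infinity>x. d k x * g x)" for k
    using d g by (intro infsum_nonneg) auto
  ultimately show "\<exists>no. \<forall>n\<ge>no. norm ((\<Sum>\<^sub>\<infinity>x. d n x * g x) - 0) < e"
    using bd by (intro exI[of _ k0]) (smt (verit) field_sum_of_halves real_norm_def)
qed

context weighted begin

lemma l2_restr_approx:
  assumes "f \<in> l2 G" "0 < e"
  obtains A where "finite A" "N (\<lambda>x. f x - restr A f x) < e"
proof -
  let ?q = "\<lambda>x. (f x)\<^sup>2 * m x"
  have sm: "?q summable_on UNIV" using assms by (simp add: l2_def)
  obtain A where A: "finite A" "(\<Sum>\<^sub>\<infinity>x. ?q x) - (e/2)\<^sup>2 < sum ?q A"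
    using infsum_finite_approx[OF sm, of "(e/2)\<^sup>2"] assms by auto
  have "nrm F (\<lambda>x. f x - restr A f x) \<le> e/2" if F: "finite F" for F
  proof (rule power2_le_imp_le)
    have "(nrm F (\<lambda>x. f x - restr A f x))\<^sup>2 = sum ?q (F - A)"
      unfolding nrm_square using F by (intro sum.mono_neutral_cong_right) (auto simp: restr_def)
    also have "\<dots> = sum ?q (F \<union> A) - sum ?q A"
      using F A sum.union_disjoint[of "F - A" A ?q] by (simp add: Diff_Int_distrib2 Un_commute)
    also have "sum ?q (F \<union> A) \<le> (\<Sum>\<^sub>\<infinity>x. ?q x)"
      using F A by (intro finite_sum_le_infsum[OF sm]) auto
    finally show "(nrm F (\<lambda>x. f x - restr A f x))\<^sup>2 \<le> (e/2)\<^sup>2" using A by simp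
  qed (use assms in auto)
  from l2_boundI(2)[OF this] A(1) that[of A] assms(2) show ?thesis by force
qed

section \<open>Cutoff functions and the maximal domain of the Laplacian\<close>

text \<open>The inner sum is at most twice the gradient form of \<open>\<eta>\<close> times the measure. Cutoff functions enter the
estimates below only through this sum, so a small gradient is all that is asked of them.\<close>

lemma cutoff_error:
  assumes "finite A" "\<And>x. \<Gamma> \<eta> x \<le> c"
  shows "(\<Sum>x\<in>A. \<Sum>y\<in>A. w x y * (\<eta> y - \<eta> x)\<^sup>2 * (f x)\<^sup>2) \<le> 2 * c * (nrm A f)\<^sup>2"
proof -
  have "(\<Sum>x\<in>A. \<Sum>y\<in>A. w x y * (\<eta> y - \<eta> x)\<^sup>2 * (f x)\<^sup>2)
      = (\<Sum>x\<in>A. (\<Sum>y\<in>A. w x y * (\<eta> y - \<eta> x)\<^sup>2) * (f x)\<^sup>2)"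
    by (simp add: sum_distrib_right)
  also have "\<dots> \<le> (\<Sum>x\<in>A. (2 * m x * c) * (f x)\<^sup>2)"
  proof (intro sum_mono mult_right_mono)
    fix x assume "x \<in> A"
    have "(\<Sum>y\<in>A. w x y * (\<eta> y - \<eta> x)\<^sup>2) \<le> (\<Sum>y\<in>A \<union> nbrs G x. w x y * (\<eta> y - \<eta> x)\<^sup>2)"
      using assms by (intro sum_mono2) auto
    also have "\<dots> = 2 * m x * \<Gamma> \<eta> x"
      using assms by (subst grad_form_superset[of "A \<union> nbrs G x"]) (auto simp: power2_eq_square mult.assoc)
    also have "\<dots> \<le> 2 * m x * c" using assms by (intro mult_left_mono) auto
    finally show "(\<Sum>y\<in>A. w x y * (\<eta> y - \<eta> x)\<^sup>2) \<le> 2 * m x * c" .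
  qed auto
  also have "\<dots> = 2 * c * (nrm A f)\<^sup>2"
    unfolding nrm_square sum_distrib_left by (intro sum.cong refl) (auto simp: algebra_simps)
  finally show ?thesis .
qed

text \<open>Green's formula with the test function \<open>\<eta>\<^sup>2 f\<close>, after the identity
\<open>(a - b)(p\<^sup>2 a - q\<^sup>2 b) = (p a - q b)\<^sup>2 - (p - q)\<^sup>2 a b\<close>. The square is the energy of \<open>\<eta> f\<close>; the error term is
small when the gradient of \<open>\<eta>\<close> is. Energy bounds, dissipativity and the parabolic maximum
principle all come from this inequality.\<close>

lemma caccioppoli:
  assumes A: "absorbs A \<eta>" and c: "\<And>x. \<Gamma> \<eta> x \<le> c"
  shows "(\<Sum>x\<in>A. (\<eta> x)\<^sup>2 * f x * L f x * m x)
    \<le> c * (nrm A f)\<^sup>2 - (\<Sum>x\<in>A. \<Sum>y\<in>A. w x y * (\<eta> y * f y - \<eta> x * f x)\<^sup>2) / 2"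
proof -
  have fin: "finite A" using A by (simp add: absorbs_def)
  let ?g = "\<lambda>x. (\<eta> x)\<^sup>2 * f x"
  let ?S = "\<lambda>h. \<Sum>x\<in>A. \<Sum>y\<in>A. w x y * h x y"
  have "absorbs A ?g" using A by (auto simp: absorbs_def)
  from green[OF this, of f]
  have "(\<Sum>x\<in>A. ?g x * L f x * m x) = - ?S (\<lambda>x y. (f y - f x) * (?g y - ?g x)) / 2"
    by (simp add: mult.assoc)
  also have "?S (\<lambda>x y. (f y - f x) * (?g y - ?g x))
     = ?S (\<lambda>x y. (\<eta> y * f y - \<eta> x * f x)\<^sup>2 - (\<eta> y - \<eta> x)\<^sup>2 * (f x * f y))"
    by (intro sum.cong refl) (auto simp: algebra_simps power2_eq_square)
  also have "\<dots> = ?S (\<lambda>x y. (\<eta> y * f y - \<eta> x * f x)\<^sup>2) - ?S (\<lambda>x y. (\<eta> y - \<eta> x)\<^sup>2 * (f x * f y))"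
    by (simp add: right_diff_distrib sum_subtractf)
  finally have 1: "(\<Sum>x\<in>A. ?g x * L f x * m x) =
     ?S (\<lambda>x y. (\<eta> y - \<eta> x)\<^sup>2 * (f x * f y)) / 2 - ?S (\<lambda>x y. (\<eta> y * f y - \<eta> x * f x)\<^sup>2) / 2"
    by simp
  have sw: "?S (\<lambda>x y. (\<eta> y - \<eta> x)\<^sup>2 * (f y)\<^sup>2) = ?S (\<lambda>x y. (\<eta> y - \<eta> x)\<^sup>2 * (f x)\<^sup>2)"
    by (subst sum.swap) (intro sum.cong refl, auto simp: w_sym power2_commute)
  have "f x * f y \<le> ((f x)\<^sup>2 + (f y)\<^sup>2) / 2" for x y
    using sum_squares_bound[of "f x" "f y"] by simp
  then have "?S (\<lambda>x y. (\<eta> y - \<eta> x)\<^sup>2 * (f x * f y))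
      \<le> ?S (\<lambda>x y. (\<eta> y - \<eta> x)\<^sup>2 * (((f x)\<^sup>2 + (f y)\<^sup>2) / 2))"
    by (intro sum_mono mult_left_mono) auto
  also have "\<dots> = ?S (\<lambda>x y. (\<eta> y - \<eta> x)\<^sup>2 * (f x)\<^sup>2) / 2 + ?S (\<lambda>x y. (\<eta> y - \<eta> x)\<^sup>2 * (f y)\<^sup>2) / 2"
    unfolding sum_divide_distrib sum.distrib[symmetric]
    by (intro sum.cong refl) (auto simp: field_simps)
  also have "\<dots> = ?S (\<lambda>x y. (\<eta> y - \<eta> x)\<^sup>2 * (f x)\<^sup>2)" by (simp add: sw)
  also have "\<dots> \<le> 2 * c * (nrm A f)\<^sup>2"
    using cutoff_error[OF fin c, of f] by (simp add: mult.assoc)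
  finally show ?thesis unfolding 1 by simp
qed

lemma l2_damped:
  assumes "f \<in> l2 G" "\<And>x. \<bar>c x\<bar> \<le> 1"
  shows "(\<lambda>x. c x * f x) \<in> l2 G"
proof (rule l2_boundI)
  fix F :: "'v set" assume F: "finite F"
  have "nrm F (\<lambda>x. c x * f x) \<le> nrm F f"
  proof (rule power2_le_imp_le)
    show "(nrm F (\<lambda>x. c x * f x))\<^sup>2 \<le> (nrm F f)\<^sup>2"
      unfolding nrm_square power_mult_distrib using assms(2)
      by (intro sum_mono mult_right_mono mult_left_le_one_le) (auto simp: abs_square_le_1)
  qed simp
  then show "nrm F (\<lambda>x. c x * f x) \<le> N f" using nrm_le_N[OF assms(1) F] by linarith
qed

lemma ip_damped_tendsto:
  assumes f: "f \<in> l2 G" and g: "g \<in> l2 G"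
    and c: "\<And>k x. 0 \<le> c k x" "\<And>k x. c k x \<le> 1" "\<And>x. (\<lambda>k. c k x) \<longlonglongrightarrow> 1"
  shows "(\<lambda>k. ip g (\<lambda>x. c k x * f x)) \<longlonglongrightarrow> ip g f"
proof -
  have cf: "(\<lambda>x. c k x * f x) \<in> l2 G" for k
    by (rule l2_damped[OF f]) (use c in auto)
  have lim: "(\<lambda>k. \<Sum>\<^sub>\<infinity>x. (1 - c k x) * \<bar>g x * f x * m x\<bar>) \<longlonglongrightarrow> 0"
  proof (rule infsum_damped_tendsto_0[OF ip_abs_summable(1)[OF g f]])
    show "(\<lambda>k. 1 - c k x) \<longlonglongrightarrow> 0" for x
      using tendsto_diff[OF tendsto_const[of 1] c(3)[of x]] by simp
  qed (use c in auto)
  have "\<bar>ip g (\<lambda>x. c k x * f x) - ip g f\<bar> \<le> (\<Sum>\<^sub>\<infinity>x. (1 - c k x) * \<bar>g x * f x * m x\<bar>)" for k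
  proof -
    have df: "(\<lambda>x. c k x * f x - f x) \<in> l2 G" by (rule l2_diff[OF cf f])
    have "ip g (\<lambda>x. c k x * f x) - ip g f = ip g (\<lambda>x. c k x * f x - f x)"
      by (rule ip_diff[symmetric, OF cf f g])
    also have "\<bar>\<dots>\<bar> \<le> (\<Sum>\<^sub>\<infinity>x. \<bar>g x * (c k x * f x - f x) * m x\<bar>)"
      unfolding ip_def using norm_infsum_bound[of "\<lambda>x. g x * (c k x * f x - f x) * m x" UNIV]
        ip_abs_summable(1)[OF g df] by simp
    also have "(\<lambda>x. \<bar>g x * (c k x * f x - f x) * m x\<bar>) = (\<lambda>x. (1 - c k x) * \<bar>g x * f x * m x\<bar>)"
    proof
      fix x
      have "g x * (c k x * f x - f x) * m x = - ((1 - c k x) * (g x * f x * m x))" by (simp add: algebra_simps)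
      then show "\<bar>g x * (c k x * f x - f x) * m x\<bar> = (1 - c k x) * \<bar>g x * f x * m x\<bar>"
        using c(2)[of k x] by (simp add: abs_mult)
    qed
    finally show ?thesis .
  qed
  then have "(\<lambda>k. ip g (\<lambda>x. c k x * f x) - ip g f) \<longlonglongrightarrow> 0"
    by (intro Lim_null_comparison[OF always_eventually lim]) simp
  then show ?thesis by (rule LIM_zero_cancel)
qed

text \<open>The largest subspace of \<open>l2\<close> on which the Laplacian can act. Completeness of the graph makes it the
operator domain of the Laplacian.\<close>

definition Dmax :: "('v \<Rightarrow> real) set" where
  "Dmax = {f \<in> l2 G. L f \<in> l2 G}"

lemma C0_Dmax: "f \<in> C0 \<Longrightarrow> f \<in> Dmax"
  by (simp add: Dmax_def C0_l2 laplacian_C0)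

lemma DmaxD: "f \<in> Dmax \<Longrightarrow> f \<in> l2 G" "f \<in> Dmax \<Longrightarrow> L f \<in> l2 G"
  by (auto simp: Dmax_def)

lemma Dmax_diff: "f \<in> Dmax \<Longrightarrow> g \<in> Dmax \<Longrightarrow> (\<lambda>x. f x - g x) \<in> Dmax"
  by (simp add: Dmax_def l2_diff laplacian_diff[abs_def])

end

locale complete_weighted = weighted G for G :: "'v wgraph" +
  assumes complete: "complete_graph G"
begin

text \<open>Truncating the given cutoff functions at zero keeps their gradient bounds; monotone convergence to one
already keeps them below one.\<close>

lemma ex_cutoffs:
  "\<exists>\<eta>. (\<forall>k::nat. \<eta> k \<in> C0) \<and> (\<forall>k x. 0 \<le> \<eta> k x \<and> \<eta> k x \<le> 1) \<and> (\<forall>x. (\<lambda>k. \<eta> k x) \<longlonglongrightarrow> 1)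
     \<and> (\<forall>k x. \<Gamma> (\<eta> k) x \<le> 1 / real (Suc k))"
proof -
  from complete obtain \<eta> where e:
    "\<And>k::nat. k \<ge> 1 \<Longrightarrow> \<eta> k \<in> C0" "\<And>k x. k \<ge> 1 \<Longrightarrow> \<eta> k x \<le> \<eta> (Suc k) x"
    "\<And>x. (\<lambda>k. \<eta> k x) \<longlonglongrightarrow> 1" "\<And>k x. k \<ge> 1 \<Longrightarrow> \<Gamma> (\<eta> k) x \<le> 1 / real k"
    unfolding complete_graph_def by blast
  define \<zeta> where "\<zeta> k x = max 0 (\<eta> (Suc k) x)" for k x
  have lim: "(\<lambda>k. \<eta> (Suc k) x) \<longlonglongrightarrow> 1" for x
    using e(3)[of x] by (rule LIMSEQ_Suc)
  have "\<eta> (Suc k) x \<le> 1" for k x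
    using e(2) by (intro incseq_le[OF incseq_SucI lim]) auto
  then have "\<forall>k x. 0 \<le> \<zeta> k x \<and> \<zeta> k x \<le> 1" by (auto simp: \<zeta>_def)
  moreover have "\<zeta> k \<in> C0" for k
    using e(1)[of "Suc k"] unfolding C0_def \<zeta>_def by (auto elim: rev_finite_subset)
  moreover have "(\<lambda>k. \<zeta> k x) \<longlonglongrightarrow> 1" for x
    using tendsto_max[OF tendsto_const[of 0] lim[of x]] by (simp add: \<zeta>_def)
  moreover have "\<Gamma> (\<zeta> k) x \<le> 1 / real (Suc k)" for k x
  proof -
    have "(max 0 a - max 0 b) * (max 0 a - max 0 b) \<le> (a - b) * (a - b)" for a b :: real
    proof -
      have "\<bar>max 0 a - max 0 b\<bar> \<le> \<bar>a - b\<bar>" by (simp add: max_def)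
      then show ?thesis by (simp only: abs_le_square_iff power2_eq_square)
    qed
    then have "\<Gamma> (\<zeta> k) x \<le> \<Gamma> (\<eta> (Suc k)) x"
      unfolding grad_form_def \<zeta>_def mult.assoc
      by (intro divide_right_mono sum_mono mult_left_mono) auto
    then show ?thesis using e(4)[of "Suc k" x] by simp
  qed
  ultimately show ?thesis by (intro exI[of _ \<zeta>]) blast
qed

definition cutoff :: "nat \<Rightarrow> 'v \<Rightarrow> real" where
  "cutoff = (SOME \<eta>. (\<forall>k. \<eta> k \<in> C0) \<and> (\<forall>k x. 0 \<le> \<eta> k x \<and> \<eta> k x \<le> 1) \<and> (\<forall>x. (\<lambda>k. \<eta> k x) \<longlonglongrightarrow> 1)
     \<and> (\<forall>k x. \<Gamma> (\<eta> k) x \<le> 1 / real (Suc k)))"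

lemma cutoff: "cutoff k \<in> C0" "0 \<le> cutoff k x" "cutoff k x \<le> 1" "(\<lambda>k. cutoff k x) \<longlonglongrightarrow> 1"
    "\<Gamma> (cutoff k) x \<le> 1 / real (Suc k)"
  using someI_ex[OF ex_cutoffs] unfolding cutoff_def[symmetric] by blast+

lemma inverse_Suc_tendsto: "(\<lambda>k. c / real (Suc k)) \<longlonglongrightarrow> 0"
  using tendsto_mult[OF tendsto_const[of c] LIMSEQ_inverse_real_of_nat] by (simp add: divide_inverse)

text \<open>The energy of \<open>\<eta>\<^sub>k f\<close> is at most \<open>|f| |\<Delta>f| + |f|\<^sup>2/(k+1)\<close> by the Caccioppoli inequality; letting \<open>k\<close> grow
on a fixed finite set removes the cutoff.\<close>

lemma energy_bound:
  assumes f: "f \<in> Dmax" and F: "finite F"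
  shows "(\<Sum>x\<in>F. \<Sum>y\<in>F. w x y * (f y - f x)\<^sup>2) / 2 \<le> N f * N (L f)"
proof -
  have bd: "(\<Sum>x\<in>F. \<Sum>y\<in>F. w x y * (cutoff k y * f y - cutoff k x * f x)\<^sup>2) / 2
      \<le> N f * N (L f) + (N f)\<^sup>2 / real (Suc k)" for k
  proof -
    obtain A where A: "absorbs A (cutoff k)" "F \<subseteq> A" using C0_absorbed[OF cutoff(1) F] by blast
    then have fin: "finite A" by (simp add: absorbs_def)
    have "(\<Sum>x\<in>F. \<Sum>y\<in>F. w x y * (cutoff k y * f y - cutoff k x * f x)\<^sup>2)
       \<le> (\<Sum>x\<in>A. \<Sum>y\<in>A. w x y * (cutoff k y * f y - cutoff k x * f x)\<^sup>2)"
      unfolding sum.cartesian_product using fin A F by (intro sum_mono2) auto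
    moreover have "- (N f * N (L f)) \<le> (\<Sum>x\<in>A. (cutoff k x)\<^sup>2 * f x * L f x * m x)"
    proof -
      have "\<bar>\<Sum>x\<in>A. (cutoff k x)\<^sup>2 * f x * L f x * m x\<bar> \<le> (\<Sum>x\<in>A. \<bar>f x * L f x * m x\<bar>)"
      proof (rule order_trans[OF sum_abs sum_mono])
        fix x
        have "(cutoff k x)\<^sup>2 \<le> 1" using cutoff by (simp add: power_le_one)
        then have "(cutoff k x)\<^sup>2 * \<bar>f x * L f x * m x\<bar> \<le> \<bar>f x * L f x * m x\<bar>"
          by (intro mult_left_le_one_le) auto
        then show "\<bar>(cutoff k x)\<^sup>2 * f x * L f x * m x\<bar> \<le> \<bar>f x * L f x * m x\<bar>"
          by (simp add: abs_mult mult.assoc)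
      qed
      also have "\<dots> \<le> nrm A f * nrm A (L f)" by (rule nrm_mult_le)
      also have "\<dots> \<le> N f * N (L f)"
        using f fin by (intro mult_mono nrm_le_N) (auto simp: DmaxD)
      finally show ?thesis by linarith
    qed
    moreover have "1 / real (Suc k) * (nrm A f)\<^sup>2 \<le> 1 / real (Suc k) * (N f)\<^sup>2"
      using f fin by (intro mult_left_mono power_mono nrm_le_N) (auto simp: DmaxD)
    ultimately show ?thesis
      using caccioppoli[OF A(1) cutoff(5), of f] by (simp only: times_divide_eq_left mult_1)
  qed
  have "(\<lambda>k. (\<Sum>x\<in>F. \<Sum>y\<in>F. w x y * (cutoff k y * f y - cutoff k x * f x)\<^sup>2) / 2)
     \<longlonglongrightarrow> (\<Sum>x\<in>F. \<Sum>y\<in>F. w x y * (1 * f y - 1 * f x)\<^sup>2) / 2"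
    by (intro tendsto_intros cutoff) auto
  moreover have "(\<lambda>k. N f * N (L f) + (N f)\<^sup>2 / real (Suc k)) \<longlonglongrightarrow> N f * N (L f) + 0"
    by (intro tendsto_intros inverse_Suc_tendsto)
  ultimately show ?thesis
    using LIMSEQ_le[of _ _ _ "N f * N (L f)"] bd by fastforce
qed

lemma grad_form_sum_bound:
  assumes f: "f \<in> Dmax" and F: "finite F"
  shows "(\<Sum>x\<in>F. m x * \<Gamma> f x) \<le> N f * N (L f)"
proof -
  let ?A = "nbhd F"
  have "m x * \<Gamma> f x = (\<Sum>y\<in>?A. w x y * (f y - f x)\<^sup>2) / 2" if "x \<in> F" for x
    using that F by (subst grad_form_superset[of ?A]) (auto simp: nbrs_subset_nbhd power2_eq_square mult.assoc)
  then have "(\<Sum>x\<in>F. m x * \<Gamma> f x) = (\<Sum>x\<in>F. \<Sum>y\<in>?A. w x y * (f y - f x)\<^sup>2) / 2"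
    by (simp add: sum_divide_distrib)
  also have "\<dots> \<le> (\<Sum>x\<in>?A. \<Sum>y\<in>?A. w x y * (f y - f x)\<^sup>2) / 2"
    using F nbhd_subset[of F] by (intro divide_right_mono sum_mono2 sum_nonneg) auto
  also have "\<dots> \<le> N f * N (L f)" using F by (intro energy_bound f) auto
  finally show ?thesis .
qed

text \<open>The cutoff version of this pairing is at most \<open>|f|\<^sup>2/(k+1)\<close>, since the energy term in the
Caccioppoli inequality has the good sign.\<close>

lemma laplacian_dissipative:
  assumes f: "f \<in> Dmax" shows "ip f (L f) \<le> 0"
proof -
  have "(\<lambda>k. ip f (\<lambda>x. (cutoff k x)\<^sup>2 * L f x)) \<longlonglongrightarrow> ip f (L f)"
    using cutoff tendsto_power[OF cutoff(4), where n = 2]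
    by (intro ip_damped_tendsto DmaxD f) (auto simp: power_le_one)
  moreover have "ip f (\<lambda>x. (cutoff k x)\<^sup>2 * L f x) \<le> (N f)\<^sup>2 / real (Suc k)" for k
  proof -
    obtain A where A: "absorbs A (cutoff k)" using C0_absorbed[OF cutoff(1), of "{}"] by blast
    then have fin: "finite A" by (simp add: absorbs_def)
    have "ip f (\<lambda>x. (cutoff k x)\<^sup>2 * L f x) = (\<Sum>x\<in>A. (cutoff k x)\<^sup>2 * f x * L f x * m x)"
      using A by (subst ip_finite[OF fin]) (auto simp: absorbs_def algebra_simps intro!: sum.cong)
    also have "\<dots> \<le> 1 / real (Suc k) * (nrm A f)\<^sup>2"
      using caccioppoli[OF A cutoff(5), of f]
      by (smt (verit) divide_nonneg_nonneg mult_nonneg_nonneg sum_nonneg w_nonneg zero_le_power2)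
    also have "\<dots> \<le> 1 / real (Suc k) * (N f)\<^sup>2"
      using f fin by (intro mult_left_mono power_mono nrm_le_N) (auto simp: DmaxD)
    finally show ?thesis by simp
  qed
  ultimately show ?thesis using LIMSEQ_le[OF _ inverse_Suc_tendsto[of "(N f)\<^sup>2"]] by blast
qed

text \<open>The error in the symmetric Green formula when a cutoff is inserted. The inequality of arithmetic and
geometric means is weighted by \<open>\<surd>c\<close> so that the gradient of the cutoff, of size \<open>c\<close>, and the
finite energy of \<open>g\<close> both end up with a factor \<open>\<surd>c\<close>.\<close>

lemma cutoff_cross_term:
  assumes A: "finite A" and \<eta>: "\<And>x. \<Gamma> \<eta> x \<le> c" and c: "0 < c"
    and f: "f \<in> l2 G" and g: "g \<in> Dmax"
  shows "\<bar>\<Sum>x\<in>A. \<Sum>y\<in>A. w x y * (\<eta> y - \<eta> x) * f x * (g y - g x)\<bar>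
      \<le> sqrt c * ((N f)\<^sup>2 + N g * N (L g))"
proof -
  let ?S = "\<lambda>h. \<Sum>x\<in>A. \<Sum>y\<in>A. w x y * h x y"
  let ?a = "\<lambda>x y. (\<eta> y - \<eta> x) * f x" and ?b = "\<lambda>x y. g y - g x"
  have amgm: "\<bar>a * b\<bar> \<le> a\<^sup>2 / sqrt c / 2 + sqrt c * b\<^sup>2 / 2" for a b :: real
  proof -
    have "0 \<le> (\<bar>a\<bar> - sqrt c * \<bar>b\<bar>)\<^sup>2" by simp
    then have "2 * sqrt c * \<bar>a * b\<bar> \<le> a\<^sup>2 + c * b\<^sup>2"
      using c by (simp add: power2_diff power_mult_distrib abs_mult mult_ac)
    then have "\<bar>a * b\<bar> \<le> (a\<^sup>2 + c * b\<^sup>2) / (2 * sqrt c)"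
      using c by (subst pos_le_divide_eq) (auto simp: mult_ac)
    also have "\<dots> = a\<^sup>2 / sqrt c / 2 + (c / sqrt c) * b\<^sup>2 / 2"
      by (simp add: add_divide_distrib)
    also have "c / sqrt c = sqrt c" using c by (simp add: real_div_sqrt)
    finally show ?thesis .
  qed
  have "\<bar>?S (\<lambda>x y. ?a x y * ?b x y)\<bar> \<le> ?S (\<lambda>x y. \<bar>?a x y * ?b x y\<bar>)"
    by (intro order_trans[OF sum_abs sum_mono] order_trans[OF sum_abs sum_mono]) (simp add: abs_mult)
  also have "\<dots> \<le> ?S (\<lambda>x y. (?a x y)\<^sup>2 / sqrt c / 2 + sqrt c * (?b x y)\<^sup>2 / 2)"
    by (intro sum_mono mult_left_mono amgm) auto
  also have "\<dots> = ?S (\<lambda>x y. (\<eta> y - \<eta> x)\<^sup>2 * (f x)\<^sup>2) / sqrt c / 2 + sqrt c * (?S (\<lambda>x y. (?b x y)\<^sup>2) / 2)"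
    unfolding sum_divide_distrib sum_distrib_left sum.distrib[symmetric]
    by (intro sum.cong refl) (auto simp: power_mult_distrib distrib_left)
  also have "\<dots> \<le> (2 * c * (N f)\<^sup>2) / sqrt c / 2 + sqrt c * (N g * N (L g))"
  proof (intro add_mono divide_right_mono mult_left_mono energy_bound g A)
    have "?S (\<lambda>x y. (\<eta> y - \<eta> x)\<^sup>2 * (f x)\<^sup>2) \<le> 2 * c * (nrm A f)\<^sup>2"
      using cutoff_error[OF A \<eta>, of f] by (simp add: mult.assoc)
    also have "\<dots> \<le> 2 * c * (N f)\<^sup>2"
      using f A c by (intro mult_left_mono power_mono nrm_le_N) auto
    finally show "?S (\<lambda>x y. (\<eta> y - \<eta> x)\<^sup>2 * (f x)\<^sup>2) \<le> 2 * c * (N f)\<^sup>2" .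
  qed (use c in auto)
  also have "(2 * c * (N f)\<^sup>2) / sqrt c / 2 = sqrt c * (N f)\<^sup>2"
    using c real_div_sqrt[of c] by (simp add: field_simps)
  finally show ?thesis by (simp add: mult.assoc distrib_left)
qed

text \<open>Symmetry of the Laplacian on the maximal domain: in the difference of the two truncated pairings all terms
cancel except those that contain an increment of the cutoff, and these vanish in the limit.\<close>

lemma green_Dmax:
  assumes f: "f \<in> Dmax" and g: "g \<in> Dmax"
  shows "ip f (L g) = ip (L f) g"
proof -
  define I where "I k = ip f (\<lambda>x. cutoff k x * L g x) - ip g (\<lambda>x. cutoff k x * L f x)" for k
  have lim: "I \<longlonglongrightarrow> ip f (L g) - ip g (L f)"
    unfolding I_def by (intro tendsto_diff ip_damped_tendsto DmaxD f g cutoff)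
  define C where "C = (N f)\<^sup>2 + N g * N (L g) + ((N g)\<^sup>2 + N f * N (L f))"
  have bd: "\<bar>I k\<bar> \<le> sqrt (1 / real (Suc k)) * C" for k
  proof -
    obtain A where A: "absorbs A (cutoff k)" using C0_absorbed[OF cutoff(1), of "{}"] by blast
    then have fin: "finite A" by (simp add: absorbs_def)
    let ?S = "\<lambda>h. \<Sum>x\<in>A. \<Sum>y\<in>A. h x y"
    have *: "ip u (\<lambda>x. cutoff k x * L v x) = - ?S (\<lambda>x y. w x y * (v y - v x) * (cutoff k y * u y - cutoff k x * u x)) / 2" for u v
    proof -
      have "ip u (\<lambda>x. cutoff k x * L v x) = (\<Sum>x\<in>A. (cutoff k x * u x) * L v x * m x)"
        using A by (subst ip_finite[OF fin]) (auto simp: absorbs_def algebra_simps intro!: sum.cong)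
      also have "\<dots> = - ?S (\<lambda>x y. w x y * (v y - v x) * (cutoff k y * u y - cutoff k x * u x)) / 2"
        using A by (intro green) (auto simp: absorbs_def)
      finally show ?thesis .
    qed
    let ?X = "\<lambda>u v. ?S (\<lambda>x y. w x y * (cutoff k y - cutoff k x) * u x * (v y - v x))"
    have "?S (\<lambda>x y. w x y * (g y - g x) * (cutoff k y * f y - cutoff k x * f x))
        - ?S (\<lambda>x y. w x y * (f y - f x) * (cutoff k y * g y - cutoff k x * g x)) = ?X f g - ?X g f"
      unfolding sum_subtractf[symmetric] by (intro sum.cong refl) (simp add: algebra_simps)
    moreover have "a - b = c - d \<Longrightarrow> - a / 2 - - b / 2 = (d - c) / 2" for a b c d :: real
      by (simp add: field_simps)
    ultimately have "I k = (?X g f - ?X f g) / 2" unfolding I_def * by blast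
    moreover have "\<bar>?X f g\<bar> \<le> sqrt (1 / real (Suc k)) * ((N f)\<^sup>2 + N g * N (L g))"
      "\<bar>?X g f\<bar> \<le> sqrt (1 / real (Suc k)) * ((N g)\<^sup>2 + N f * N (L f))"
      using fin cutoff f g by (intro cutoff_cross_term; auto simp: DmaxD)+
    moreover have "i = (b - a) / 2 \<Longrightarrow> \<bar>a\<bar> \<le> p \<Longrightarrow> \<bar>b\<bar> \<le> q \<Longrightarrow> \<bar>i\<bar> \<le> p + q" for i a b p q :: real
      by (simp add: abs_le_iff)
    ultimately show ?thesis unfolding C_def distrib_left[of _ "_ + _" "_ + _"] by blast
  qed
  have "(\<lambda>k. sqrt (1 / real (Suc k)) * C) \<longlonglongrightarrow> sqrt 0 * C"
    by (intro tendsto_intros inverse_Suc_tendsto)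
  then have "I \<longlonglongrightarrow> 0"
    using bd by (intro Lim_null_comparison[OF always_eventually, of I]) auto
  with lim have "ip f (L g) - ip g (L f) = 0" by (rule LIMSEQ_unique)
  then show ?thesis by (simp add: ip_sym[of g])
qed

lemma Dmax_finite_energy:
  assumes "f \<in> Dmax" shows "finite_energy G f"
  unfolding finite_energy_def
proof (rule nonneg_bdd_above_summable_on)
  show "bdd_above (sum (\<lambda>(x, y). w x y * (f y - f x)\<^sup>2) ` {F. F \<subseteq> UNIV \<and> finite F})"
  proof (rule bdd_aboveI2)
    fix P :: "('v \<times> 'v) set" assume P: "P \<in> {F. F \<subseteq> UNIV \<and> finite F}"
    let ?F = "fst ` P \<union> snd ` P"
    let ?e = "\<lambda>(x, y). w x y * (f y - f x)\<^sup>2"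
    have "P \<subseteq> ?F \<times> ?F" by force
    then have "sum ?e P \<le> sum ?e (?F \<times> ?F)"
      using P by (intro sum_mono2) auto
    also have "\<dots> \<le> 2 * (N f * N (L f))"
      using energy_bound[OF assms, of ?F] P by (simp add: sum.cartesian_product)
    finally show "sum (\<lambda>(x, y). w x y * (f y - f x)\<^sup>2) P \<le> 2 * (N f * N (L f))" .
  qed
qed auto

text \<open>The increments of \<open>(1 - \<eta>) f\<close> split into \<open>(1 - \<eta>)\<close> times an increment of \<open>f\<close>, whose energy
tends to zero by dominated convergence, and \<open>f\<close> times an increment of \<open>\<eta>\<close>, whose energy is
of order \<open>1/(k+1)\<close>.\<close>

lemma Dmax_cutoff_Q_norm:
  assumes f: "f \<in> Dmax"
  shows "(\<lambda>k. Q_norm G (\<lambda>x. cutoff k x * f x - f x)) \<longlonglongrightarrow> 0"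
proof -
  have fl2: "f \<in> l2 G" using f by (rule DmaxD)
  have d: "(\<lambda>k. (1 - cutoff k x)\<^sup>2) \<longlonglongrightarrow> 0" for x
    using tendsto_power[OF tendsto_diff[OF tendsto_const[of 1] cutoff(4)[of x]], of 2] by simp
  have d1: "0 \<le> (1 - cutoff k x)\<^sup>2" "(1 - cutoff k x)\<^sup>2 \<le> 1" for k x
    using cutoff(2,3)[of k x] by (auto simp: power_le_one)
  let ?g = "\<lambda>k x. cutoff k x * f x - f x"
  have N2: "(N (?g k))\<^sup>2 = (\<Sum>\<^sub>\<infinity>x. (1 - cutoff k x)\<^sup>2 * ((f x)\<^sup>2 * m x))" for k
    unfolding ip_self[symmetric] ip_def by (rule infsum_cong) (auto simp: power2_eq_square algebra_simps)
  have lim1: "(\<lambda>k. (N (?g k))\<^sup>2) \<longlonglongrightarrow> 0"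
    unfolding N2 using fl2 by (intro infsum_damped_tendsto_0 d d1) (auto simp: l2_def)
  let ?E = "\<lambda>p. case p of (x, y) \<Rightarrow> w x y * (f y - f x)\<^sup>2"
  let ?D = "\<lambda>k p. (1 - cutoff k (fst p))\<^sup>2"
  have sumE: "?E summable_on UNIV" using Dmax_finite_energy[OF f] by (simp add: finite_energy_def)
  have lim2: "(\<lambda>k. \<Sum>\<^sub>\<infinity>p. ?D k p * ?E p) \<longlonglongrightarrow> 0"
    by (intro infsum_damped_tendsto_0[OF sumE] d d1) auto
  have sumDE: "(\<lambda>p. ?D k p * ?E p) summable_on UNIV" for k
    by (rule summable_on_comparison_test[OF sumE]) (use d1 in \<open>auto intro: mult_left_le_one_le\<close>)
  let ?q = "\<lambda>k p. case p of (x, y) \<Rightarrow> w x y * (?g k y - ?g k x) * (?g k y - ?g k x)"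
  have q0: "0 \<le> ?q k p" for k p by (auto simp: mult.assoc split: prod.split)
  define R where "R k = 2 * (\<Sum>\<^sub>\<infinity>p. ?D k p * ?E p) + 4 * (N f)\<^sup>2 / real (Suc k)" for k
  have bd: "sum (?q k) P \<le> R k" if P: "finite P" for k P
  proof -
    let ?F = "fst ` P \<union> snd ` P"
    have PF: "P \<subseteq> ?F \<times> ?F" by force
    have fin: "finite ?F" using P by auto
    let ?r = "\<lambda>p. case p of (x, y) \<Rightarrow> w x y * (cutoff k y - cutoff k x)\<^sup>2 * (f y)\<^sup>2"
    have "?q k p \<le> 2 * (?D k p * ?E p) + 2 * ?r p" for p
    proof (cases p)
      case (Pair x y)
      have "?g k y - ?g k x = - (1 - cutoff k x) * (f y - f x) + (cutoff k y - cutoff k x) * f y"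
        by (simp add: algebra_simps)
      moreover have "(a + b) * (a + b) \<le> 2 * a\<^sup>2 + 2 * b\<^sup>2" for a b :: real
        using sum_squares_bound[of a b] by (simp add: power2_eq_square algebra_simps)
      ultimately have "(?g k y - ?g k x) * (?g k y - ?g k x)
          \<le> 2 * ((1 - cutoff k x) * (f y - f x))\<^sup>2 + 2 * ((cutoff k y - cutoff k x) * f y)\<^sup>2"
        by (metis minus_mult_left power2_minus)
      then have "w x y * ((?g k y - ?g k x) * (?g k y - ?g k x))
          \<le> w x y * (2 * ((1 - cutoff k x) * (f y - f x))\<^sup>2 + 2 * ((cutoff k y - cutoff k x) * f y)\<^sup>2)"
        by (intro mult_left_mono) auto
      moreover have "W * (2 * (a * b)\<^sup>2 + 2 * (c * d)\<^sup>2) = 2 * (a\<^sup>2 * (W * b\<^sup>2)) + 2 * (W * c\<^sup>2 * d\<^sup>2)"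
        for W a b c d :: real by (simp add: power_mult_distrib algebra_simps)
      ultimately show ?thesis unfolding Pair by (simp only: prod.case fst_conv mult.assoc)
    qed
    then have "sum (?q k) P \<le> (\<Sum>p\<in>P. 2 * (?D k p * ?E p) + 2 * ?r p)" by (rule sum_mono)
    also have "\<dots> = 2 * (\<Sum>p\<in>P. ?D k p * ?E p) + 2 * sum ?r P"
      by (simp add: sum.distrib sum_distrib_left)
    also have "(\<Sum>p\<in>P. ?D k p * ?E p) \<le> (\<Sum>\<^sub>\<infinity>p. ?D k p * ?E p)"
      using P d1 by (intro finite_sum_le_infsum sumDE) auto
    also have "sum ?r P \<le> sum ?r (?F \<times> ?F)"
      using fin PF by (intro sum_mono2) auto
    also have "\<dots> = (\<Sum>x\<in>?F. \<Sum>y\<in>?F. w x y * (cutoff k y - cutoff k x)\<^sup>2 * (f y)\<^sup>2)"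
      by (simp add: sum.cartesian_product)
    also have "\<dots> = (\<Sum>x\<in>?F. \<Sum>y\<in>?F. w x y * (cutoff k y - cutoff k x)\<^sup>2 * (f x)\<^sup>2)"
      by (subst sum.swap) (intro sum.cong refl, simp add: w_sym power2_commute)
    also have "\<dots> \<le> 2 * (1 / real (Suc k)) * (nrm ?F f)\<^sup>2"
      by (rule cutoff_error[OF fin cutoff(5)])
    also have "\<dots> \<le> 2 * (1 / real (Suc k)) * (N f)\<^sup>2"
      using fin fl2 by (intro mult_left_mono power_mono nrm_le_N) auto
    finally show ?thesis by (simp add: R_def)
  qed
  have "?q k summable_on UNIV" for k
    by (rule nonneg_bdd_above_summable_on) (use q0 bd in \<open>auto intro!: bdd_aboveI2[of _ _ "R k"]\<close>)
  then have Q1: "Q_form G (?g k) (?g k) \<le> R k / 2" for k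
    unfolding Q_form_def using bd by (intro divide_right_mono infsum_le_finite_sums) auto
  have Q0: "0 \<le> Q_form G (?g k) (?g k)" for k
    unfolding Q_form_def by (intro divide_nonneg_nonneg infsum_nonneg q0) auto
  have "R \<longlonglongrightarrow> 2 * 0 + 0"
    unfolding R_def by (intro tendsto_intros lim2 inverse_Suc_tendsto)
  then have "(\<lambda>k. R k / 2) \<longlonglongrightarrow> 0" using tendsto_divide[of R 0 _ "\<lambda>_. 2" 2] by simp
  then have lim3: "(\<lambda>k. Q_form G (?g k) (?g k)) \<longlonglongrightarrow> 0"
    by (intro Lim_null_comparison[OF always_eventually, of "\<lambda>k. Q_form G (?g k) (?g k)"])
      (simp_all only: real_norm_def abs_of_nonneg[OF Q0] Q1 simp_thms)
  have "(\<lambda>k. sqrt ((N (?g k))\<^sup>2 + Q_form G (?g k) (?g k))) \<longlonglongrightarrow> sqrt (0 + 0)"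
    by (intro tendsto_intros lim1 lim3)
  then show ?thesis by (simp add: Q_norm_def)
qed

text \<open>Completeness makes the boundary condition hidden in the form domain void: every function of the maximal domain is
approximated in the form norm by its own cutoffs.\<close>

lemma dom_laplacian_eq: "dom_laplacian G = Dmax"
proof -
  have "f \<in> dom_Q G" if f: "f \<in> Dmax" for f
  proof -
    have "(\<lambda>x. cutoff k x * f x) \<in> C0" for k
      using cutoff(1)[of k] by (auto simp: C0_def elim: rev_finite_subset)
    then have "\<exists>\<phi>. (\<forall>k. \<phi> k \<in> C0) \<and> (\<lambda>k. Q_norm G (\<lambda>x. \<phi> k x - f x)) \<longlonglongrightarrow> 0"
      using Dmax_cutoff_Q_norm[OF f] by (intro exI[of _ "\<lambda>k x. cutoff k x * f x"]) auto
    then show ?thesis using Dmax_finite_energy[OF f] DmaxD(1)[OF f] by (simp add: dom_Q_def)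
  qed
  then show ?thesis by (auto simp: dom_laplacian_def Dmax_def dom_Q_def)
qed

end

section \<open>Dirichlet heat flow on finite vertex sets\<close>

text \<open>Squaring the positive part makes it differentiable, also where it vanishes. Energies of positive parts can
thus be differentiated in time.\<close>

lemma pos_part_square_derivative:
  fixes f :: "real \<Rightarrow> real"
  assumes "(f has_real_derivative D) (at t within T)"
  shows "((\<lambda>t. (max 0 (f t))\<^sup>2) has_real_derivative 2 * max 0 (f t) * D) (at t within T)"
proof -
  have "((\<lambda>x::real. (max 0 x)\<^sup>2) has_real_derivative 2 * max 0 x) (at x)" for x
  proof -
    consider "x > 0" | "x < 0" | "x = 0" by linarith
    then show ?thesis
    proof cases
      case 1
      have "((\<lambda>x::real. x\<^sup>2) has_real_derivative 2 * max 0 x) (at x)"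
        using 1 by (auto intro!: derivative_eq_intros)
      then show ?thesis
        by (rule has_field_derivative_transform_within_open[of _ _ _ "{0<..}"]) (use 1 in auto)
    next
      case 2
      have "((\<lambda>x::real. 0) has_real_derivative 2 * max 0 x) (at x)"
        using 2 by (auto intro!: derivative_eq_intros)
      then show ?thesis
        by (rule has_field_derivative_transform_within_open[of _ _ _ "{..<0}"]) (use 2 in auto)
    next
      case 3
      have "(\<lambda>h::real. (max 0 h)\<^sup>2 / h) \<midarrow>0\<rightarrow> 0"
      proof (rule Lim_null_comparison[of _ "\<lambda>h. \<bar>h\<bar>"])
        have "norm ((max 0 h)\<^sup>2 / h) \<le> \<bar>h\<bar>" for h :: real
          by (cases "h > 0") (auto simp: max_def power2_eq_square)
        then show "\<forall>\<^sub>F h in at 0. norm ((max 0 h)\<^sup>2 / h) \<le> \<bar>h\<bar>" for h :: real by simp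
      qed (rule tendsto_rabs_zero[OF tendsto_ident_at])
      then show ?thesis using 3 by (simp add: DERIV_def)
    qed
  qed
  from DERIV_chain2[OF this assms] show ?thesis .
qed

context weighted begin

text \<open>A vector-valued mean value inequality, obtained from the scalar one by testing with the very vector whose
norm is to be bounded.\<close>

lemma mvt_nrm:
  assumes F: "finite F" and ab: "a \<le> b"
    and der: "\<And>x s. x \<in> F \<Longrightarrow> a \<le> s \<Longrightarrow> s \<le> b \<Longrightarrow> ((\<lambda>t. u t x) has_real_derivative v s x) (at s within {a..b})"
    and bd: "\<And>s. a \<le> s \<Longrightarrow> s \<le> b \<Longrightarrow> nrm F (\<lambda>x. v s x - c x) \<le> M"
  shows "nrm F (\<lambda>x. u b x - u a x - (b - a) * c x) \<le> (b - a) * M"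
proof -
  define d where "d x = u b x - u a x - (b - a) * c x" for x
  define g where "g s = (\<Sum>x\<in>F. d x * (u s x - s * c x) * m x)" for s
  have "((\<lambda>s. g s) has_real_derivative (\<Sum>x\<in>F. d x * (v s x - c x) * m x)) (at s within {a..b})"
    if "s \<in> {a..b}" for s
    unfolding g_def using that
    by (intro DERIV_sum DERIV_cmult_right DERIV_cmult DERIV_diff der) (auto intro!: derivative_eq_intros)
  then have "(g has_derivative (*) (\<Sum>x\<in>F. d x * (v s x - c x) * m x)) (at s within {a..b})"
    if "a \<le> s" "s \<le> b" for s
    using that by (simp add: has_field_derivative_def)
  from mvt_very_simple[OF ab this]
  obtain s where s: "s \<in> {a..b}" "g b - g a = (\<Sum>x\<in>F. d x * (v s x - c x) * m x) * (b - a)" by auto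
  have "(nrm F d)\<^sup>2 = g b - g a"
    unfolding nrm_square g_def sum_subtractf[symmetric]
    by (intro sum.cong refl) (simp add: d_def power2_eq_square algebra_simps)
  also have "\<dots> \<le> (nrm F d * M) * (b - a)"
  proof -
    have "(\<Sum>x\<in>F. d x * (v s x - c x) * m x) \<le> (\<Sum>x\<in>F. \<bar>d x * (v s x - c x) * m x\<bar>)"
      by (intro sum_mono) simp
    also have "\<dots> \<le> nrm F d * nrm F (\<lambda>x. v s x - c x)" by (rule nrm_mult_le)
    also have "\<dots> \<le> nrm F d * M" using s bd by (intro mult_left_mono) auto
    finally show ?thesis unfolding s(2) using ab by (intro mult_right_mono) auto
  qed
  finally have *: "nrm F d * nrm F d \<le> nrm F d * ((b - a) * M)" by (simp add: power2_eq_square mult_ac)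
  have "0 \<le> M" using bd[of a] ab nrm_nonneg order_trans by blast
  then have "nrm F d \<le> (b - a) * M"
    using * ab by (cases "nrm F d = 0") (auto simp: mult_le_cancel_left_pos less_le)
  then show ?thesis by (simp add: d_def[abs_def])
qed

lemma green_restr_sum:
  assumes F: "finite F" and g: "\<And>x. x \<notin> F \<Longrightarrow> g x = 0"
  shows "(\<Sum>x\<in>F. g x * L f x * m x)
     = - (\<Sum>x\<in>nbhd F. \<Sum>y\<in>nbhd F. w x y * (f y - f x) * (g y - g x)) / 2"
proof -
  have "(\<Sum>x\<in>F. g x * L f x * m x) = (\<Sum>x\<in>nbhd F. g x * L f x * m x)"
    using F g nbhd_subset by (intro sum.mono_neutral_left) auto
  also have "\<dots> = - (\<Sum>x\<in>nbhd F. \<Sum>y\<in>nbhd F. w x y * (f y - f x) * (g y - g x)) / 2"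
    using F g by (intro green absorbs_nbhd) auto
  finally show ?thesis .
qed

lemma green_restr_neg:
  assumes F: "finite F" and g: "\<And>x. x \<notin> F \<Longrightarrow> g x = 0"
  shows "(\<Sum>x\<in>F. g x * L g x * m x) \<le> 0"
  using green_restr_sum[OF F g, where f = g] by (simp add: sum_nonneg mult.assoc)

lemma green_restr_sym:
  assumes F: "finite F" and f: "\<And>x. x \<notin> F \<Longrightarrow> f x = 0" and g: "\<And>x. x \<notin> F \<Longrightarrow> g x = 0"
  shows "(\<Sum>x\<in>F. g x * L f x * m x) = (\<Sum>x\<in>F. f x * L g x * m x)"
proof -
  have "(\<Sum>x\<in>nbhd F. \<Sum>y\<in>nbhd F. w x y * (f y - f x) * (g y - g x))
      = (\<Sum>x\<in>nbhd F. \<Sum>y\<in>nbhd F. w x y * (g y - g x) * (f y - f x))"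
    by (simp add: mult_ac)
  then show ?thesis using green_restr_sum[OF F f, where f = g] green_restr_sum[OF F g, where f = f] by simp
qed

text \<open>The energy of the positive part of a subsolution cannot increase. On a finite set with Dirichlet boundary
values this comparison principle gives positivity, uniqueness and monotonicity in the set at once.\<close>

lemma subsolution_nonpos:
  assumes F: "finite F"
    and der: "\<And>x t. x \<in> F \<Longrightarrow> ((\<lambda>t. v t x) has_real_derivative v' t x) (at t)"
    and sub: "\<And>x t. x \<in> F \<Longrightarrow> 0 \<le> t \<Longrightarrow> 0 < v t x \<Longrightarrow> v' t x \<le> L (restr F (v t)) x"
    and init: "\<And>x. x \<in> F \<Longrightarrow> v 0 x \<le> 0"
    and t: "0 \<le> t" and x: "x \<in> F"
  shows "v t x \<le> 0"
proof -
  define \<phi> where "\<phi> t = (\<Sum>x\<in>F. (max 0 (v t x))\<^sup>2 * m x)" for t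
  have d: "(\<phi> has_real_derivative (\<Sum>x\<in>F. 2 * max 0 (v t x) * v' t x * m x)) (at t)" for t
    unfolding \<phi>_def by (intro DERIV_sum DERIV_cmult_right pos_part_square_derivative der)
  have neg: "(\<Sum>x\<in>F. 2 * max 0 (v t x) * v' t x * m x) \<le> 0" if t: "0 \<le> t" for t
  proof -
    let ?g = "restr F (\<lambda>x. max 0 (v t x))"
    have "(\<Sum>x\<in>F. 2 * max 0 (v t x) * v' t x * m x) \<le> (\<Sum>x\<in>F. 2 * (?g x * L ?g x * m x))"
    proof (rule sum_mono)
      fix x assume x: "x \<in> F"
      show "2 * max 0 (v t x) * v' t x * m x \<le> 2 * (?g x * L ?g x * m x)"
      proof (cases "0 < v t x")
        case True
        have "v' t x \<le> L (restr F (v t)) x" using sub x t True by blast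
        also have "\<dots> \<le> L ?g x"
          using True by (intro laplacian_mono_at) (auto simp: restr_def)
        finally show ?thesis using True x
          by (simp add: restr_def mult_left_mono)
      qed (simp add: restr_def max_def)
    qed
    also have "\<dots> = 2 * (\<Sum>x\<in>F. ?g x * L ?g x * m x)" by (simp add: sum_distrib_left)
    also have "\<dots> \<le> 0" using green_restr_neg[OF F, of ?g] by (simp add: restr_def)
    finally show ?thesis .
  qed
  have "\<phi> t \<le> \<phi> 0"
    using d neg by (intro DERIV_nonpos_imp_nonincreasing[OF t]) blast
  also have "\<phi> 0 = 0" unfolding \<phi>_def using init by (intro sum.neutral) (auto simp: max_absorb1)
  finally have "\<phi> t = 0" unfolding \<phi>_def by (simp add: antisym sum_nonneg)
  then have "(max 0 (v t x))\<^sup>2 * m x = 0"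
    unfolding \<phi>_def using F x by (subst (asm) sum_nonneg_eq_0_iff) auto
  then show ?thesis by (simp add: max_def split: if_splits)
qed

definition dirichlet :: "'v set \<Rightarrow> ('v \<Rightarrow> real) \<Rightarrow> 'v \<Rightarrow> real" where
  "dirichlet F f x = (if x \<in> F then L (restr F f) x else 0)"

text \<open>The exponential series of \<open>t \<Delta>\<^sub>F\<close> applied to \<open>f\<close>, evaluated pointwise.\<close>

definition heatF :: "'v set \<Rightarrow> real \<Rightarrow> ('v \<Rightarrow> real) \<Rightarrow> 'v \<Rightarrow> real" where
  "heatF F t f x = (\<Sum>k. (dirichlet F ^^ k) (restr F f) x / fact k * t ^ k)"

lemma restr_id: "(\<And>x. x \<notin> F \<Longrightarrow> f x = 0) \<Longrightarrow> restr F f = f"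
  by (auto simp: restr_def)

lemma dirichlet_pow_support: "x \<notin> F \<Longrightarrow> (dirichlet F ^^ k) (restr F f) x = 0"
  by (cases k) (auto simp: restr_def dirichlet_def)

lemma laplacian_abs_le:
  assumes "\<And>y. \<bar>f y\<bar> \<le> M"
  shows "\<bar>L f x\<bar> \<le> (\<Sum>y\<in>nbrs G x. w x y) * (2 * M) / m x"
proof -
  have "\<bar>\<Sum>y\<in>nbrs G x. w x y * (f y - f x)\<bar> \<le> (\<Sum>y\<in>nbrs G x. w x y * (2 * M))"
  proof (rule order_trans[OF sum_abs sum_mono])
    fix y
    have "\<bar>f y - f x\<bar> \<le> 2 * M" using assms[of y] assms[of x] by linarith
    then show "\<bar>w x y * (f y - f x)\<bar> \<le> w x y * (2 * M)" by (simp add: abs_mult mult_left_mono)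
  qed
  then show ?thesis unfolding laplacian_def by (simp add: divide_right_mono sum_distrib_right)
qed

lemma dirichlet_pow_bound:
  assumes F: "finite F"
  obtains B C where "0 \<le> B" "0 \<le> C" "\<And>k x. \<bar>(dirichlet F ^^ k) (restr F f) x\<bar> \<le> B * C ^ k"
proof -
  define B where "B = (\<Sum>x\<in>F. \<bar>f x\<bar>)"
  define C where "C = (\<Sum>x\<in>F. (\<Sum>y\<in>nbrs G x. w x y) * 2 / m x)"
  have C0: "0 \<le> C" unfolding C_def by (intro sum_nonneg divide_nonneg_nonneg mult_nonneg_nonneg) auto
  have B0: "0 \<le> B" unfolding B_def by (intro sum_nonneg) auto
  have "\<bar>(dirichlet F ^^ k) (restr F f) x\<bar> \<le> B * C ^ k" for k x
  proof (induction k arbitrary: x)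
    case 0
    have "x \<in> F \<Longrightarrow> \<bar>f x\<bar> \<le> B" unfolding B_def using F by (intro member_le_sum) auto
    then show ?case using B0 by (auto simp: restr_def)
  next
    case (Suc k)
    show ?case
    proof (cases "x \<in> F")
      case True
      let ?g = "restr F ((dirichlet F ^^ k) (restr F f))"
      have "\<bar>?g y\<bar> \<le> B * C ^ k" for y using Suc[of y] B0 C0 by (simp add: restr_def[of F "(dirichlet F ^^ k) (restr F f)"])
      from laplacian_abs_le[of ?g, OF this, of x]
      have "\<bar>L ?g x\<bar> \<le> (B * C ^ k) * ((\<Sum>y\<in>nbrs G x. w x y) * 2 / m x)" by (simp add: mult_ac)
      also have "\<dots> \<le> (B * C ^ k) * C"
      proof (rule mult_left_mono)
        show "(\<Sum>y\<in>nbrs G x. w x y) * 2 / m x \<le> C"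
          unfolding C_def using F True
          by (intro member_le_sum[of x F "\<lambda>x. (\<Sum>y\<in>nbrs G x. w x y) * 2 / m x"] divide_nonneg_nonneg mult_nonneg_nonneg sum_nonneg) auto
      qed (use B0 C0 in auto)
      finally show ?thesis using True
        by (simp add: dirichlet_def[of F "(dirichlet F ^^ k) (restr F f)"] mult_ac)
    qed (use B0 C0 in \<open>simp add: dirichlet_def[of F "(dirichlet F ^^ k) (restr F f)"]\<close>)
  qed
  with B0 C0 show thesis by (rule that)
qed

lemma heatF_summable:
  assumes F: "finite F"
  shows "summable (\<lambda>k. (dirichlet F ^^ k) (restr F f) x / fact k * t ^ k)"
proof -
  obtain B C where BC: "0 \<le> B" "0 \<le> C" "\<And>k x. \<bar>(dirichlet F ^^ k) (restr F f) x\<bar> \<le> B * C ^ k"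
    using dirichlet_pow_bound[OF F] by blast
  show ?thesis
  proof (rule summable_comparison_test[OF exI, OF allI, OF impI])
    show "summable (\<lambda>k. B * (inverse (fact k) * (C * \<bar>t\<bar>) ^ k))"
      by (intro summable_mult summable_exp)
    fix k :: nat
    have "norm ((dirichlet F ^^ k) (restr F f) x / fact k * t ^ k)
       = \<bar>(dirichlet F ^^ k) (restr F f) x\<bar> * (\<bar>t\<bar> ^ k / fact k)"
      by (simp add: abs_mult power_abs)
    also have "\<dots> \<le> (B * C ^ k) * (\<bar>t\<bar> ^ k / fact k)" by (intro mult_right_mono BC) auto
    finally show "norm ((dirichlet F ^^ k) (restr F f) x / fact k * t ^ k) \<le> B * (inverse (fact k) * (C * \<bar>t\<bar>) ^ k)"
      by (simp add: divide_inverse power_mult_distrib mult_ac)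
  qed
qed

lemma laplacian_sums:
  assumes "\<And>y. (\<lambda>k. a k y) sums s y"
  shows "(\<lambda>k. L (a k) x) sums L s x"
  unfolding laplacian_def by (intro sums_divide sums_sum sums_mult sums_diff assms)

lemma heatF_support: "x \<notin> F \<Longrightarrow> heatF F t f x = 0"
  by (simp add: heatF_def dirichlet_pow_support)

text \<open>Solutions are considered for all real times, so that two-sided derivatives exist at time zero.\<close>

definition solves :: "'v set \<Rightarrow> (real \<Rightarrow> 'v \<Rightarrow> real) \<Rightarrow> bool" where
  "solves F u \<longleftrightarrow> (\<forall>t x. ((\<lambda>t. u t x) has_real_derivative dirichlet F (u t) x) (at t)) \<and> (\<forall>t x. x \<notin> F \<longrightarrow> u t x = 0)"

lemma heatF_solves:
  assumes F: "finite F" shows "solves F (\<lambda>t. heatF F t f)"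
  unfolding solves_def
proof (intro conjI allI impI heatF_support)
  fix t x
  let ?c = "\<lambda>k x. (dirichlet F ^^ k) (restr F f) x"
  have "((\<lambda>t. \<Sum>k. ?c k x / fact k * t ^ k) has_real_derivative (\<Sum>k. diffs (\<lambda>k. ?c k x / fact k) k * t ^ k)) (at t)"
    by (rule termdiffs_strong_converges_everywhere) (rule heatF_summable[OF F])
  also have "(\<Sum>k. diffs (\<lambda>k. ?c k x / fact k) k * t ^ k) = (\<Sum>k. dirichlet F (?c k) x / fact k * t ^ k)"
    by (intro suminf_cong) (simp add: diffs_def)
  also have "\<dots> = dirichlet F (heatF F t f) x"
  proof (cases "x \<in> F")
    case True
    have "(\<lambda>k. ?c k y / fact k * t ^ k) sums heatF F t f y" for y
      unfolding heatF_def using heatF_summable[OF F] by (rule summable_sums)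
    from laplacian_sums[of "\<lambda>k y. ?c k y / fact k * t ^ k", OF this]
    have "(\<lambda>k. L (\<lambda>y. ?c k y / fact k * t ^ k) x) sums L (heatF F t f) x" .
    moreover have "L (\<lambda>y. ?c k y / fact k * t ^ k) x = dirichlet F (?c k) x / fact k * t ^ k" for k
      using laplacian_cmult[of "t ^ k / fact k" "?c k" x] True restr_id[of F "?c k"] dirichlet_pow_support[of _ F k f]
      by (simp add: dirichlet_def mult_ac)
    ultimately have "(\<Sum>k. dirichlet F (?c k) x / fact k * t ^ k) = L (heatF F t f) x"
      by (simp add: sums_iff)
    then show ?thesis using True restr_id[of F "heatF F t f"] heatF_support[of _ F t f] by (simp add: dirichlet_def)
  qed (simp add: dirichlet_def)
  finally show "((\<lambda>t. heatF F t f x) has_real_derivative dirichlet F (heatF F t f) x) (at t)"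
    by (simp add: heatF_def)
qed

lemma heatF_0: "heatF F 0 f x = restr F f x"
  unfolding heatF_def using powser_zero[of "\<lambda>k. (dirichlet F ^^ k) (restr F f) x / fact k"] by simp

lemma solvesD: "solves F u \<Longrightarrow> ((\<lambda>t. u t x) has_real_derivative dirichlet F (u t) x) (at t)"
  "solves F u \<Longrightarrow> x \<notin> F \<Longrightarrow> u t x = 0"
  by (auto simp: solves_def)

lemma solves_restr: "solves F u \<Longrightarrow> restr F (u t) = u t"
  by (rule restr_id) (rule solvesD)

lemma solves_dirichlet: "solves F u \<Longrightarrow> x \<in> F \<Longrightarrow> dirichlet F (u t) x = L (u t) x"
  by (simp add: dirichlet_def solves_restr)

lemma dirichlet_lin: "dirichlet F (\<lambda>x. a * f x + b * g x) x = a * dirichlet F f x + b * dirichlet F g x"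
proof -
  have "restr F (\<lambda>x. a * f x + b * g x) = (\<lambda>x. a * restr F f x + b * restr F g x)" by (auto simp: restr_def)
  then show ?thesis by (simp add: dirichlet_def laplacian_lin)
qed

lemma solves_lin: "solves F u \<Longrightarrow> solves F v \<Longrightarrow> solves F (\<lambda>t x. a * u t x + b * v t x)"
  unfolding solves_def dirichlet_lin
  by (auto intro!: DERIV_add DERIV_cmult)

lemma solves_nonneg:
  assumes F: "finite F" and u: "solves F u" and init: "\<And>x. 0 \<le> u 0 x" and t: "0 \<le> t"
  shows "0 \<le> u t x"
proof (cases "x \<in> F")
  case True
  have "- u t x \<le> 0"
  proof (rule subsolution_nonpos[OF F, of "\<lambda>t x. - u t x" "\<lambda>t x. - dirichlet F (u t) x"])
    fix x t assume x: "x \<in> F"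
    show "((\<lambda>t. - u t x) has_real_derivative - dirichlet F (u t) x) (at t)"
      by (intro DERIV_minus solvesD u)
    have "restr F (\<lambda>x. - u t x) = (\<lambda>x. (-1) * u t x)" using solvesD(2)[OF u] by (auto simp: restr_def)
    then show "- dirichlet F (u t) x \<le> L (restr F (\<lambda>x. - u t x)) x"
      using solves_dirichlet[OF u x] laplacian_cmult[of "-1" "u t" x] by simp
  qed (use init t True in auto)
  then show ?thesis by simp
qed (simp add: solvesD[OF u])

lemma solves_unique:
  assumes F: "finite F" and u: "solves F u" and v: "solves F v" and init: "\<And>x. u 0 x = v 0 x" and t: "0 \<le> t"
  shows "u t x = v t x"
proof -
  have "0 \<le> 1 * u t x + (-1) * v t x"
    by (rule solves_nonneg[OF F solves_lin[OF u v] _ t]) (simp add: init)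
  moreover have "0 \<le> 1 * v t x + (-1) * u t x"
    by (rule solves_nonneg[OF F solves_lin[OF v u] _ t]) (simp add: init)
  ultimately show ?thesis by simp
qed

lemma heatF_nonneg: assumes "finite F" "\<And>x. 0 \<le> f x" "0 \<le> t" shows "0 \<le> heatF F t f x"
  by (rule solves_nonneg[OF assms(1) heatF_solves[OF assms(1)] _ assms(3)]) (use assms in \<open>auto simp: heatF_0 restr_def\<close>)

lemma heatF_lin: assumes F: "finite F" and t: "0 \<le> t"
  shows "heatF F t (\<lambda>x. a * f x + b * g x) x = a * heatF F t f x + b * heatF F t g x"
  by (rule solves_unique[OF F heatF_solves[OF F] solves_lin[OF heatF_solves[OF F] heatF_solves[OF F]] _ t])
    (simp add: heatF_0 restr_def)

text \<open>A smaller set absorbs more heat. On \<open>F\<close> the difference of the two flows is a subsolution, because the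
flow on the larger set is nonnegative on the boundary of \<open>F\<close>.\<close>

lemma heatF_mono_set:
  assumes F: "finite F'" and sub: "F \<subseteq> F'" and f: "\<And>x. 0 \<le> f x" and t: "0 \<le> t"
  shows "heatF F t f x \<le> heatF F' t f x"
proof (cases "x \<in> F")
  case True
  have fin: "finite F" using sub F finite_subset by blast
  note s = heatF_solves[OF fin, of f] and s' = heatF_solves[OF F, of f]
  let ?v = "\<lambda>t x. heatF F t f x - heatF F' t f x"
  have "?v t x \<le> 0"
  proof (rule subsolution_nonpos[OF fin, of ?v "\<lambda>t x. dirichlet F (heatF F t f) x - dirichlet F' (heatF F' t f) x"])
    fix x t
    show "((\<lambda>t. ?v t x) has_real_derivative dirichlet F (heatF F t f) x - dirichlet F' (heatF F' t f) x) (at t)"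
      by (intro DERIV_diff solvesD(1)[OF s] solvesD(1)[OF s'])
  next
    fix x and t :: real assume x: "x \<in> F" and t: "0 \<le> t"
    have "dirichlet F (heatF F t f) x - dirichlet F' (heatF F' t f) x = L (?v t) x"
      using x sub solves_dirichlet[OF s x] solves_dirichlet[OF s', of x] by (auto simp: laplacian_diff)
    also have "\<dots> \<le> L (restr F (?v t)) x"
      using x t heatF_nonneg[OF F f t] by (intro laplacian_mono_at) (auto simp: restr_def heatF_support)
    finally show "dirichlet F (heatF F t f) x - dirichlet F' (heatF F' t f) x \<le> L (restr F (?v t)) x" .
  qed (use True t sub in \<open>auto simp: heatF_0 restr_def\<close>)
  then show ?thesis by simp
qed (simp add: heatF_support heatF_nonneg[OF F f t])

lemma heatF_semigroup:
  assumes F: "finite F" and s: "0 \<le> s" and t: "0 \<le> t"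
  shows "heatF F (t + s) f x = heatF F t (heatF F s f) x"
proof (rule solves_unique[OF F _ heatF_solves[OF F] _ t])
  show "solves F (\<lambda>t. heatF F (t + s) f)"
    using heatF_solves[OF F, of f] unfolding solves_def by (auto intro!: DERIV_shift[THEN iffD1])
  show "heatF F (0 + s) f x = heatF F 0 (heatF F s f) x" for x
    by (simp add: heatF_0 restr_def heatF_support)
qed

lemma heatF_commute:
  assumes F: "finite F" and t: "0 \<le> t"
  shows "heatF F t (dirichlet F f) x = dirichlet F (heatF F t f) x"
proof (rule solves_unique[OF F heatF_solves[OF F] _ _ t])
  note s = heatF_solves[OF F, of f]
  show "solves F (\<lambda>t. dirichlet F (heatF F t f))"
    unfolding solves_def
  proof (intro conjI allI impI)
    fix t x
    show "((\<lambda>t. dirichlet F (heatF F t f) x) has_real_derivative dirichlet F (dirichlet F (heatF F t f)) x) (at t)"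
    proof (cases "x \<in> F")
      case True
      have "((\<lambda>t. L (heatF F t f) x) has_real_derivative L (dirichlet F (heatF F t f)) x) (at t)"
        by (rule laplacian_has_derivative) (rule solvesD[OF s])
      moreover have "restr F (dirichlet F (heatF F t f)) = dirichlet F (heatF F t f)"
        by (auto simp: restr_def dirichlet_def)
      ultimately show ?thesis using True by (simp add: dirichlet_def[of F _ x] solves_restr[OF s])
    qed (simp add: dirichlet_def)
  qed (simp add: dirichlet_def)
  have "restr F (heatF F 0 f) = restr F f" by (auto simp: restr_def heatF_0)
  then show "heatF F 0 (dirichlet F f) x = dirichlet F (heatF F 0 f) x" for x
    by (simp add: heatF_0 restr_def[of F "dirichlet F f"] dirichlet_def)
qed

lemma heatF_contraction:
  assumes F: "finite F" and t: "0 \<le> t" shows "nrm F (heatF F t f) \<le> nrm F f"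
proof -
  note s = heatF_solves[OF F, of f]
  let ?\<phi> = "\<lambda>t. \<Sum>x\<in>F. (heatF F t f x)\<^sup>2 * m x"
  let ?\<phi>' = "\<lambda>t. \<Sum>x\<in>F. (2 * heatF F t f x * dirichlet F (heatF F t f) x) * m x"
  have "(?\<phi> has_real_derivative ?\<phi>' t) (at t)" for t
    by (intro DERIV_sum DERIV_cmult_right) (auto intro!: derivative_eq_intros solvesD[OF s])
  moreover have "?\<phi>' t \<le> 0" for t
  proof -
    have "?\<phi>' t = 2 * (\<Sum>x\<in>F. heatF F t f x * L (heatF F t f) x * m x)"
      unfolding sum_distrib_left by (intro sum.cong refl) (simp add: solves_dirichlet[OF s])
    then show ?thesis using green_restr_neg[OF F, of "heatF F t f"] by (simp add: heatF_support)
  qed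
  ultimately have "?\<phi> t \<le> ?\<phi> 0" by (intro DERIV_nonpos_imp_nonincreasing[OF t]) blast
  also have "?\<phi> 0 = (nrm F f)\<^sup>2" unfolding nrm_square by (intro sum.cong refl) (simp add: heatF_0 restr_def)
  finally show ?thesis unfolding nrm_square[symmetric] by (rule power2_le_imp_le) simp
qed

text \<open>Heat is lost only through edges leaving \<open>F\<close>: against the indicator of \<open>F\<close> Green's
formula leaves exactly the flux across the boundary.\<close>

lemma heatF_mass:
  assumes F: "finite F" and t: "0 \<le> t" and f: "\<And>x. 0 \<le> f x"
  shows "(\<Sum>x\<in>F. heatF F t f x * m x) \<le> (\<Sum>x\<in>F. f x * m x)"
proof -
  note s = heatF_solves[OF F, of f]
  let ?\<phi> = "\<lambda>t. \<Sum>x\<in>F. heatF F t f x * m x"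
  let ?\<phi>' = "\<lambda>t. \<Sum>x\<in>F. dirichlet F (heatF F t f) x * m x"
  have "(?\<phi> has_real_derivative ?\<phi>' t) (at t)" for t
    by (intro DERIV_sum DERIV_cmult_right solvesD[OF s])
  moreover have "?\<phi>' t \<le> 0" if t: "0 \<le> t" for t
  proof -
    let ?i = "restr F (\<lambda>_. 1)"
    have "?\<phi>' t = (\<Sum>x\<in>F. ?i x * L (heatF F t f) x * m x)"
      by (intro sum.cong refl) (simp add: solves_dirichlet[OF s] restr_def)
    also have "\<dots> = - (\<Sum>x\<in>nbhd F. \<Sum>y\<in>nbhd F. w x y * (heatF F t f y - heatF F t f x) * (?i y - ?i x)) / 2"
      by (rule green_restr_sum[OF F]) (simp add: restr_def)
    also have "\<dots> \<le> 0"
    proof -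
      have "0 \<le> w x y * (heatF F t f y - heatF F t f x) * (?i y - ?i x)" for x y
        using heatF_nonneg[OF F f t] by (auto simp: restr_def heatF_support)
      then show ?thesis by (simp add: sum_nonneg)
    qed
    finally show ?thesis .
  qed
  ultimately have "?\<phi> t \<le> ?\<phi> 0" by (intro DERIV_nonpos_imp_nonincreasing[OF t]) blast
  also have "?\<phi> 0 = (\<Sum>x\<in>F. f x * m x)" by (intro sum.cong refl) (simp add: heatF_0 restr_def)
  finally show ?thesis .
qed

text \<open>By Green's formula the pairing of the flow of \<open>f\<close> up to time \<open>r\<close> with the flow of
\<open>g\<close> up to time \<open>t - r\<close> does not depend on \<open>r\<close>.\<close>

lemma heatF_symmetric:
  assumes F: "finite F"
  shows "(\<Sum>x\<in>F. f x * heatF F t g x * m x) = (\<Sum>x\<in>F. heatF F t f x * g x * m x)"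
proof -
  note s = heatF_solves[OF F]
  let ?\<psi> = "\<lambda>r. \<Sum>x\<in>F. heatF F r f x * heatF F (t - r) g x * m x"
  have "(?\<psi> has_real_derivative 0) (at r)" for r
  proof -
    have d: "((\<lambda>r. heatF F (t - r) g x) has_real_derivative - dirichlet F (heatF F (t - r) g) x) (at r)" for x
    proof -
      have "((\<lambda>r. t - r) has_real_derivative -1) (at r)" by (auto intro!: derivative_eq_intros)
      from DERIV_chain2[OF solvesD(1)[OF s] this] show ?thesis by simp
    qed
    have "(?\<psi> has_real_derivative (\<Sum>x\<in>F. (heatF F r f x * - dirichlet F (heatF F (t - r) g) x
        + dirichlet F (heatF F r f) x * heatF F (t - r) g x) * m x)) (at r)"
      by (intro DERIV_sum DERIV_cmult_right DERIV_mult'[OF solvesD(1)[OF s] d])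
    also have "(\<Sum>x\<in>F. (heatF F r f x * - dirichlet F (heatF F (t - r) g) x
        + dirichlet F (heatF F r f) x * heatF F (t - r) g x) * m x)
      = (\<Sum>x\<in>F. heatF F (t - r) g x * L (heatF F r f) x * m x) - (\<Sum>x\<in>F. heatF F r f x * L (heatF F (t - r) g) x * m x)"
      unfolding sum_subtractf[symmetric]
      by (intro sum.cong refl) (simp add: solves_dirichlet[OF s] algebra_simps)
    also have "\<dots> = 0" using green_restr_sym[OF F heatF_support heatF_support] by simp
    finally show ?thesis .
  qed
  then have "?\<psi> 0 = ?\<psi> t" using DERIV_isconst_all by blast
  then show ?thesis by (simp add: heatF_0 restr_def cong: sum.cong)
qed

lemma heatF_lipschitz:
  assumes F: "finite F" and t: "0 \<le> t" and ts: "t \<le> s"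
  shows "nrm F (\<lambda>x. heatF F s f x - heatF F t f x) \<le> (s - t) * nrm F (dirichlet F f)"
proof -
  have "nrm F (\<lambda>x. heatF F s f x - heatF F t f x - (s - t) * 0) \<le> (s - t) * nrm F (dirichlet F f)"
  proof (rule mvt_nrm[OF F ts])
    fix r x assume "t \<le> r"
    show "((\<lambda>t. heatF F t f x) has_real_derivative dirichlet F (heatF F r f) x) (at r within {t..s})"
      by (rule has_field_derivative_at_within) (rule solvesD[OF heatF_solves[OF F]])
  next
    fix r assume r: "t \<le> r"
    have "dirichlet F (heatF F r f) = heatF F r (dirichlet F f)"
      using heatF_commute[OF F, of r f] r t by auto
    then show "nrm F (\<lambda>x. dirichlet F (heatF F r f) x - 0) \<le> nrm F (dirichlet F f)"
      using heatF_contraction[OF F, of r "dirichlet F f"] r t by simp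
  qed
  then show ?thesis by simp
qed

lemma nrm_minus: "nrm F (\<lambda>x. - f x) = nrm F f"
  by (simp add: nrm_def L2_set_def)

text \<open>The error is expressed by \<open>\<Delta>\<^sub>F\<^sup>2 f\<close> alone, with a constant that does not see the set \<open>F\<close>; this
is what allows \<open>F\<close> to exhaust the graph. Both signs of \<open>s - t\<close> are covered, to have two-sided
derivatives in the limit.\<close>

lemma heatF_taylor:
  assumes F: "finite F" and t: "0 \<le> t" and s: "0 \<le> s"
  shows "nrm F (\<lambda>x. heatF F s f x - heatF F t f x - (s - t) * heatF F t (dirichlet F f) x)
     \<le> (s - t)\<^sup>2 * nrm F (dirichlet F (dirichlet F f))"
proof -
  let ?M = "nrm F (dirichlet F (dirichlet F f))"
  have der: "((\<lambda>t. heatF F t f x) has_real_derivative heatF F r (dirichlet F f) x) (at r within {a..b})"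
    if "0 \<le> r" for r a b x
    using solvesD(1)[OF heatF_solves[OF F], of f x r] heatF_commute[OF F that, of f x]
    by (auto intro: has_field_derivative_at_within)
  have lip: "nrm F (\<lambda>x. heatF F r (dirichlet F f) x - heatF F q (dirichlet F f) x) \<le> \<bar>r - q\<bar> * ?M"
    if "0 \<le> r" "0 \<le> q" for r q
  proof (cases "q \<le> r")
    case True then show ?thesis using heatF_lipschitz[OF F, of q r "dirichlet F f"] that by simp
  next
    case False then show ?thesis
      using heatF_lipschitz[OF F, of r q "dirichlet F f"] that
        nrm_minus[of F "\<lambda>x. heatF F r (dirichlet F f) x - heatF F q (dirichlet F f) x"] by simp
  qed
  show ?thesis
  proof (cases "t \<le> s")
    case True
    have "nrm F (\<lambda>x. heatF F s f x - heatF F t f x - (s - t) * heatF F t (dirichlet F f) x) \<le> (s - t) * ((s - t) * ?M)"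
    proof (rule mvt_nrm[OF F True der])
      fix r assume r: "t \<le> r" "r \<le> s"
      have "nrm F (\<lambda>x. heatF F r (dirichlet F f) x - heatF F t (dirichlet F f) x) \<le> \<bar>r - t\<bar> * ?M"
        using r t by (intro lip) auto
      also have "\<dots> \<le> (s - t) * ?M" using r by (intro mult_right_mono) auto
      finally show "nrm F (\<lambda>x. heatF F r (dirichlet F f) x - heatF F t (dirichlet F f) x) \<le> (s - t) * ?M" .
    qed (use t in auto)
    then show ?thesis by (simp add: power2_eq_square mult.assoc)
  next
    case False
    then have st: "s \<le> t" by simp
    have "nrm F (\<lambda>x. heatF F t f x - heatF F s f x - (t - s) * heatF F t (dirichlet F f) x) \<le> (t - s) * ((t - s) * ?M)"
    proof (rule mvt_nrm[OF F st der])
      fix r assume r: "s \<le> r" "r \<le> t"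
      have "nrm F (\<lambda>x. heatF F r (dirichlet F f) x - heatF F t (dirichlet F f) x) \<le> \<bar>r - t\<bar> * ?M"
        using r s t by (intro lip) auto
      also have "\<dots> \<le> (t - s) * ?M" using r by (intro mult_right_mono) auto
      finally show "nrm F (\<lambda>x. heatF F r (dirichlet F f) x - heatF F t (dirichlet F f) x) \<le> (t - s) * ?M" .
    qed (use s in auto)
    moreover have "nrm F (\<lambda>x. heatF F t f x - heatF F s f x - (t - s) * heatF F t (dirichlet F f) x)
       = nrm F (\<lambda>x. heatF F s f x - heatF F t f x - (s - t) * heatF F t (dirichlet F f) x)"
      by (subst nrm_minus[symmetric]) (simp add: algebra_simps)
    ultimately show ?thesis by (simp add: power2_eq_square algebra_simps)
  qed
qed

end

section \<open>The heat semigroup as a limit over an exhaustion\<close>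

lemma derivative_from_quadratic_bound:
  fixes f :: "real \<Rightarrow> real"
  assumes "\<And>s. s \<in> T \<Longrightarrow> \<bar>f s - f t - (s - t) * D\<bar> \<le> C * (s - t)\<^sup>2"
  shows "(f has_real_derivative D) (at t within T)"
proof -
  have "((\<lambda>s. (f s - f t) / (s - t) - D) \<longlongrightarrow> 0) (at t within T)"
  proof (rule Lim_null_comparison[of _ "\<lambda>s. \<bar>C\<bar> * \<bar>s - t\<bar>"])
    show "\<forall>\<^sub>F s in at t within T. norm ((f s - f t) / (s - t) - D) \<le> \<bar>C\<bar> * \<bar>s - t\<bar>"
      unfolding eventually_at_filter
    proof (intro always_eventually allI impI)
      fix s assume s: "s \<noteq> t" "s \<in> T"
      have "\<bar>f s - f t - (s - t) * D\<bar> \<le> \<bar>C\<bar> * (s - t)\<^sup>2"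
        using assms[OF s(2)] by (meson abs_ge_self mult_right_mono order_trans zero_le_power2)
      moreover have "norm ((f s - f t) / (s - t) - D) = \<bar>f s - f t - (s - t) * D\<bar> / \<bar>s - t\<bar>"
        using s by (simp add: abs_divide[symmetric] diff_divide_distrib)
      moreover have "(s - t)\<^sup>2 = \<bar>s - t\<bar> * \<bar>s - t\<bar>" by (simp add: power2_eq_square)
      ultimately show "norm ((f s - f t) / (s - t) - D) \<le> \<bar>C\<bar> * \<bar>s - t\<bar>"
        using s by (simp add: pos_divide_le_eq mult.assoc)
    qed
    have "((\<lambda>s. \<bar>C\<bar> * \<bar>s - t\<bar>) \<longlongrightarrow> \<bar>C\<bar> * \<bar>t - t\<bar>) (at t within T)"
      by (intro tendsto_intros)
    then show "((\<lambda>s. \<bar>C\<bar> * \<bar>s - t\<bar>) \<longlongrightarrow> 0) (at t within T)" by simp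
  qed
  then show ?thesis unfolding has_field_derivative_iff by (rule LIM_zero_cancel)
qed

context weighted begin

text \<open>Balls around an arbitrary base vertex. They exhaust the graph because it is connected.\<close>

fun exhaust :: "nat \<Rightarrow> 'v set" where
  "exhaust 0 = {undefined}"
| "exhaust (Suc k) = nbhd (exhaust k)"

lemma finite_exhaust [simp]: "finite (exhaust k)"
  by (induction k) auto

lemma exhaust_mono: "k \<le> l \<Longrightarrow> exhaust k \<subseteq> exhaust l"
  by (rule lift_Suc_mono_le[of exhaust]) (auto simp: nbhd_def)

lemma exhaust_covers: "\<exists>k. x \<in> exhaust k"
  using connected_edges[of undefined x]
proof (induction rule: rtrancl_induct)
  case base show ?case by (intro exI[of _ 0]) simp
next
  case (step y z)
  then obtain k where "y \<in> exhaust k" by auto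
  then have "z \<in> exhaust (Suc k)" using step(2) by (auto simp: nbhd_def nbrs_def)
  then show ?case by blast
qed

lemma eventually_exhaust:
  assumes "finite A" shows "\<forall>\<^sub>F k in sequentially. A \<subseteq> exhaust k"
proof -
  have "\<forall>\<^sub>F k in sequentially. \<forall>x\<in>A. x \<in> exhaust k"
  proof (intro eventually_ball_finite assms ballI)
    fix x
    obtain l where "x \<in> exhaust l" using exhaust_covers by blast
    then show "\<forall>\<^sub>F k in sequentially. x \<in> exhaust k"
      using exhaust_mono by (intro eventually_sequentiallyI[of l]) blast
  qed
  then show ?thesis by eventually_elim auto
qed

text \<open>The initial values of the heat kernel. Pairing with such a function evaluates at its vertex.\<close>

definition unit_mass :: "'v \<Rightarrow> 'v \<Rightarrow> real" where
  "unit_mass y z = indicator {y} z / m y"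

lemma unit_mass_C0 [simp]: "unit_mass y \<in> C0"
  by (auto simp: C0_def unit_mass_def indicator_def)

lemma unit_mass_l2 [simp]: "unit_mass y \<in> l2 G" by (simp add: C0_l2)

lemma unit_mass_nonneg [simp]: "0 \<le> unit_mass y z" by (simp add: unit_mass_def)

lemma ip_unit_mass: "ip (unit_mass x) f = f x" "ip f (unit_mass x) = f x"
proof -
  show "ip (unit_mass x) f = f x" by (subst ip_finite[of "{x}"]) (auto simp: unit_mass_def)
  then show "ip f (unit_mass x) = f x" by (simp add: ip_sym)
qed

lemma sum_unit_mass: "finite A \<Longrightarrow> (\<Sum>y\<in>A. f y * m y * unit_mass y x) = (if x \<in> A then f x else 0)"
proof -
  assume A: "finite A"
  have "(\<Sum>y\<in>A. f y * m y * unit_mass y x) = (\<Sum>y\<in>A. if x = y then f x else 0)"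
    by (intro sum.cong refl) (auto simp: unit_mass_def indicator_def)
  then show ?thesis using A by simp
qed

lemma nrm_mono: assumes "finite F'" "F \<subseteq> F'" shows "nrm F f \<le> nrm F' f"
  unfolding nrm_def L2_set_def using assms by (intro real_sqrt_le_mono sum_mono2) auto

lemma nrm_point: assumes "finite F" "x \<in> F" shows "\<bar>f x\<bar> * sqrt (m x) \<le> nrm F f"
  using nrm_mono[of F "{x}" f] assms by (simp add: nrm_def abs_mult)

lemma heatF_sum:
  assumes F: "finite F" and t: "0 \<le> t" and A: "finite A"
  shows "heatF F t (\<lambda>x. \<Sum>y\<in>A. a y * g y x) x = (\<Sum>y\<in>A. a y * heatF F t (g y) x)"
  using A
proof (induction A rule: finite_induct)
  case empty
  show ?case using heatF_lin[OF F t, of 0 "\<lambda>_. 0" 0 "\<lambda>_. 0" x] by simp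
next
  case (insert z A)
  then show ?case using heatF_lin[OF F t, of "a z" "g z" 1 "\<lambda>x. \<Sum>y\<in>A. a y * g y x" x] by simp
qed

lemma heatF_kernel:
  assumes F: "finite F" and t: "0 \<le> t" and A: "finite A" "\<And>x. x \<notin> A \<Longrightarrow> f x = 0"
  shows "heatF F t f x = (\<Sum>y\<in>A. f y * m y * heatF F t (unit_mass y) x)"
proof -
  have "f = (\<lambda>x. \<Sum>y\<in>A. f y * m y * unit_mass y x)" using A by (auto simp: sum_unit_mass)
  then have "heatF F t f x = heatF F t (\<lambda>x. \<Sum>y\<in>A. f y * m y * unit_mass y x) x" by simp
  then show ?thesis using heatF_sum[OF F t A(1), of "\<lambda>y. f y * m y" unit_mass] by simp
qed

lemma heatF_unit_mass_outside: assumes "finite F" "0 \<le> t" "y \<notin> F" shows "heatF F t (unit_mass y) x = 0"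
proof -
  have "restr F (unit_mass y) = restr F (\<lambda>_. 0)"
    using assms(3) by (auto simp: restr_def unit_mass_def indicator_def fun_eq_iff)
  then have "heatF F t (unit_mass y) x = heatF F t (\<lambda>_. 0) x" by (simp add: heatF_def)
  then show ?thesis using heatF_lin[OF assms(1,2), of 0 "\<lambda>_. 0" 0 "\<lambda>_. 0" x] by simp
qed

lemma heatF_unit_mass_sym:
  assumes F: "finite F" and t: "0 \<le> t" shows "heatF F t (unit_mass y) x = heatF F t (unit_mass x) y"
proof (cases "x \<in> F \<and> y \<in> F")
  case True
  have "(\<Sum>z\<in>F. unit_mass x z * h z * m z) = h x" if "x \<in> F" for x h
  proof -
    have "(\<Sum>z\<in>F. unit_mass x z * h z * m z) = (\<Sum>z\<in>F. if z = x then h z else 0)"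
      by (intro sum.cong refl) (auto simp: unit_mass_def)
    then show ?thesis using that F by simp
  qed
  then show ?thesis
    using heatF_symmetric[OF F, of "unit_mass x" t "unit_mass y"] True by (simp add: mult.commute[of "heatF F t _ _" "unit_mass _ _"])
next
  case False
  then show ?thesis using heatF_unit_mass_outside[OF F t] heatF_support by metis
qed

text \<open>The minimal heat kernel; the limit exists since the Dirichlet kernels increase with the set and are
bounded by contractivity.\<close>

definition kern :: "real \<Rightarrow> 'v \<Rightarrow> 'v \<Rightarrow> real" where
  "kern t x y = lim (\<lambda>k. heatF (exhaust k) t (unit_mass y) x)"

lemma kern_incseq: "0 \<le> t \<Longrightarrow> k \<le> l \<Longrightarrow> heatF (exhaust k) t (unit_mass y) x \<le> heatF (exhaust l) t (unit_mass y) x"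
  by (intro heatF_mono_set exhaust_mono) auto

lemma kern_lim:
  assumes t: "0 \<le> t" shows "(\<lambda>k. heatF (exhaust k) t (unit_mass y) x) \<longlonglongrightarrow> kern t x y"
proof -
  have "heatF (exhaust k) t (unit_mass y) x \<le> N (unit_mass y) / sqrt (m x)" for k
  proof (cases "x \<in> exhaust k")
    case True
    have "\<bar>heatF (exhaust k) t (unit_mass y) x\<bar> * sqrt (m x) \<le> nrm (exhaust k) (heatF (exhaust k) t (unit_mass y))"
      using True by (intro nrm_point) auto
    also have "\<dots> \<le> nrm (exhaust k) (unit_mass y)" using t by (intro heatF_contraction) auto
    also have "\<dots> \<le> N (unit_mass y)" by (intro nrm_le_N) auto
    finally show ?thesis by (simp add: pos_le_divide_eq) (meson abs_ge_self m_nonneg mult_right_mono order_trans real_sqrt_ge_zero)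
  qed (simp add: heatF_support)
  moreover have "incseq (\<lambda>k. heatF (exhaust k) t (unit_mass y) x)"
    using kern_incseq[OF t] by (auto simp: incseq_def)
  ultimately have "convergent (\<lambda>k. heatF (exhaust k) t (unit_mass y) x)"
    by (intro Bseq_monoseq_convergent BseqI'[of _ "N (unit_mass y) / sqrt (m x)"] incseq_imp_monoseq)
      (auto simp: heatF_nonneg t)
  then show ?thesis unfolding kern_def by (simp add: convergent_LIMSEQ_iff)
qed

lemma kern_sym: assumes "0 \<le> t" shows "kern t x y = kern t y x"
  unfolding kern_def using heatF_unit_mass_sym[OF finite_exhaust assms] by simp

lemma kern_ge: assumes "0 \<le> t" shows "heatF (exhaust k) t (unit_mass y) x \<le> kern t x y"
  by (rule incseq_le[OF _ kern_lim[OF assms]]) (use kern_incseq[OF assms] in \<open>auto simp: incseq_def\<close>)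

text \<open>On all of \<open>l2\<close> the semigroup is given by its kernel. Properties are first proved for finitely supported
functions, where it is a limit of Dirichlet flows, and then extended by symmetry and density.\<close>

definition heat :: "real \<Rightarrow> ('v \<Rightarrow> real) \<Rightarrow> 'v \<Rightarrow> real" where
  "heat t f x = ip (kern t x) f"

lemma heat_lim:
  assumes t: "0 \<le> t" and f: "f \<in> C0"
  shows "(\<lambda>k. heatF (exhaust k) t f x) \<longlonglongrightarrow> heat t f x"
proof -
  let ?A = "{x. f x \<noteq> 0}"
  have A: "finite ?A" using f by (simp add: C0_def)
  have "(\<lambda>k. \<Sum>y\<in>?A. f y * m y * heatF (exhaust k) t (unit_mass y) x) \<longlonglongrightarrow> (\<Sum>y\<in>?A. f y * m y * kern t x y)"
    by (intro tendsto_intros kern_lim t)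
  also have "(\<lambda>k. \<Sum>y\<in>?A. f y * m y * heatF (exhaust k) t (unit_mass y) x) = (\<lambda>k. heatF (exhaust k) t f x)"
    using heatF_kernel[OF finite_exhaust t A] by auto
  also have "(\<Sum>y\<in>?A. f y * m y * kern t x y) = heat t f x"
    unfolding heat_def by (subst ip_finite[OF A]) (auto simp: mult_ac)
  finally show ?thesis .
qed

lemma heat_unit_mass: "heat t (unit_mass y) x = kern t x y"
  by (simp add: heat_def ip_unit_mass)

lemma kern_eq_heat: assumes "0 \<le> t" shows "kern t x = heat t (unit_mass x)"
  using kern_sym[OF assms] by (auto simp: heat_unit_mass)

lemma heat_alt: assumes "0 \<le> t" shows "heat t f x = ip (heat t (unit_mass x)) f"
  by (simp add: heat_def kern_eq_heat[OF assms])

lemma dirichlet_C0: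
  assumes "f \<in> C0" shows "\<forall>\<^sub>F k in sequentially. dirichlet (exhaust k) f = L f"
proof -
  let ?A = "nbhd {x. f x \<noteq> 0}"
  have "finite ?A" using assms by (simp add: C0_def)
  have *: "dirichlet F f = L f" if "?A \<subseteq> F" for F
  proof
    fix x
    have "restr F f = f" using that nbhd_subset[of "{x. f x \<noteq> 0}"] by (intro restr_id) blast
    moreover have "L f x = 0" if "x \<notin> F" using \<open>?A \<subseteq> F\<close> that by (intro laplacian_support) blast
    ultimately show "dirichlet F f x = L f x" by (simp add: dirichlet_def)
  qed
  show ?thesis by (rule eventually_mono[OF eventually_exhaust[OF \<open>finite ?A\<close>]]) (rule *)
qed

lemma limit_l2_bound:
  assumes "\<And>x. (\<lambda>k. f k x) \<longlonglongrightarrow> g x" "\<forall>\<^sub>F k in sequentially. nrm (exhaust k) (f k) \<le> c"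
  shows "g \<in> l2 G" "N g \<le> c"
proof -
  have "\<forall>\<^sub>F k in sequentially. nrm F (f k) \<le> c" if "finite F" for F
    using eventually_exhaust[OF that] assms(2)
    by eventually_elim (rule order_trans[OF nrm_mono], auto)
  from l2_fatou[OF assms(1) this] show "g \<in> l2 G" "N g \<le> c" by blast+
qed

lemma heat_C0_l2:
  assumes t: "0 \<le> t" and f: "f \<in> C0" shows "heat t f \<in> l2 G" "N (heat t f) \<le> N f"
proof -
  have "nrm (exhaust k) (heatF (exhaust k) t f) \<le> N f" for k
    using heatF_contraction[OF finite_exhaust t, of k f] nrm_le_N[OF C0_l2[OF f] finite_exhaust[of k]] by linarith
  then show "heat t f \<in> l2 G" "N (heat t f) \<le> N f"
    using limit_l2_bound[of "\<lambda>k. heatF (exhaust k) t f", OF heat_lim[OF t f] always_eventually, of "N f"] by blast+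
qed

lemma kern_l2: "0 \<le> t \<Longrightarrow> kern t x \<in> l2 G"
  by (simp add: kern_eq_heat heat_C0_l2)

text \<open>Once the exhaustion contains the support of \<open>f\<close> together with its neighbours, the Dirichlet Laplacian
of \<open>f\<close> is its Laplacian, and Dirichlet flows commute with the former.\<close>

lemma heat_laplacian:
  assumes t: "0 \<le> t" and f: "f \<in> C0" shows "L (heat t f) = heat t (L f)"
proof
  fix x
  have "(\<lambda>k. L (heatF (exhaust k) t f) x) \<longlonglongrightarrow> L (heat t f) x"
    by (rule laplacian_tendsto) (rule heat_lim[OF t f])
  moreover have "\<forall>\<^sub>F k in sequentially. L (heatF (exhaust k) t f) x = heatF (exhaust k) t (L f) x"
    using dirichlet_C0[OF f] eventually_exhaust[of "{x}", simplified]
  proof eventually_elim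
    case (elim k)
    then show ?case
      using heatF_commute[OF finite_exhaust t, of k f x] solves_dirichlet[OF heatF_solves[OF finite_exhaust], of x k t f]
      by simp
  qed
  ultimately have "(\<lambda>k. heatF (exhaust k) t (L f) x) \<longlonglongrightarrow> L (heat t f) x"
    by (rule Lim_transform_eventually)
  then show "L (heat t f) x = heat t (L f) x" using heat_lim[OF t laplacian_C0[OF f]] LIMSEQ_unique by blast
qed

lemma heat_Dmax: "0 \<le> t \<Longrightarrow> f \<in> C0 \<Longrightarrow> heat t f \<in> Dmax"
  by (simp add: Dmax_def heat_C0_l2 heat_laplacian laplacian_C0)

lemma heat_lipschitz:
  assumes t: "0 \<le> t" and ts: "t \<le> s" and f: "f \<in> C0"
  shows "N (\<lambda>x. heat s f x - heat t f x) \<le> (s - t) * N (L f)"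
proof (rule limit_l2_bound(2))
  show "(\<lambda>k. heatF (exhaust k) s f x - heatF (exhaust k) t f x) \<longlonglongrightarrow> heat s f x - heat t f x" for x
    using t ts f by (intro tendsto_intros heat_lim) auto
  show "\<forall>\<^sub>F k in sequentially. nrm (exhaust k) (\<lambda>x. heatF (exhaust k) s f x - heatF (exhaust k) t f x) \<le> (s - t) * N (L f)"
    using dirichlet_C0[OF f]
  proof eventually_elim
    case (elim k)
    have "nrm (exhaust k) (L f) \<le> N (L f)" by (intro nrm_le_N C0_l2 laplacian_C0 f finite_exhaust)
    then have "(s - t) * nrm (exhaust k) (L f) \<le> (s - t) * N (L f)" using ts by (intro mult_left_mono) auto
    then show ?case using heatF_lipschitz[OF finite_exhaust t ts, of k f] elim by simp
  qed
qed

text \<open>The quantitative form of \<open>\<partial>\<^sub>t = \<Delta>\<close> in \<open>l2\<close>, inherited from the finite sets. It replaces every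
appeal to abstract semigroup theory on finitely supported functions.\<close>

lemma heat_taylor:
  assumes t: "0 \<le> t" and s: "0 \<le> s" and f: "f \<in> C0"
  shows "(\<lambda>x. heat s f x - heat t f x - (s - t) * L (heat t f) x) \<in> l2 G"
    and "N (\<lambda>x. heat s f x - heat t f x - (s - t) * L (heat t f) x) \<le> (s - t)\<^sup>2 * N (L (L f))"
proof -
  let ?d = "\<lambda>k x. heatF (exhaust k) s f x - heatF (exhaust k) t f x - (s - t) * heatF (exhaust k) t (L f) x"
  have 1: "(\<lambda>k. ?d k x) \<longlonglongrightarrow> heat s f x - heat t f x - (s - t) * L (heat t f) x" for x
    unfolding heat_laplacian[OF t f] using t s f by (intro tendsto_intros heat_lim laplacian_C0) auto
  have 2: "\<forall>\<^sub>F k in sequentially. nrm (exhaust k) (?d k) \<le> (s - t)\<^sup>2 * N (L (L f))"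
    using dirichlet_C0[OF f] dirichlet_C0[OF laplacian_C0[OF f]]
  proof eventually_elim
    case (elim k)
    have "nrm (exhaust k) (L (L f)) \<le> N (L (L f))" by (intro nrm_le_N C0_l2 laplacian_C0 f finite_exhaust)
    then have "(s - t)\<^sup>2 * nrm (exhaust k) (L (L f)) \<le> (s - t)\<^sup>2 * N (L (L f))" by (intro mult_left_mono) auto
    then show ?case using heatF_taylor[OF finite_exhaust t s, of k f] elim by simp
  qed
  from limit_l2_bound[OF 1 2]
  show "(\<lambda>x. heat s f x - heat t f x - (s - t) * L (heat t f) x) \<in> l2 G"
    and "N (\<lambda>x. heat s f x - heat t f x - (s - t) * L (heat t f) x) \<le> (s - t)\<^sup>2 * N (L (L f))" .
qed

lemma heat_nonneg: assumes "0 \<le> t" "f \<in> C0" "\<And>x. 0 \<le> f x" shows "0 \<le> heat t f x"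
  by (rule LIMSEQ_le_const[OF heat_lim[OF assms(1,2)]]) (use assms heatF_nonneg in auto)

lemma kern_nonneg: "0 \<le> t \<Longrightarrow> 0 \<le> kern t x y"
  using heat_nonneg[of t "unit_mass y" x] by (simp add: heat_unit_mass)

lemma kern_mass:
  assumes t: "0 \<le> t" and F: "finite F" shows "(\<Sum>x\<in>F. kern t x y * m x) \<le> 1"
proof (rule LIMSEQ_le_const2)
  show "(\<lambda>k. \<Sum>x\<in>F. heatF (exhaust k) t (unit_mass y) x * m x) \<longlonglongrightarrow> (\<Sum>x\<in>F. kern t x y * m x)"
    by (intro tendsto_intros kern_lim t)
  have "(\<Sum>x\<in>F. heatF (exhaust k) t (unit_mass y) x * m x) \<le> 1" for k
  proof -
    have "(\<Sum>x\<in>F. heatF (exhaust k) t (unit_mass y) x * m x) \<le> (\<Sum>x\<in>F \<union> exhaust k. heatF (exhaust k) t (unit_mass y) x * m x)"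
      using F t by (intro sum_mono2) (auto intro!: mult_nonneg_nonneg heatF_nonneg)
    also have "\<dots> = (\<Sum>x\<in>exhaust k. heatF (exhaust k) t (unit_mass y) x * m x)"
      using F by (intro sum.mono_neutral_right) (auto simp: heatF_support)
    also have "\<dots> \<le> (\<Sum>x\<in>exhaust k. unit_mass y x * m x)" using t by (intro heatF_mass) auto
    also have "\<dots> = (\<Sum>x\<in>exhaust k. if y = x then 1 else 0)"
      by (intro sum.cong refl) (auto simp: unit_mass_def indicator_def)
    also have "\<dots> \<le> 1" by simp
    finally show ?thesis .
  qed
  then show "\<exists>N. \<forall>k\<ge>N. (\<Sum>x\<in>F. heatF (exhaust k) t (unit_mass y) x * m x) \<le> 1" by blast
qed

lemma heat_ip_derivative:
  assumes t: "0 \<le> t" and f: "f \<in> C0" and g: "g \<in> l2 G"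
  shows "((\<lambda>s. ip g (heat s f)) has_real_derivative ip g (L (heat t f))) (at t within {0..})"
proof (rule derivative_from_quadratic_bound)
  fix s :: real assume "s \<in> {0..}"
  then have s: "0 \<le> s" by simp
  note l = heat_C0_l2(1)[OF s f] heat_C0_l2(1)[OF t f] DmaxD(2)[OF heat_Dmax[OF t f]]
  have "ip g (\<lambda>x. heat s f x - heat t f x - (s - t) * L (heat t f) x)
      = ip g (heat s f) - ip g (heat t f) - (s - t) * ip g (L (heat t f))"
  proof -
    have "(\<lambda>x. heat s f x - heat t f x - (s - t) * L (heat t f) x)
        = (\<lambda>x. 1 * (heat s f x - heat t f x) + (t - s) * L (heat t f) x)" by (auto simp: algebra_simps)
    then show ?thesis
      using ip_lin[OF l2_diff(1)[OF l(1,2)] l(3) g, of 1 "t - s"] ip_diff[OF l(1,2) g]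
      by (simp add: left_diff_distrib)
  qed
  then have "\<bar>ip g (heat s f) - ip g (heat t f) - (s - t) * ip g (L (heat t f))\<bar>
      \<le> N g * N (\<lambda>x. heat s f x - heat t f x - (s - t) * L (heat t f) x)"
    using ip_le[OF g heat_taylor(1)[OF t s f]] by simp
  also have "\<dots> \<le> N g * ((s - t)\<^sup>2 * N (L (L f)))" by (intro mult_left_mono heat_taylor t s f) auto
  finally show "\<bar>ip g (heat s f) - ip g (heat t f) - (s - t) * ip g (L (heat t f))\<bar>
      \<le> (N g * N (L (L f))) * (s - t)\<^sup>2" by (simp add: mult_ac)
qed

lemma heat_point_derivative:
  assumes t: "0 \<le> t" and f: "f \<in> C0"
  shows "((\<lambda>s. heat s f x) has_real_derivative L (heat t f) x) (at t within {0..})"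
  using heat_ip_derivative[OF t f unit_mass_l2[of x]] by (simp add: ip_unit_mass)

lemma heat_lin:
  assumes t: "0 \<le> t" and f: "f \<in> l2 G" and g: "g \<in> l2 G"
  shows "heat t (\<lambda>x. a * f x + b * g x) x = a * heat t f x + b * heat t g x"
  unfolding heat_def by (intro ip_lin f g kern_l2 t)

lemma heat_diff:
  assumes t: "0 \<le> t" and f: "f \<in> l2 G" and g: "g \<in> l2 G"
  shows "heat t (\<lambda>x. f x - g x) x = heat t f x - heat t g x"
  using heat_lin[OF assms, of 1 "-1"] by simp

lemma heat_0: "heat 0 f x = f x"
proof -
  have "\<forall>\<^sub>F k in sequentially. heatF (exhaust k) 0 (unit_mass x) y = unit_mass x y" for y
    by (rule eventually_mono[OF eventually_exhaust[of "{y}"]]) (auto simp: heatF_0 restr_def)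
  then have "(\<lambda>k. unit_mass x y) \<longlonglongrightarrow> kern 0 y x" for y
    using Lim_transform_eventually[OF kern_lim[of 0 x y]] by simp
  then have "unit_mass x y = kern 0 y x" for y using LIMSEQ_unique tendsto_const by blast
  then have "kern 0 x = unit_mass x" using kern_sym[of 0] by (auto simp: fun_eq_iff)
  then show ?thesis by (simp add: heat_def ip_unit_mass)
qed

lemma ip_sum:
  assumes A: "finite A" and g: "\<And>y. g y \<in> l2 G" and h: "h \<in> l2 G"
  shows "(\<lambda>x. \<Sum>y\<in>A. a y * g y x) \<in> l2 G \<and> ip h (\<lambda>x. \<Sum>y\<in>A. a y * g y x) = (\<Sum>y\<in>A. a y * ip h (g y))"
  using A
proof (induction A rule: finite_induct)
  case empty
  show ?case by (simp add: ip_def l2_def)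
next
  case (insert z A)
  then show ?case
    using l2_lin[of "g z" "\<lambda>x. \<Sum>y\<in>A. a y * g y x" "a z" 1] g
      ip_lin[of "g z" "\<lambda>x. \<Sum>y\<in>A. a y * g y x" h "a z" 1] h by simp
qed

lemma heat_sym_C0:
  assumes t: "0 \<le> t" and g: "g \<in> C0" and f: "f \<in> l2 G"
  shows "ip (heat t f) g = ip f (heat t g)"
proof -
  let ?A = "{x. g x \<noteq> 0}"
  have A: "finite ?A" using g by (simp add: C0_def)
  have "heat t g = (\<lambda>x. \<Sum>y\<in>?A. (g y * m y) * kern t y x)"
  proof
    fix x
    have "heat t g x = (\<Sum>y\<in>?A. kern t x y * g y * m y)"
      unfolding heat_def by (rule ip_finite[OF A]) auto
    also have "\<dots> = (\<Sum>y\<in>?A. (g y * m y) * kern t y x)"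
      by (intro sum.cong refl) (simp add: kern_sym[OF t, of x])
    finally show "heat t g x = (\<Sum>y\<in>?A. (g y * m y) * kern t y x)" .
  qed
  then have "ip f (heat t g) = (\<Sum>y\<in>?A. g y * m y * ip f (kern t y))"
    using ip_sum[OF A kern_l2[OF t] f, of "\<lambda>y. g y * m y" "\<lambda>y. y"] by simp
  also have "\<dots> = ip (heat t f) g"
    by (subst ip_finite[OF A]) (auto simp: heat_def ip_sym mult_ac)
  finally show ?thesis by simp
qed

text \<open>Contractivity by duality: on a finite set test the flow of \<open>f\<close> with its own restriction, and move the
flow to that finitely supported function.\<close>

lemma heat_l2:
  assumes t: "0 \<le> t" and f: "f \<in> l2 G" shows "heat t f \<in> l2 G" "N (heat t f) \<le> N f"
proof -
  have "nrm F (heat t f) \<le> N f" if F: "finite F" for F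
  proof -
    let ?g = "restr F (heat t f)"
    have "(nrm F (heat t f))\<^sup>2 = ip (heat t f) ?g"
      unfolding nrm_square by (subst ip_finite[OF F]) (auto simp: restr_def power2_eq_square)
    also have "\<dots> = ip f (heat t ?g)" by (intro heat_sym_C0 t f restr_C0 F)
    also have "\<dots> \<le> N f * N (heat t ?g)"
      using ip_le[OF f heat_C0_l2(1)[OF t restr_C0[OF F]]] by (meson abs_ge_self order_trans)
    also have "\<dots> \<le> N f * N ?g" by (intro mult_left_mono heat_C0_l2 t restr_C0 F) auto
    finally have "nrm F (heat t f) * nrm F (heat t f) \<le> N f * nrm F (heat t f)"
      by (simp add: restr_nrm[OF F] power2_eq_square)
    then show ?thesis
      by (cases "nrm F (heat t f) = 0") (auto simp: less_le)
  qed
  from l2_boundI[OF this] show "heat t f \<in> l2 G" "N (heat t f) \<le> N f" by auto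
qed

lemma heat_sym:
  assumes t: "0 \<le> t" and f: "f \<in> l2 G" and g: "g \<in> l2 G"
  shows "ip (heat t f) g = ip f (heat t g)"
proof -
  have bd: "\<bar>ip (heat t f) g - ip f (heat t g)\<bar> \<le> e" if e: "0 < e" for e
  proof -
    obtain A where A: "finite A" "N (\<lambda>x. g x - restr A g x) < e / (2 * (N f + 1))"
      using l2_restr_approx[OF g, of "e / (2 * (N f + 1))"] e N_nonneg[of f] by auto
    let ?r = "restr A g"
    let ?d = "\<lambda>x. g x - ?r x"
    have r: "?r \<in> C0" by (rule restr_C0[OF A(1)])
    note r2 = C0_l2[OF r]
    have d: "?d \<in> l2 G" by (rule l2_diff[OF g r2])
    have "ip (heat t f) ?d = ip (heat t f) g - ip (heat t f) ?r" by (rule ip_diff[OF g r2 heat_l2(1)[OF t f]])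
    moreover have "ip f (heat t ?d) = ip f (heat t g) - ip f (heat t ?r)"
    proof -
      have "heat t ?d = (\<lambda>x. heat t g x - heat t ?r x)" using heat_diff[OF t g r2] by auto
      then show ?thesis using ip_diff[OF heat_l2(1)[OF t g] heat_l2(1)[OF t r2] f] by simp
    qed
    ultimately have "\<bar>ip (heat t f) g - ip f (heat t g)\<bar> \<le> \<bar>ip (heat t f) ?d\<bar> + \<bar>ip f (heat t ?d)\<bar>"
      using heat_sym_C0[OF t r f] by linarith
    also have "\<bar>ip (heat t f) ?d\<bar> \<le> N (heat t f) * N ?d" by (rule ip_le[OF heat_l2(1)[OF t f] d])
    also have "\<dots> \<le> N f * N ?d" by (intro mult_right_mono heat_l2 t f) auto
    also have "\<bar>ip f (heat t ?d)\<bar> \<le> N f * N (heat t ?d)" by (rule ip_le[OF f heat_l2(1)[OF t d]])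
    also have "\<dots> \<le> N f * N ?d" by (intro mult_left_mono heat_l2 t d) auto
    also have "N f * N ?d + N f * N ?d \<le> (N f + 1) * (2 * N ?d)" by (simp add: algebra_simps)
    also have "\<dots> \<le> e" using A(2) N_nonneg[of f] by (simp add: field_simps)
    finally show ?thesis by simp
  qed
  have "\<bar>ip (heat t f) g - ip f (heat t g)\<bar> \<le> 0" by (rule field_le_epsilon) (use bd in simp)
  then show ?thesis by simp
qed

text \<open>Monotone convergence: the composition law holds for each Dirichlet kernel, and all terms increase along the
exhaustion.\<close>

lemma chapman_kolmogorov:
  assumes s: "0 \<le> s" and t: "0 \<le> t"
  shows "heat t (heat s (unit_mass y)) x = heat (t + s) (unit_mass y) x"
proof -
  define a where "a k z = heatF (exhaust k) t (unit_mass z) x * heatF (exhaust k) s (unit_mass y) z * m z" for k z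
  define b where "b z = kern t x z * kern s z y * m z" for z
  have ab: "(\<lambda>k. a k z) \<longlonglongrightarrow> b z" for z
    unfolding a_def b_def by (intro tendsto_intros kern_lim t s)
  have le: "a k z \<le> b z" for k z
    unfolding a_def b_def by (intro mult_mono mult_nonneg_nonneg kern_ge heatF_nonneg kern_nonneg t s) auto
  have a0: "0 \<le> a k z" for k z
    unfolding a_def by (intro mult_nonneg_nonneg heatF_nonneg t s) auto
  have b0: "0 \<le> b z" for z using a0 le order_trans by blast
  have fin: "(\<Sum>z\<in>exhaust k. a k z) = heatF (exhaust k) (t + s) (unit_mass y) x" for k
  proof -
    have "heatF (exhaust k) (t + s) (unit_mass y) x = heatF (exhaust k) t (heatF (exhaust k) s (unit_mass y)) x"
      by (rule heatF_semigroup[OF finite_exhaust s t])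
    also have "\<dots> = (\<Sum>z\<in>exhaust k. heatF (exhaust k) s (unit_mass y) z * m z * heatF (exhaust k) t (unit_mass z) x)"
      by (rule heatF_kernel[OF finite_exhaust t finite_exhaust]) (rule heatF_support)
    finally show ?thesis by (simp add: a_def mult_ac)
  qed
  have lim: "(\<lambda>k. \<Sum>z\<in>exhaust k. a k z) \<longlonglongrightarrow> kern (t + s) x y"
    unfolding fin by (rule kern_lim) (use s t in auto)
  have up: "sum b F \<le> kern (t + s) x y" if F: "finite F" for F
  proof (rule LIMSEQ_le[OF _ lim])
    show "(\<lambda>k. \<Sum>z\<in>F. a k z) \<longlonglongrightarrow> sum b F" by (intro tendsto_intros ab)
    show "\<exists>n. \<forall>k\<ge>n. (\<Sum>z\<in>F. a k z) \<le> (\<Sum>z\<in>exhaust k. a k z)"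
      using eventually_exhaust[OF F] unfolding eventually_sequentially
      by (meson a0 finite_exhaust sum_mono2)
  qed
  have sm: "b summable_on UNIV"
    by (rule nonneg_bdd_above_summable_on) (use b0 up in \<open>auto intro!: bdd_aboveI2\<close>)
  have "infsum b UNIV \<le> kern (t + s) x y" by (rule infsum_le_finite_sums[OF sm]) (use up in auto)
  moreover have "kern (t + s) x y \<le> infsum b UNIV"
  proof (rule LIMSEQ_le_const2[OF lim])
    have "(\<Sum>z\<in>exhaust k. a k z) \<le> infsum b UNIV" for k
      by (rule order_trans[OF sum_mono[OF le] finite_sum_le_infsum[OF sm]]) (use b0 in auto)
    then show "\<exists>N. \<forall>k\<ge>N. (\<Sum>z\<in>exhaust k. a k z) \<le> infsum b UNIV" by blast
  qed
  moreover have "heat t (heat s (unit_mass y)) x = infsum b UNIV"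
    by (simp add: heat_def[of t] ip_def b_def[abs_def] heat_unit_mass)
  ultimately show ?thesis by (simp add: heat_unit_mass)
qed

lemma heat_semigroup_law:
  assumes s: "0 \<le> s" and t: "0 \<le> t" and f: "f \<in> l2 G"
  shows "heat (s + t) f = heat s (heat t f)"
proof
  fix x
  have "heat (s + t) f x = ip (heat (s + t) (unit_mass x)) f" using s t by (intro heat_alt) auto
  also have "heat (s + t) (unit_mass x) = heat t (heat s (unit_mass x))" using chapman_kolmogorov[OF s t] by (auto simp: add.commute)
  also have "ip (heat t (heat s (unit_mass x))) f = ip (heat s (unit_mass x)) (heat t f)"
    by (intro heat_sym t f heat_l2 s unit_mass_l2)
  also have "\<dots> = heat s (heat t f) x" by (simp add: heat_alt[OF s])
  finally show "heat (s + t) f x = heat s (heat t f) x" .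
qed

text \<open>Strong continuity follows from contractivity and the Lipschitz bound on the dense set of finitely
supported functions.\<close>

lemma heat_continuous_0:
  assumes f: "f \<in> l2 G" and e: "0 < e"
  obtains \<delta> where "0 < \<delta>" "\<And>h. 0 \<le> h \<Longrightarrow> h \<le> \<delta> \<Longrightarrow> N (\<lambda>x. heat h f x - f x) \<le> e"
proof -
  obtain A where A: "finite A" "N (\<lambda>x. f x - restr A f x) < e / 3"
    using l2_restr_approx[OF f, of "e / 3"] e by auto
  let ?r = "restr A f"
  let ?d = "\<lambda>x. f x - ?r x"
  have r: "?r \<in> C0" by (rule restr_C0[OF A(1)])
  note r2 = C0_l2[OF r]
  have d: "?d \<in> l2 G" by (rule l2_diff[OF f r2])
  define \<delta> where "\<delta> = e / (3 * (N (L ?r) + 1))"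
  have N1: "0 < N (L ?r) + 1" using N_nonneg[of "L ?r"] by linarith
  show thesis
  proof (rule that[of \<delta>])
    show "0 < \<delta>" using e N1 by (simp add: \<delta>_def)
    fix h assume h: "0 \<le> h" "h \<le> \<delta>"
    have "(\<lambda>x. heat h f x - f x) = (\<lambda>x. (heat h ?d x - ?d x) + (heat h ?r x - heat 0 ?r x))"
      using heat_diff[OF h(1) f r2] by (auto simp: heat_0)
    then have "N (\<lambda>x. heat h f x - f x) \<le> N (\<lambda>x. heat h ?d x - ?d x) + N (\<lambda>x. heat h ?r x - heat 0 ?r x)"
      using l2_add(2)[OF l2_diff(1)[OF heat_l2(1)[OF h(1) d] d] l2_diff(1)[OF heat_l2(1)[OF h(1) r2] heat_l2(1)[of 0, OF _ r2]]] by simp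
    also have "N (\<lambda>x. heat h ?d x - ?d x) \<le> N (heat h ?d) + N ?d" by (rule l2_diff[OF heat_l2(1)[OF h(1) d] d])
    also have "N (heat h ?d) \<le> N ?d" by (rule heat_l2[OF h(1) d])
    also have "N (\<lambda>x. heat h ?r x - heat 0 ?r x) \<le> (h - 0) * N (L ?r)" by (rule heat_lipschitz[OF _ h(1) r]) simp
    also have "(h - 0) * N (L ?r) \<le> \<delta> * (N (L ?r) + 1)" using h by (intro mult_mono) auto
    also have "\<dots> = e / 3" unfolding \<delta>_def using N1 by (subst times_divide_eq_left, subst nonzero_divide_eq_eq) auto
    finally show "N (\<lambda>x. heat h f x - f x) \<le> e" using A(2) by simp
  qed
qed

lemma heat_strongly_continuous: "C0_semigroup_on_l2 G heat"
  unfolding C0_semigroup_on_l2_def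
proof (intro conjI allI impI ballI)
  fix f assume f: "f \<in> l2 G"
  show "((\<lambda>h. N (\<lambda>x. heat h f x - f x)) \<longlongrightarrow> 0) (at_right 0)"
  proof (rule tendstoI)
    fix e :: real assume e: "0 < e"
    obtain \<delta> where \<delta>: "0 < \<delta>" "\<And>h. 0 \<le> h \<Longrightarrow> h \<le> \<delta> \<Longrightarrow> N (\<lambda>x. heat h f x - f x) \<le> e / 2"
      using heat_continuous_0[OF f, of "e / 2"] e by auto
    show "\<forall>\<^sub>F h in at_right 0. dist (N (\<lambda>x. heat h f x - f x)) 0 < e"
      unfolding eventually_at_right_field
    proof (intro exI[of _ \<delta>] conjI \<delta>(1) allI impI)
      fix h :: real assume "0 < h" "h < \<delta>"
      then show "dist (N (\<lambda>x. heat h f x - f x)) 0 < e" using \<delta>(2)[of h] e by simp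
    qed
  qed
qed (auto simp: heat_l2 heat_lin heat_0 heat_semigroup_law intro!: exI[of _ 1])

end

section \<open>The generator of the heat semigroup\<close>

context complete_weighted begin

text \<open>By kernel symmetry the flow of \<open>f\<close> at \<open>x\<close> is the pairing of \<open>f\<close> with the flow of a
unit mass, which is differentiable in \<open>l2\<close>; Green's formula on the maximal domain moves the Laplacian
onto \<open>f\<close>.\<close>

lemma heat_derivative_Dmax:
  assumes t: "0 \<le> t" and f: "f \<in> Dmax"
  shows "((\<lambda>s. heat s f x) has_real_derivative heat t (L f) x) (at t within {0..})"
proof -
  have "((\<lambda>s. ip f (heat s (unit_mass x))) has_real_derivative ip f (L (heat t (unit_mass x)))) (at t within {0..})"
    by (rule heat_ip_derivative[OF t unit_mass_C0 DmaxD(1)[OF f]])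
  moreover have "ip f (L (heat t (unit_mass x))) = heat t (L f) x"
    using green_Dmax[OF f heat_Dmax[OF t unit_mass_C0]] by (simp add: heat_alt[OF t] ip_sym)
  ultimately have *: "((\<lambda>s. ip f (heat s (unit_mass x))) has_real_derivative heat t (L f) x) (at t within {0..})" by simp
  show ?thesis
    by (rule has_field_derivative_transform_within[OF *, of 1]) (use t in \<open>auto simp: heat_alt ip_sym\<close>)
qed

text \<open>The mean value inequality turns pointwise derivatives into a norm estimate: the difference quotient deviates
from \<open>\<Delta>f\<close> by no more than the flow moves \<open>\<Delta>f\<close> during the time step.\<close>

lemma heat_generator_Dmax:
  assumes f: "f \<in> Dmax"
  shows "((\<lambda>h. N (\<lambda>x. (heat h f x - f x) / h - L f x)) \<longlongrightarrow> 0) (at_right 0)"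
proof (rule tendstoI)
  fix e :: real assume e: "0 < e"
  note Lf = DmaxD(2)[OF f]
  obtain \<delta> where \<delta>: "0 < \<delta>" "\<And>h. 0 \<le> h \<Longrightarrow> h \<le> \<delta> \<Longrightarrow> N (\<lambda>x. heat h (L f) x - L f x) \<le> e / 2"
    using heat_continuous_0[OF Lf, of "e / 2"] e by auto
  have "N (\<lambda>x. (heat h f x - f x) / h - L f x) \<le> e / 2" if h: "0 < h" "h < \<delta>" for h
  proof (rule l2_boundI(2))
    fix F :: "'v set" assume F: "finite F"
    have "nrm F (\<lambda>x. heat h f x - heat 0 f x - (h - 0) * L f x) \<le> (h - 0) * (e / 2)"
    proof (rule mvt_nrm[OF F])
      fix x and s :: real assume "0 \<le> s"
      show "((\<lambda>t. heat t f x) has_real_derivative heat s (L f) x) (at s within {0..h})"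
        by (rule has_field_derivative_subset[OF heat_derivative_Dmax[OF \<open>0 \<le> s\<close> f]]) auto
    next
      fix s assume s: "0 \<le> s" "s \<le> h"
      have "nrm F (\<lambda>x. heat s (L f) x - L f x) \<le> N (\<lambda>x. heat s (L f) x - L f x)"
        by (intro nrm_le_N l2_diff heat_l2 Lf F s)
      then show "nrm F (\<lambda>x. heat s (L f) x - L f x) \<le> e / 2" using \<delta>(2)[of s] s h by simp
    qed (use h in auto)
    then have "nrm F (\<lambda>x. (1 / h) * (heat h f x - f x - h * L f x)) \<le> (1 / h) * (h * (e / 2))"
      unfolding nrm_scale using h by (intro mult_mono) (auto simp: heat_0)
    then show "nrm F (\<lambda>x. (heat h f x - f x) / h - L f x) \<le> e / 2"
      using h by (simp add: right_diff_distrib diff_divide_distrib)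
  qed
  then show "\<forall>\<^sub>F h in at_right 0. dist (N (\<lambda>x. (heat h f x - f x) / h - L f x)) 0 < e"
    unfolding eventually_at_right_field using \<delta>(1) e by (intro exI[of _ \<delta>]) (auto, fastforce)
qed

text \<open>For the converse inclusion, a limit of difference quotients is identified pointwise with the Laplacian by testing
with unit masses, whose flow has a derivative at time zero; this puts \<open>\<Delta>f\<close> into \<open>l2\<close>.\<close>

lemma heat_generated: "generated_by_laplacian G heat"
  unfolding generated_by_laplacian_def dom_laplacian_eq
proof (intro ballI iffI)
  fix f g assume f: "f \<in> l2 G" and g: "g \<in> l2 G"
  assume lim: "((\<lambda>h. N (\<lambda>x. (heat h f x - f x) / h - g x)) \<longlongrightarrow> 0) (at_right 0)"
  have "g x = L f x" for x
  proof -
    let ?q = "\<lambda>h. (heat h f x - f x) / h"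
    have "\<bar>?q h - g x\<bar> \<le> N (\<lambda>x. (heat h f x - f x) / h - g x) / sqrt (m x)" if "0 < h" for h
    proof -
      have "(\<lambda>x. (heat h f x - f x) / h - g x) \<in> l2 G"
        using l2_diff(1)[OF l2_scale(1)[OF l2_diff(1)[OF heat_l2(1)[of h f] f], of "1 / h"] g] f that by simp
      from l2_point[OF this, of x] show ?thesis by (simp add: field_simps)
    qed
    then have "\<forall>\<^sub>F h in at_right 0. norm (?q h - g x) \<le> N (\<lambda>x. (heat h f x - f x) / h - g x) / sqrt (m x)"
      unfolding eventually_at_right_field by (intro exI[of _ 1]) auto
    moreover have "((\<lambda>h. N (\<lambda>x. (heat h f x - f x) / h - g x) / sqrt (m x)) \<longlongrightarrow> 0) (at_right 0)"
      using tendsto_divide[OF lim tendsto_const, of "sqrt (m x)"] by simp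
    ultimately have "((\<lambda>h. ?q h - g x) \<longlongrightarrow> 0) (at_right 0)" by (rule Lim_null_comparison)
    then have 1: "(?q \<longlongrightarrow> g x) (at_right 0)" by (rule LIM_zero_cancel)
    have S0: "heat 0 (unit_mass x) = unit_mass x" by (auto simp: heat_0)
    have "((\<lambda>s. ip f (heat s (unit_mass x))) has_real_derivative ip f (L (heat 0 (unit_mass x)))) (at 0 within {0..})"
      by (rule heat_ip_derivative[OF _ unit_mass_C0 f]) simp
    then have "((\<lambda>h. (ip f (heat h (unit_mass x)) - ip f (heat 0 (unit_mass x))) / (h - 0)) \<longlongrightarrow> ip f (L (heat 0 (unit_mass x)))) (at 0 within {0<..})"
      unfolding has_field_derivative_iff by (rule tendsto_within_subset) auto
    moreover have "\<forall>\<^sub>F h in at_right 0. (ip f (heat h (unit_mass x)) - ip f (heat 0 (unit_mass x))) / (h - 0) = ?q h"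
      unfolding eventually_at_right_field
    proof (intro exI[of _ 1] conjI allI impI)
      fix h :: real assume "0 < h"
      then have "heat h f x = ip f (heat h (unit_mass x))" using heat_alt[of h f x] ip_sym by simp
      moreover have "ip f (heat 0 (unit_mass x)) = f x" unfolding S0 by (rule ip_unit_mass)
      ultimately show "(ip f (heat h (unit_mass x)) - ip f (heat 0 (unit_mass x))) / (h - 0) = ?q h" by simp
    qed simp
    ultimately have 2: "(?q \<longlongrightarrow> ip f (L (heat 0 (unit_mass x)))) (at_right 0)"
      by (rule Lim_transform_eventually)
    have "ip f (L (unit_mass x)) = L f x"
    proof -
      let ?A = "nbhd {x}"
      have L0: "L (unit_mass x) z = 0" if "z \<notin> ?A" for z
        using that by (intro laplacian_support) (auto simp: unit_mass_def nbhd_def indicator_def split: if_splits)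
      have "ip f (L (unit_mass x)) = (\<Sum>z\<in>?A. f z * L (unit_mass x) z * m z)"
        using L0 by (intro ip_finite) auto
      also have "\<dots> = (\<Sum>z\<in>?A. restr ?A f z * L (unit_mass x) z * m z)"
        by (intro sum.cong refl) (simp add: restr_def)
      also have "\<dots> = ip (restr ?A f) (L (unit_mass x))"
        using L0 by (intro ip_finite[symmetric]) auto
      also have "\<dots> = ip (L (restr ?A f)) (unit_mass x)"
        by (intro green_Dmax C0_Dmax restr_C0 unit_mass_C0 finite_nbhd) auto
      also have "\<dots> = L (restr ?A f) x" by (rule ip_unit_mass)
      also have "\<dots> = L f x"
        unfolding laplacian_def by (intro arg_cong2[of _ _ _ _ "(/)"] sum.cong refl) (auto simp: restr_def nbhd_def)
      finally show ?thesis .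
    qed
    then show ?thesis using tendsto_unique[OF _ 1 2] S0 by simp
  qed
  then have "g = L f" by auto
  then show "f \<in> Dmax \<and> g = L f" using f g by (simp add: Dmax_def)
next
  fix f g assume "f \<in> Dmax \<and> g = L f"
  then show "((\<lambda>h. N (\<lambda>x. (heat h f x - f x) / h - g x)) \<longlongrightarrow> 0) (at_right 0)"
    using heat_generator_Dmax by simp
qed

end

section \<open>Uniqueness of the semigroup\<close>

context weighted begin

lemma l2_geometric_limit:
  assumes X: "\<And>k. X k \<in> l2 G" and step: "\<And>k. N (\<lambda>x. X (Suc k) x - X k x) \<le> (1/3) ^ k"
  obtains y where "y \<in> l2 G" "\<And>k. (\<lambda>x. X k x - y x) \<in> l2 G" "\<And>k. N (\<lambda>x. X k x - y x) \<le> 3/2 * (1/3) ^ k"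
proof -
  have pw: "\<bar>X (Suc k) x - X k x\<bar> \<le> (1/3) ^ k / sqrt (m x)" for k x
    using order_trans[OF l2_point[OF l2_diff(1)[OF X[of "Suc k"] X[of k]], of x] step[of k]]
    by (simp add: pos_le_divide_eq)
  have "convergent (\<lambda>k. X k x)" for x
  proof -
    have "summable (\<lambda>k. (1/3::real) ^ k * (1 / sqrt (m x)))"
      by (intro summable_mult2 summable_geometric) simp
    then have "summable (\<lambda>k. X (Suc k) x - X k x)"
      by (rule summable_comparison_test[rotated]) (use pw[of _ x] in auto)
    from summable_LIMSEQ[OF this]
    have "(\<lambda>n. X n x - X 0 x) \<longlonglongrightarrow> (\<Sum>k. X (Suc k) x - X k x)" unfolding sum_lessThan_telescope[of "\<lambda>n. X n x"] .
    from tendsto_add[OF this tendsto_const[of "X 0 x"]] show ?thesis by (auto simp: convergent_def)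
  qed
  then obtain y where y: "\<And>x. (\<lambda>k. X k x) \<longlonglongrightarrow> y x" unfolding convergent_def by metis
  have diff: "N (\<lambda>x. X k x - X (k + j) x) \<le> 3/2 * (1/3) ^ k * (1 - (1/3) ^ j)" for k j
  proof (induction j)
    case 0 then show ?case by (simp add: l2_norm_def)
  next
    case (Suc j)
    have "N (\<lambda>x. X k x - X (k + Suc j) x) = N (\<lambda>x. (X k x - X (k + j) x) + (X (k + j) x - X (Suc (k + j)) x))" by simp
    also have "\<dots> \<le> N (\<lambda>x. X k x - X (k + j) x) + N (\<lambda>x. X (k + j) x - X (Suc (k + j)) x)"
      by (intro l2_add l2_diff X)
    also have "N (\<lambda>x. X (k + j) x - X (Suc (k + j)) x) \<le> (1/3) ^ (k + j)"
      using step[of "k + j"] by (simp add: l2_minus_commute)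
    finally show ?case using Suc by (simp add: power_add field_simps)
  qed
  have lim: "(\<lambda>x. X k x - y x) \<in> l2 G \<and> N (\<lambda>x. X k x - y x) \<le> 3/2 * (1/3) ^ k" for k
  proof -
    have 1: "(\<lambda>n. X k x - X n x) \<longlonglongrightarrow> X k x - y x" for x by (intro tendsto_intros y)
    have 2: "\<forall>\<^sub>F n in sequentially. nrm F (\<lambda>x. X k x - X n x) \<le> 3/2 * (1/3) ^ k" if F: "finite F" for F
    proof (rule eventually_sequentiallyI)
      fix n assume "k \<le> n"
      then obtain j where n: "n = k + j" using le_Suc_ex by blast
      have "nrm F (\<lambda>x. X k x - X n x) \<le> N (\<lambda>x. X k x - X n x)" by (intro nrm_le_N l2_diff X F)
      also have "\<dots> \<le> 3/2 * (1/3) ^ k * (1 - (1/3) ^ j)" unfolding n by (rule diff)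
      also have "\<dots> \<le> 3/2 * (1/3) ^ k * 1" by (intro mult_left_mono) auto
      finally show "nrm F (\<lambda>x. X k x - X n x) \<le> 3/2 * (1/3) ^ k" by simp
    qed
    show ?thesis using l2_fatou[of "\<lambda>n x. X k x - X n x", OF 1 2] by blast
  qed
  have "y \<in> l2 G" using l2_diff(1)[OF X[of 0] conjunct1[OF lim[of 0]]] by simp
  with lim show thesis using that by blast
qed

lemma semigroupD:
  assumes "C0_semigroup_on_l2 G P"
  shows "0 \<le> t \<Longrightarrow> f \<in> l2 G \<Longrightarrow> P t f \<in> l2 G"
    and "0 \<le> t \<Longrightarrow> f \<in> l2 G \<Longrightarrow> g \<in> l2 G \<Longrightarrow> P t (\<lambda>x. a * f x + b * g x) = (\<lambda>x. a * P t f x + b * P t g x)"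
    and "0 \<le> t \<Longrightarrow> \<exists>c. \<forall>f\<in>l2 G. N (P t f) \<le> c * N f"
    and "f \<in> l2 G \<Longrightarrow> P 0 f = f"
    and "0 \<le> s \<Longrightarrow> 0 \<le> t \<Longrightarrow> f \<in> l2 G \<Longrightarrow> P (s + t) f = P s (P t f)"
    and "f \<in> l2 G \<Longrightarrow> ((\<lambda>h. N (\<lambda>x. P h f x - f x)) \<longlongrightarrow> 0) (at_right 0)"
  using assms unfolding C0_semigroup_on_l2_def by blast+

text \<open>The principle of uniform boundedness, proved by a gliding hump. If the operator norms were unbounded near
zero, choose times \<open>H k\<close> tending to zero with norms above \<open>4\<^sup>k\<close> and almost norming unit vectors \<open>E k\<close>, and
add \<open>\<plusminus>3\<^sup>-\<^sup>k E k\<close> successively. One of the two signs makes the image under the \<open>k\<close>-th operator at least as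
large as that of \<open>3\<^sup>-\<^sup>k E k\<close>, and all later corrections together have norm at most \<open>3\<^sup>-\<^sup>k/2\<close>, too little to
destroy it. The limit vector contradicts strong continuity at zero.\<close>

lemma semigroup_bounded_near_0:
  assumes P: "C0_semigroup_on_l2 G P"
  obtains \<delta> M where "0 < \<delta>" "1 \<le> M" "\<And>h f. 0 \<le> h \<Longrightarrow> h \<le> \<delta> \<Longrightarrow> f \<in> l2 G \<Longrightarrow> N (P h f) \<le> M * N f"
proof (rule ccontr)
  note bounded = that
  assume no: "\<not> thesis"
  have unb: "\<exists>h f. 0 \<le> h \<and> h \<le> \<delta> \<and> f \<in> l2 G \<and> M * N f < N (P h f)" if dM: "0 < \<delta>" "1 \<le> M" for \<delta> M
  proof (rule ccontr)
    assume "\<not> ?thesis"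
    then have "\<And>h f. 0 \<le> h \<Longrightarrow> h \<le> \<delta> \<Longrightarrow> f \<in> l2 G \<Longrightarrow> N (P h f) \<le> M * N f" by (meson not_le)
    then have thesis by (rule bounded[OF dM])
    with no show False by simp
  qed
  note lin = semigroupD(2)[OF P]
  have scale: "P h (\<lambda>x. a * f x) = (\<lambda>x. a * P h f x)" if "0 \<le> h" "f \<in> l2 G" for h a f
    using lin[OF that that(2), of a 0] by simp
  \<comment> \<open>\<open>opn h\<close> is the operator norm of \<open>P h\<close>, as the least admissible constant.\<close>
  define bds where "bds h = {c. 0 \<le> c \<and> (\<forall>f\<in>l2 G. N (P h f) \<le> c * N f)}" for h
  define opn where "opn h = Inf (bds h)" for h
  have ne: "bds h \<noteq> {}" if h: "0 \<le> h" for h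
  proof -
    obtain c where c: "\<forall>f\<in>l2 G. N (P h f) \<le> c * N f" using semigroupD(3)[OF P h] by blast
    have "max 0 c \<in> bds h"
      unfolding bds_def using c by (auto intro: order_trans[OF _ mult_right_mono[OF max.cobounded2]])
    then show ?thesis by blast
  qed
  have bb: "bdd_below (bds h)" for h by (auto simp: bds_def intro!: bdd_belowI[of _ 0])
  have opn_bound: "N (P h f) \<le> opn h * N f" if h: "0 \<le> h" and f: "f \<in> l2 G" for h f
  proof (cases "N f = 0")
    case True
    obtain c where "c \<in> bds h" using ne[OF h] by blast
    then have "N (P h f) \<le> c * N f" using f by (simp add: bds_def)
    then show ?thesis using True by simp
  next
    case False
    then have Nf: "0 < N f" using N_nonneg[of f] by linarith
    have "N (P h f) / N f \<le> opn h"
      unfolding opn_def by (rule cInf_greatest[OF ne[OF h]]) (use f Nf in \<open>auto simp: bds_def pos_divide_le_eq\<close>)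
    then show ?thesis using Nf by (simp add: pos_divide_le_eq)
  qed
  have almost: "\<exists>e\<in>l2 G. N e = 1 \<and> 3/4 * opn h \<le> N (P h e)" if h: "0 \<le> h" and o: "0 < opn h" for h
  proof -
    have "3/4 * opn h \<notin> bds h" using cInf_lower[OF _ bb, of "3/4 * opn h" h] o by (auto simp: opn_def)
    then obtain f where f: "f \<in> l2 G" "3/4 * opn h * N f < N (P h f)" using o by (auto simp: bds_def not_le)
    have "N f \<noteq> 0" using f opn_bound[OF h f(1)] by auto
    then have Nf: "0 < N f" using N_nonneg[of f] by linarith
    let ?e = "\<lambda>x. (1 / N f) * f x"
    have "N ?e = 1" using Nf by (simp only: l2_scale(2)[OF f(1)]) simp
    moreover have "N (P h ?e) = N (P h f) / N f"
      unfolding scale[OF h f(1)] using Nf by (simp only: l2_scale(2)[OF semigroupD(1)[OF P h f(1)]]) simp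
    moreover have "3/4 * opn h \<le> N (P h f) / N f" using f(2) Nf by (simp add: pos_le_divide_eq)
    moreover have "?e \<in> l2 G" by (rule l2_scale(1)[OF f(1)])
    ultimately show ?thesis by (intro bexI[of _ ?e]) simp_all
  qed
  have "\<exists>h e. 0 \<le> h \<and> h \<le> 1 / real (Suc k) \<and> 4 ^ k < opn h \<and> e \<in> l2 G \<and> N e = 1 \<and> 3/4 * opn h \<le> N (P h e)" for k
  proof -
    obtain h f where h: "0 \<le> h" "h \<le> 1 / real (Suc k)" "f \<in> l2 G" "4 ^ k * N f < N (P h f)"
      using unb[of "1 / real (Suc k)" "4 ^ k"] by auto
    have "4 ^ k * N f < opn h * N f" using h opn_bound[OF h(1,3)] by linarith
    then have o: "4 ^ k < opn h" using N_nonneg[of f] by (simp add: mult_less_cancel_right)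
    then have "0 < opn h" by (meson less_trans zero_less_numeral zero_less_power)
    from almost[OF h(1) this] h(1,2) o show ?thesis by blast
  qed
  then obtain H E where HE: "\<And>k. 0 \<le> H k" "\<And>k. H k \<le> 1 / real (Suc k)" "\<And>k. 4 ^ k < opn (H k)"
    "\<And>k. E k \<in> l2 G" "\<And>k. N (E k) = 1" "\<And>k. 3/4 * opn (H k) \<le> N (P (H k) (E k))"
    by metis
  define stp where "stp k X \<sigma> = (\<lambda>x. X x + (\<sigma> * (1/3) ^ k) * E k x)" for k X and \<sigma> :: real
  define X where "X = rec_nat (\<lambda>_. 0::real) (\<lambda>k Y. if (1/3) ^ k * N (P (H k) (E k)) \<le> N (P (H k) (stp k Y 1))
     then stp k Y 1 else stp k Y (-1))"
  have XS: "X (Suc k) = (if (1/3) ^ k * N (P (H k) (E k)) \<le> N (P (H k) (stp k (X k) 1))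
     then stp k (X k) 1 else stp k (X k) (-1))" for k by (simp add: X_def)
  have X: "X k \<in> l2 G" for k
  proof (induction k)
    case 0 show ?case by (simp add: X_def l2_def)
  next
    case (Suc k)
    have "stp k (X k) \<sigma> \<in> l2 G" for \<sigma>
      unfolding stp_def by (rule l2_add(1)[OF Suc l2_scale(1)[OF HE(4)]])
    then show ?case by (simp add: XS)
  qed
  have step: "N (\<lambda>x. X (Suc k) x - X k x) \<le> (1/3) ^ k" for k
  proof -
    have "N (\<lambda>x. (\<sigma> * (1/3) ^ k) * E k x) = \<bar>\<sigma>\<bar> * (1/3) ^ k" for \<sigma> :: real
      unfolding l2_scale(2)[OF HE(4)] by (simp add: HE(5) abs_mult)
    from this[of 1] this[of "-1"] show ?thesis by (auto simp: XS stp_def)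
  qed
  have big: "(1/3) ^ k * N (P (H k) (E k)) \<le> N (P (H k) (X (Suc k)))" for k
  proof (cases "(1/3) ^ k * N (P (H k) (E k)) \<le> N (P (H k) (stp k (X k) 1))")
    case False
    have PE: "P (H k) (E k) \<in> l2 G" and PX: "P (H k) (X k) \<in> l2 G" by (intro semigroupD(1)[OF P] HE X)+
    have Ps: "P (H k) (stp k (X k) \<sigma>) = (\<lambda>x. P (H k) (X k) x + (\<sigma> * (1/3) ^ k) * P (H k) (E k) x)" for \<sigma>
      using lin[OF HE(1) X HE(4), of k 1 k "\<sigma> * (1/3) ^ k"] by (simp add: stp_def)
    have Pl2: "P (H k) (stp k (X k) \<sigma>) \<in> l2 G" for \<sigma>
      unfolding Ps by (intro l2_add(1) PX l2_scale(1) PE)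
    have "N (\<lambda>x. (2 * (1/3) ^ k) * P (H k) (E k) x)
        = N (\<lambda>x. P (H k) (stp k (X k) 1) x - P (H k) (stp k (X k) (-1)) x)"
      unfolding Ps by (rule arg_cong[of _ _ N]) auto
    also have "\<dots> \<le> N (P (H k) (stp k (X k) 1)) + N (P (H k) (stp k (X k) (-1)))"
      by (intro l2_diff Pl2)
    also have "N (\<lambda>x. (2 * (1/3) ^ k) * P (H k) (E k) x) = 2 * ((1/3) ^ k * N (P (H k) (E k)))"
      unfolding l2_scale(2)[OF PE] by simp
    finally show ?thesis using False by (simp add: XS)
  qed (simp add: XS)
  obtain y where y: "y \<in> l2 G" "\<And>k. (\<lambda>x. X k x - y x) \<in> l2 G" "\<And>k. N (\<lambda>x. X k x - y x) \<le> 3/2 * (1/3) ^ k"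
    using l2_geometric_limit[OF X step] by blast
  have grow: "(4/3) ^ k \<le> 4 * N (P (H k) y)" for k
  proof -
    let ?d = "\<lambda>x. X (Suc k) x - y x"
    have "P (H k) ?d = (\<lambda>x. P (H k) (X (Suc k)) x - P (H k) y x)"
      using lin[OF HE(1) X y(1), of k 1 "Suc k" "-1"] by simp
    then have "N (P (H k) (X (Suc k))) \<le> N (P (H k) ?d) + N (P (H k) y)"
      using l2_triangle_diff(2)[of "P (H k) (X (Suc k))" "P (H k) y"] semigroupD(1)[OF P HE(1) y(2)[of "Suc k"], of k]
        semigroupD(1)[OF P HE(1) y(1)] by simp
    also have "N (P (H k) ?d) \<le> opn (H k) * N ?d" by (rule opn_bound[OF HE(1) y(2)])
    also have "\<dots> \<le> opn (H k) * (3/2 * (1/3) ^ Suc k)"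
      using HE(3)[of k] by (intro mult_left_mono y) (auto intro: order_trans[of _ "4 ^ k"])
    finally have "N (P (H k) (X (Suc k))) \<le> opn (H k) * (3/2 * (1/3) ^ Suc k) + N (P (H k) y)" by simp
    moreover have "(1/3) ^ k * (3/4 * opn (H k)) \<le> (1/3) ^ k * N (P (H k) (E k))"
      by (intro mult_left_mono HE) auto
    moreover have "(1/3) ^ k * (3/4 * opn (H k)) = 3/4 * ((1/3) ^ k * opn (H k))"
      "opn (H k) * (3/2 * (1/3) ^ Suc k) = 1/2 * ((1/3) ^ k * opn (H k))" by simp_all
    ultimately have "1/4 * ((1/3) ^ k * opn (H k)) \<le> N (P (H k) y)"
      using big[of k] by linarith
    moreover have "(1/3) ^ k * 4 ^ k \<le> (1/3) ^ k * opn (H k)" using HE(3)[of k] by (intro mult_left_mono) auto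
    moreover have "(1/3) ^ k * 4 ^ k = (4/3::real) ^ k" by (simp flip: power_mult_distrib)
    ultimately show ?thesis by linarith
  qed
  obtain d where d: "0 < d" "\<And>h. 0 < h \<Longrightarrow> h < d \<Longrightarrow> N (\<lambda>x. P h y x - y x) < 1"
    using order_tendstoD(2)[OF semigroupD(6)[OF P y(1)], of 1] unfolding eventually_at_right_field by auto
  obtain k1 where k1: "4 * (N y + 1) < (4/3::real) ^ k1" using real_arch_pow[of "4/3"] by auto
  obtain k2 where k2: "1 / real (Suc k2) < d" using nat_approx_posE[OF d(1)] by blast
  obtain K where K: "k1 \<le> K" "k2 \<le> K" using max.cobounded1 max.cobounded2 by blast
  have "(4/3::real) ^ k1 \<le> (4/3) ^ K" using K by (intro power_increasing) auto
  moreover have "1 / real (Suc K) \<le> 1 / real (Suc k2)" using K by (intro divide_left_mono) auto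
  then have Hd: "H K < d" using HE(2)[of K] k2 by linarith
  have "N (P (H K) y) \<le> N y + 1"
  proof (cases "H K = 0")
    case True
    then show ?thesis using semigroupD(4)[OF P y(1)] by simp
  next
    case False
    then have "N (\<lambda>x. P (H K) y x - y x) < 1" using HE(1)[of K] Hd by (intro d) auto
    then show ?thesis
      using l2_triangle_diff(2)[OF l2_diff(1)[OF semigroupD(1)[OF P HE(1) y(1)] y(1)] y(1), of K] by linarith
  qed
  ultimately show False using grow[of K] k1 unfolding distrib_left by linarith
qed

lemma semigroup_locally_bounded:
  assumes P: "C0_semigroup_on_l2 G P"
  obtains M where "0 \<le> M" "\<And>t f. 0 \<le> t \<Longrightarrow> t \<le> T \<Longrightarrow> f \<in> l2 G \<Longrightarrow> N (P t f) \<le> M * N f"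
proof -
  obtain \<delta> M where \<delta>: "0 < \<delta>" and M: "1 \<le> M"
    and bd: "\<And>h f. 0 \<le> h \<Longrightarrow> h \<le> \<delta> \<Longrightarrow> f \<in> l2 G \<Longrightarrow> N (P h f) \<le> M * N f"
    using semigroup_bounded_near_0[OF P] by blast
  have *: "N (P t f) \<le> M ^ Suc n * N f" if "0 \<le> t" "t \<le> real (Suc n) * \<delta>" "f \<in> l2 G" for t n f
    using that
  proof (induction n arbitrary: t f)
    case 0 then show ?case using bd[of t f] by simp
  next
    case (Suc n)
    show ?case
    proof (cases "t \<le> \<delta>")
      case True
      have "N (P t f) \<le> M * N f" using bd Suc True by blast
      also have "\<dots> \<le> M ^ Suc (Suc n) * N f"
        using power_increasing[of 1 "Suc (Suc n)" M] M by (intro mult_right_mono) auto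
      finally show ?thesis .
    next
      case False
      then have t: "0 \<le> t - \<delta>" "t - \<delta> \<le> real (Suc n) * \<delta>" using Suc.prems by (auto simp: algebra_simps)
      have "P t f = P \<delta> (P (t - \<delta>) f)"
        using semigroupD(5)[OF P, of \<delta> "t - \<delta>" f] \<delta> t Suc.prems by simp
      then have "N (P t f) \<le> M * N (P (t - \<delta>) f)"
        using bd[of \<delta> "P (t - \<delta>) f"] semigroupD(1)[OF P t(1) Suc.prems(3)] \<delta> by simp
      also have "\<dots> \<le> M * (M ^ Suc n * N f)"
        using M by (intro mult_left_mono Suc.IH t Suc.prems) auto
      finally show ?thesis by simp
    qed
  qed
  obtain n where n: "T / \<delta> < real n" using reals_Archimedean2 by blast
  then have "T \<le> real (Suc n) * \<delta>" using \<delta> by (simp add: pos_divide_less_eq algebra_simps)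
  then show thesis using that[of "M ^ Suc n"] * M by (meson order_trans zero_le_one zero_le_power)
qed

end

context complete_weighted begin

lemma generatorD:
  assumes "generated_by_laplacian G P" "f \<in> Dmax"
  shows "((\<lambda>h. N (\<lambda>x. (P h f x - f x) / h - L f x)) \<longlongrightarrow> 0) (at_right 0)"
  using assms unfolding generated_by_laplacian_def dom_laplacian_eq by (auto simp: Dmax_def)

lemma generatorI:
  assumes "generated_by_laplacian G P" "f \<in> l2 G" "g \<in> l2 G"
    "((\<lambda>h. N (\<lambda>x. (P h f x - f x) / h - g x)) \<longlongrightarrow> 0) (at_right 0)"
  shows "f \<in> Dmax" "L f = g"
proof -
  have "((\<lambda>h. N (\<lambda>x. (P h f x - f x) / h - g x)) \<longlongrightarrow> 0) (at_right 0) \<longleftrightarrow> f \<in> Dmax \<and> g = L f"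
    using assms(1-3) unfolding generated_by_laplacian_def dom_laplacian_eq by simp
  with assms(4) show "f \<in> Dmax" "L f = g" by simp_all
qed

lemma semigroup_laplacian:
  assumes P: "C0_semigroup_on_l2 G P" and gen: "generated_by_laplacian G P"
    and t: "0 \<le> t" and f: "f \<in> Dmax"
  shows "P t f \<in> Dmax" "L (P t f) = P t (L f)"
proof -
  note f2 = DmaxD(1)[OF f] and Lf = DmaxD(2)[OF f]
  obtain c where c: "\<forall>f\<in>l2 G. N (P t f) \<le> c * N f" using semigroupD(3)[OF P t] by blast
  let ?r = "\<lambda>h x. (P h f x - f x) / h - L f x"
  have "((\<lambda>h. N (\<lambda>x. (P h (P t f) x - P t f x) / h - P t (L f) x)) \<longlongrightarrow> 0) (at_right 0)"
  proof (rule Lim_null_comparison[of _ "\<lambda>h. c * N (?r h)"])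
    show "((\<lambda>h. c * N (?r h)) \<longlongrightarrow> 0) (at_right 0)"
      using tendsto_mult[OF tendsto_const[of c] generatorD[OF gen f]] by simp
    have "norm (N (\<lambda>x. (P h (P t f) x - P t f x) / h - P t (L f) x)) \<le> c * N (?r h)" if h: "0 < h" for h
    proof -
      have Phf: "P h f \<in> l2 G" using h by (intro semigroupD(1)[OF P] f2) auto
      have d: "(\<lambda>x. P h f x - f x) \<in> l2 G" by (rule l2_diff[OF Phf f2])
      have r: "?r h = (\<lambda>x. (1 / h) * (P h f x - f x) + (-1) * L f x)" by auto
      have "P t (?r h) = (\<lambda>x. (1 / h) * P t (\<lambda>x. P h f x - f x) x + (-1) * P t (L f) x)"
        unfolding r by (rule semigroupD(2)[OF P t d Lf])
      also have "P t (\<lambda>x. P h f x - f x) = (\<lambda>x. P t (P h f) x - P t f x)"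
        using semigroupD(2)[OF P t Phf f2, of 1 "-1"] by simp
      also have "P t (P h f) = P h (P t f)"
        using semigroupD(5)[OF P t _ f2, of h] semigroupD(5)[OF P _ t f2, of h] h by (simp add: add.commute)
      finally have "(\<lambda>x. (P h (P t f) x - P t f x) / h - P t (L f) x) = P t (?r h)" by auto
      moreover have "?r h \<in> l2 G" unfolding r by (rule l2_lin[OF d Lf])
      ultimately show ?thesis using c by simp
    qed
    then show "\<forall>\<^sub>F h in at_right 0. norm (N (\<lambda>x. (P h (P t f) x - P t f x) / h - P t (L f) x)) \<le> c * N (?r h)"
      unfolding eventually_at_right_field by (intro exI[of _ 1]) auto
  qed
  from generatorI[OF gen semigroupD(1)[OF P t f2] semigroupD(1)[OF P t Lf] this]
  show "P t f \<in> Dmax" "L (P t f) = P t (L f)" by auto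
qed

text \<open>One implicit Euler step. Factoring out \<open>P (t - h)\<close> reduces the error at time \<open>t\<close> to the one
at time zero, so that local boundedness makes it \<open>o(h)\<close> uniformly in \<open>t\<close>. This is why left
limits of \<open>P\<close> never have to be examined.\<close>

lemma semigroup_backward_error:
  assumes P: "C0_semigroup_on_l2 G P" and gen: "generated_by_laplacian G P" and f: "f \<in> Dmax"
  obtains \<epsilon> where "(\<epsilon> \<longlongrightarrow> 0) (at_right 0)"
    and "\<And>h t. 0 < h \<Longrightarrow> h \<le> t \<Longrightarrow> t \<le> T \<Longrightarrow>
      N (\<lambda>x. P t f x - P (t - h) f x - h * L (P t f) x) \<le> h * \<epsilon> h"
proof -
  note f2 = DmaxD(1)[OF f] and Lf = DmaxD(2)[OF f]
  obtain M where M: "0 \<le> M" "\<And>t f. 0 \<le> t \<Longrightarrow> t \<le> T \<Longrightarrow> f \<in> l2 G \<Longrightarrow> N (P t f) \<le> M * N f"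
    using semigroup_locally_bounded[OF P, of T] by blast
  let ?r = "\<lambda>h x. (P h f x - f x) / h - L f x"
  let ?q = "\<lambda>h x. P h (L f) x - L f x"
  define \<epsilon> where "\<epsilon> h = M * (N (?r h) + N (?q h))" for h
  show thesis
  proof (rule that[of \<epsilon>])
    have "(\<epsilon> \<longlongrightarrow> M * (0 + 0)) (at_right 0)"
      unfolding \<epsilon>_def by (intro tendsto_intros generatorD[OF gen f] semigroupD(6)[OF P Lf])
    then show "(\<epsilon> \<longlongrightarrow> 0) (at_right 0)" by simp
    fix h t :: real assume h: "0 < h" and ht: "h \<le> t" and tT: "t \<le> T"
    then have th: "0 \<le> t - h" "t - h \<le> T" and t: "0 \<le> t" by auto
    have Phf: "P h f \<in> l2 G" and PhL: "P h (L f) \<in> l2 G" using h by (auto intro!: semigroupD(1)[OF P] f2 Lf)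
    have d: "(\<lambda>x. P h f x - f x) \<in> l2 G" by (rule l2_diff[OF Phf f2])
    have q2: "?q h \<in> l2 G" by (rule l2_diff[OF PhL Lf])
    have r2: "?r h \<in> l2 G" using l2_lin(1)[OF d Lf, of "1 / h" "-1"] by simp
    define g where "g = (\<lambda>x. h * ?r h x + (- h) * ?q h x)"
    have g2: "g \<in> l2 G" unfolding g_def by (rule l2_lin(1)[OF r2 q2])
    have g: "g = (\<lambda>x. 1 * (P h f x - f x) + (- h) * P h (L f) x)"
      unfolding g_def using h by (auto simp: fun_eq_iff field_simps)
    have "P (t - h) g = (\<lambda>x. 1 * P (t - h) (\<lambda>x. P h f x - f x) x + (- h) * P (t - h) (P h (L f)) x)"
      unfolding g by (rule semigroupD(2)[OF P th(1) d PhL])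
    also have "P (t - h) (\<lambda>x. P h f x - f x) = (\<lambda>x. P (t - h) (P h f) x - P (t - h) f x)"
      using semigroupD(2)[OF P th(1) Phf f2, of 1 "-1"] by simp
    also have "P (t - h) (P h f) = P t f" using semigroupD(5)[OF P th(1) _ f2, of h] h by simp
    also have "P (t - h) (P h (L f)) = P t (L f)" using semigroupD(5)[OF P th(1) _ Lf, of h] h by simp
    also have "P t (L f) = L (P t f)" by (rule semigroup_laplacian(2)[OF P gen t f, symmetric])
    finally have "(\<lambda>x. P t f x - P (t - h) f x - h * L (P t f) x) = P (t - h) g" by simp
    then have "N (\<lambda>x. P t f x - P (t - h) f x - h * L (P t f) x) \<le> M * N g"
      using M(2)[OF th g2] by simp
    also have "\<dots> \<le> M * (h * N (?r h) + h * N (?q h))"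
      using l2_lin(2)[OF r2 q2, of h "- h"] h M(1) unfolding g_def by (intro mult_left_mono) auto
    also have "\<dots> = h * \<epsilon> h" by (simp add: \<epsilon>_def algebra_simps)
    finally show "N (\<lambda>x. P t f x - P (t - h) f x - h * L (P t f) x) \<le> h * \<epsilon> h" .
  qed
qed

lemma resolvent_expansive:
  assumes v: "v \<in> Dmax" and h: "0 \<le> h" shows "N v \<le> N (\<lambda>x. v x - h * L v x)"
proof -
  note v2 = DmaxD(1)[OF v] and Lv = DmaxD(2)[OF v]
  have z: "(\<lambda>x. v x - h * L v x) \<in> l2 G" using l2_lin(1)[OF v2 Lv, of 1 "- h"] by simp
  have "(N v)\<^sup>2 \<le> ip v v - h * ip v (L v)"
    using laplacian_dissipative[OF v] h by (simp add: ip_self mult_nonneg_nonpos)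
  also have "\<dots> = ip v (\<lambda>x. v x - h * L v x)" using ip_lin[OF v2 Lv v2, of 1 "- h"] by simp
  also have "\<dots> \<le> N v * N (\<lambda>x. v x - h * L v x)" using ip_le[OF v2 z] by linarith
  finally have "N v * N v \<le> N v * N (\<lambda>x. v x - h * L v x)" by (simp add: power2_eq_square)
  then show ?thesis by (cases "N v = 0") (auto simp: less_le)
qed

text \<open>Let \<open>v\<close> be the difference of the two orbits. A backward step satisfies
\<open>v t - h \<Delta>(v t) = v (t - h) + o(h)\<close>, and dissipativity makes the left side at least as large in norm as
\<open>v t\<close>. Summing \<open>j\<close> steps of length \<open>T/j\<close> from \<open>v 0 = 0\<close> leaves an error that tends to zero.\<close>

lemma semigroup_unique:
  assumes P: "C0_semigroup_on_l2 G P" "generated_by_laplacian G P"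
    and Q: "C0_semigroup_on_l2 G Q" "generated_by_laplacian G Q"
    and f: "f \<in> Dmax" and T: "0 \<le> T"
  shows "P T f = Q T f"
proof (cases "T = 0")
  case True
  then show ?thesis using semigroupD(4)[OF P(1)] semigroupD(4)[OF Q(1)] DmaxD(1)[OF f] by simp
next
  case False
  then have T0: "0 < T" using T by simp
  obtain \<epsilon> where e: "(\<epsilon> \<longlongrightarrow> 0) (at_right 0)" "\<And>h t. 0 < h \<Longrightarrow> h \<le> t \<Longrightarrow> t \<le> T \<Longrightarrow>
      N (\<lambda>x. P t f x - P (t - h) f x - h * L (P t f) x) \<le> h * \<epsilon> h"
    using semigroup_backward_error[OF P f, of T] by blast
  obtain \<epsilon>' where e': "(\<epsilon>' \<longlongrightarrow> 0) (at_right 0)" "\<And>h t. 0 < h \<Longrightarrow> h \<le> t \<Longrightarrow> t \<le> T \<Longrightarrow>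
      N (\<lambda>x. Q t f x - Q (t - h) f x - h * L (Q t f) x) \<le> h * \<epsilon>' h"
    using semigroup_backward_error[OF Q f, of T] by blast
  define v where "v t x = P t f x - Q t f x" for t x
  have D: "P t f \<in> Dmax" "Q t f \<in> Dmax" if "0 \<le> t" for t
    using semigroup_laplacian(1)[OF P that f] semigroup_laplacian(1)[OF Q that f] by auto
  have vD: "v t \<in> Dmax" if "0 \<le> t" for t
    unfolding v_def by (rule Dmax_diff[OF D[OF that]])
  have step: "N (v t) \<le> N (v (t - h)) + h * (\<epsilon> h + \<epsilon>' h)" if h: "0 < h" "h \<le> t" "t \<le> T" for h t
  proof -
    have t: "0 \<le> t" "0 \<le> t - h" using h by auto
    let ?a = "\<lambda>x. P t f x - P (t - h) f x - h * L (P t f) x"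
    let ?b = "\<lambda>x. Q t f x - Q (t - h) f x - h * L (Q t f) x"
    have l2: "(\<lambda>x. u t x - u (t - h) x - h * L (u t) x) \<in> l2 G"
      if "u t \<in> Dmax" "u (t - h) \<in> Dmax" for u
      using that by (intro l2_diff(1) l2_scale(1) DmaxD) auto
    have a: "?a \<in> l2 G" and b: "?b \<in> l2 G"
      using l2[of "\<lambda>t. P t f"] l2[of "\<lambda>t. Q t f"] D t by auto
    have "N (v t) \<le> N (\<lambda>x. v t x - h * L (v t) x)" by (rule resolvent_expansive[OF vD]) (use h t in auto)
    also have "(\<lambda>x. v t x - h * L (v t) x) = (\<lambda>x. v (t - h) x + (?a x - ?b x))"
      unfolding v_def by (auto simp: laplacian_diff algebra_simps)
    also have "N \<dots> \<le> N (v (t - h)) + N (\<lambda>x. ?a x - ?b x)"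
      by (intro l2_add l2_diff a b DmaxD vD t)
    also have "N (\<lambda>x. ?a x - ?b x) \<le> N ?a + N ?b" by (rule l2_diff[OF a b])
    also have "N ?a \<le> h * \<epsilon> h" by (rule e(2)[OF h])
    also have "N ?b \<le> h * \<epsilon>' h" by (rule e'(2)[OF h])
    finally show ?thesis by (simp add: distrib_left)
  qed
  have steps: "N (v (real j * h)) \<le> real j * (h * (\<epsilon> h + \<epsilon>' h))" if h: "0 < h" "real j * h \<le> T" for j h
    using h(2)
  proof (induction j)
    case 0
    have "v 0 = (\<lambda>_. 0)"
      using semigroupD(4)[OF P(1)] semigroupD(4)[OF Q(1)] DmaxD(1)[OF f] by (simp add: v_def fun_eq_iff)
    then show ?case by (simp add: l2_norm_def)
  next
    case (Suc j)
    then have 1: "real j * h \<le> T" using h by (simp add: algebra_simps)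
    have "N (v (real (Suc j) * h)) \<le> N (v (real (Suc j) * h - h)) + h * (\<epsilon> h + \<epsilon>' h)"
      using h Suc by (intro step) (auto simp: algebra_simps)
    also have "real (Suc j) * h - h = real j * h" by (simp add: algebra_simps)
    finally show ?case using Suc.IH[OF 1] by (simp add: algebra_simps)
  qed
  have "N (v T) \<le> T * (\<epsilon> (T / real (Suc n)) + \<epsilon>' (T / real (Suc n)))" for n
    using steps[of "T / real (Suc n)" "Suc n"] T0 by simp
  moreover have "(\<lambda>n. T * (\<epsilon> (T / real (Suc n)) + \<epsilon>' (T / real (Suc n)))) \<longlonglongrightarrow> T * (0 + 0)"
  proof -
    have lim: "filterlim (\<lambda>n. T / real (Suc n)) (at_right 0) sequentially"
      using T0 inverse_Suc_tendsto[of T] by (simp add: filterlim_at)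
    show ?thesis by (intro tendsto_intros filterlim_compose[OF e(1) lim] filterlim_compose[OF e'(1) lim])
  qed
  ultimately have "N (v T) \<le> T * (0 + 0)" using LIMSEQ_le_const by blast
  then have "N (v T) = 0" using N_nonneg[of "v T"] by simp
  then have "v T x = 0" for x
    using l2_point[OF DmaxD(1)[OF vD[OF T]], of x] m_pos[of x] by (simp add: mult_le_0_iff not_le)
  then show ?thesis by (auto simp: v_def fun_eq_iff)
qed

text \<open>Existence of one semigroup with the prescribed generator makes the choice in the definition of the heat
semigroup meaningful; uniqueness identifies it with the limit of the Dirichlet flows on unit masses.\<close>

lemma heat_kernel_eq:
  assumes "0 \<le> t" shows "heat_kernel G t x y = kern t x y"
proof -
  have "C0_semigroup_on_l2 G (heat_semigroup G) \<and> generated_by_laplacian G (heat_semigroup G)"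
    unfolding heat_semigroup_def by (rule someI[of _ heat]) (simp add: heat_strongly_continuous heat_generated)
  then have "heat_semigroup G t (unit_mass y) = heat t (unit_mass y)"
    using semigroup_unique[OF _ _ heat_strongly_continuous heat_generated C0_Dmax[OF unit_mass_C0] assms] by blast
  then show ?thesis by (simp add: heat_kernel_def unit_mass_def[abs_def] heat_unit_mass[unfolded unit_mass_def[abs_def]])
qed

end

section \<open>The Li-Yau inequality\<close>

context complete_weighted begin

text \<open>The energy of the positive part of \<open>K\<close>, weighted by the squared cutoff, grows at a rate of at most
\<open>2B\<^sup>2/(k+1)\<close> by the Caccioppoli inequality. Starting from zero it stays of order \<open>1/(k+1)\<close> up to time \<open>T\<close>, and
vanishes in the limit.\<close>

lemma parabolic_maximum_principle:
  fixes K :: "real \<Rightarrow> 'v \<Rightarrow> real"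
  assumes der: "\<And>x t. 0 \<le> t \<Longrightarrow> ((\<lambda>t. K t x) has_real_derivative K' t x) (at t within {0..})"
    and sub: "\<And>x t. 0 < t \<Longrightarrow> t \<le> T \<Longrightarrow> 0 < K t x \<Longrightarrow> K' t x \<le> L (K t) x"
    and init: "\<And>x. K 0 x \<le> 0"
    and bound: "\<And>t F. 0 < t \<Longrightarrow> t \<le> T \<Longrightarrow> finite F \<Longrightarrow> nrm F (\<lambda>x. max 0 (K t x)) \<le> B"
    and T: "0 \<le> T"
  shows "K T x \<le> 0"
proof -
  have bd: "(cutoff k x)\<^sup>2 * (max 0 (K T x))\<^sup>2 * m x \<le> 2 * B\<^sup>2 * T / real (Suc k)" for k
  proof -
    obtain A where A: "absorbs A (cutoff k)" "{x} \<subseteq> A" using C0_absorbed[OF cutoff(1), of "{x}"] by blast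
    then have fin: "finite A" and xA: "x \<in> A" by (auto simp: absorbs_def)
    let ?c = "2 * (1 / real (Suc k) * B\<^sup>2)"
    define \<phi> where "\<phi> t = (\<Sum>x\<in>A. (cutoff k x)\<^sup>2 * (max 0 (K t x))\<^sup>2 * m x)" for t
    define \<phi>' where "\<phi>' t = (\<Sum>x\<in>A. (cutoff k x)\<^sup>2 * (2 * max 0 (K t x) * K' t x) * m x)" for t
    have d: "(\<phi> has_real_derivative \<phi>' t) (at t within {0..})" if "0 \<le> t" for t
      unfolding \<phi>_def \<phi>'_def
      by (intro DERIV_sum DERIV_cmult_right DERIV_cmult pos_part_square_derivative der that)
    have neg: "\<phi>' t \<le> ?c" if t: "0 < t" "t \<le> T" for t
    proof -
      let ?p = "\<lambda>x. max 0 (K t x)"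
      have "\<phi>' t \<le> (\<Sum>x\<in>A. 2 * ((cutoff k x)\<^sup>2 * ?p x * L ?p x * m x))"
        unfolding \<phi>'_def
      proof (rule sum_mono)
        fix z
        show "(cutoff k z)\<^sup>2 * (2 * ?p z * K' t z) * m z \<le> 2 * ((cutoff k z)\<^sup>2 * ?p z * L ?p z * m z)"
        proof (cases "0 < K t z")
          case True
          have "K' t z \<le> L (K t) z" using sub t True by blast
          also have "\<dots> \<le> L ?p z" using True by (intro laplacian_mono_at) auto
          finally have "((cutoff k z)\<^sup>2 * ?p z * m z) * K' t z \<le> ((cutoff k z)\<^sup>2 * ?p z * m z) * L ?p z"
            by (intro mult_left_mono) auto
          then show ?thesis by (simp add: mult_ac)
        qed (simp add: max_def)
      qed
      also have "\<dots> = 2 * (\<Sum>x\<in>A. (cutoff k x)\<^sup>2 * ?p x * L ?p x * m x)" by (simp add: sum_distrib_left)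
      also have "(\<Sum>x\<in>A. (cutoff k x)\<^sup>2 * ?p x * L ?p x * m x) \<le> 1 / real (Suc k) * (nrm A ?p)\<^sup>2"
        using caccioppoli[OF A(1) cutoff(5), of ?p]
        by (smt (verit) divide_nonneg_nonneg mult_nonneg_nonneg sum_nonneg w_nonneg zero_le_power2)
      also have "\<dots> \<le> 1 / real (Suc k) * B\<^sup>2"
        using bound[OF t fin] by (intro mult_left_mono power_mono) auto
      finally show ?thesis by simp
    qed
    have "\<phi> T - ?c * T \<le> \<phi> 0 - ?c * 0"
    proof (rule DERIV_nonpos_imp_decreasing_open[OF T])
      fix t assume t: "0 < t" "t < T"
      have "(\<phi> has_real_derivative \<phi>' t) (at t)"
        using d[of t] at_within_interior[of t "{0..}"] t by simp
      then have "((\<lambda>t. \<phi> t - ?c * t) has_real_derivative \<phi>' t - ?c) (at t)"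
        by (auto intro!: derivative_eq_intros)
      then show "\<exists>y. ((\<lambda>t. \<phi> t - ?c * t) has_real_derivative y) (at t) \<and> y \<le> 0"
        using neg[of t] t by (intro exI[of _ "\<phi>' t - ?c"]) auto
    next
      have "continuous_on {0..} \<phi>" using d DERIV_continuous_on[of "{0..}" \<phi> \<phi>'] by auto
      then have "continuous_on {0..T} \<phi>" by (rule continuous_on_subset) auto
      then show "continuous_on {0..T} (\<lambda>t. \<phi> t - ?c * t)" by (intro continuous_intros)
    qed
    moreover have "\<phi> 0 = 0" unfolding \<phi>_def using init by (intro sum.neutral) (auto simp: max_absorb1)
    moreover have "(cutoff k x)\<^sup>2 * (max 0 (K T x))\<^sup>2 * m x \<le> \<phi> T"
      unfolding \<phi>_def using fin xA
      by (intro member_le_sum[of x A "\<lambda>x. (cutoff k x)\<^sup>2 * (max 0 (K T x))\<^sup>2 * m x"]) auto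
    ultimately show ?thesis by simp
  qed
  have "(\<lambda>k. (cutoff k x)\<^sup>2 * (max 0 (K T x))\<^sup>2 * m x) \<longlonglongrightarrow> 1\<^sup>2 * (max 0 (K T x))\<^sup>2 * m x"
    by (intro tendsto_intros cutoff)
  from LIMSEQ_le[OF this inverse_Suc_tendsto] bd
  have "(max 0 (K T x))\<^sup>2 * m x \<le> 0" by auto
  then show ?thesis using m_pos[of x] by (simp add: mult_le_0_iff max_def not_le split: if_splits)
qed

end

text \<open>The difference of the square roots times their sum, which is at least \<open>2\<surd>e\<close>, equals \<open>a - b\<close>.\<close>

lemma sqrt_diff_square_le:
  fixes a b e :: real
  assumes "0 < e" "0 \<le> a" "0 \<le> b"
  shows "(sqrt (a + e) - sqrt (b + e))\<^sup>2 \<le> (a - b)\<^sup>2 / (4 * e)"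
proof -
  let ?p = "sqrt (a + e)" and ?q = "sqrt (b + e)"
  have "sqrt e \<le> ?p" "sqrt e \<le> ?q" using assms by auto
  then have "2 * sqrt e \<le> ?p + ?q" by linarith
  then have "(2 * sqrt e)\<^sup>2 \<le> (?p + ?q)\<^sup>2" using assms by (intro power_mono) auto
  then have "4 * e \<le> (?p + ?q)\<^sup>2" using assms by (simp add: power_mult_distrib)
  then have "(?p - ?q)\<^sup>2 * (4 * e) \<le> (?p - ?q)\<^sup>2 * (?p + ?q)\<^sup>2" by (intro mult_left_mono) auto
  also have "\<dots> = ((?p + ?q) * (?p - ?q))\<^sup>2" by (simp add: power_mult_distrib mult.commute)
  also have "(?p + ?q) * (?p - ?q) = a - b"
    using assms by (simp add: square_diff_square_factored[symmetric])
  finally show ?thesis using assms by (simp add: pos_le_divide_eq)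
qed

context weighted begin

lemma grad_form_has_derivative:
  assumes "\<And>x. ((\<lambda>t. h t x) has_real_derivative h' x) (at t within T)"
  shows "((\<lambda>t. \<Gamma> (h t) x) has_real_derivative 2 * grad_form G (h t) h' x) (at t within T)"
proof -
  have "((\<lambda>t. \<Sum>y\<in>nbrs G x. w x y * ((h t y - h t x) * (h t y - h t x))) has_real_derivative
     (\<Sum>y\<in>nbrs G x. w x y * ((h t y - h t x) * (h' y - h' x) + (h' y - h' x) * (h t y - h t x)))) (at t within T)"
    by (intro DERIV_sum DERIV_cmult DERIV_mult' DERIV_diff assms)
  from DERIV_cdivide[OF this, of "2 * m x"]
  have "((\<lambda>t. \<Gamma> (h t) x) has_real_derivative
     (\<Sum>y\<in>nbrs G x. w x y * ((h t y - h t x) * (h' y - h' x) + (h' y - h' x) * (h t y - h t x))) / (2 * m x)) (at t within T)"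
    by (simp add: grad_form_def mult.assoc)
  also have "(\<Sum>y\<in>nbrs G x. w x y * ((h t y - h t x) * (h' y - h' x) + (h' y - h' x) * (h t y - h t x)))
     = 2 * (\<Sum>y\<in>nbrs G x. w x y * (h t y - h t x) * (h' y - h' x))"
    unfolding sum_distrib_left by (intro sum.cong refl) (simp add: algebra_simps)
  finally show ?thesis by (simp add: grad_form_def)
qed

text \<open>Concavity of the logarithm, in place of the chain rule for \<open>\<Delta> log f\<close>.\<close>

lemma laplacian_ln_le:
  assumes f: "\<And>x. 0 < f x" shows "L (\<lambda>y. ln (f y)) x \<le> L f x / f x"
proof -
  have "(\<Sum>y\<in>nbrs G x. w x y * (ln (f y) - ln (f x))) \<le> (\<Sum>y\<in>nbrs G x. w x y * (f y - f x) / f x)"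
  proof (rule sum_mono)
    fix y
    have "ln (f y) - ln (f x) \<le> (f y - f x) / f x" by (rule ln_diff_le[OF f f])
    then show "w x y * (ln (f y) - ln (f x)) \<le> w x y * (f y - f x) / f x"
      using mult_left_mono[of _ _ "w x y"] by fastforce
  qed
  then have "(\<Sum>y\<in>nbrs G x. w x y * (ln (f y) - ln (f x))) \<le> (\<Sum>y\<in>nbrs G x. w x y * (f y - f x)) / f x"
    by (simp add: sum_divide_distrib)
  from divide_right_mono[OF this m_nonneg[of x]] show ?thesis
    unfolding laplacian_def by (simp add: mult.commute)
qed

end

locale cde_graph = complete_weighted G for G :: "'v wgraph" +
  fixes n :: real
  assumes n_pos: "0 < n" and cde: "CDE' G n 0" and nondegenerate: "nondegenerate_measure G"
begin

lemma measure_lower_bound: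
  obtains m0 where "0 < m0" "\<And>x. m0 \<le> m x"
proof
  show "0 < (INF x. m x)" using nondegenerate by (simp add: nondegenerate_measure_def)
  show "(INF x. m x) \<le> m x" for x
    by (rule cINF_lower) (auto intro: bdd_belowI[of _ 0])
qed

text \<open>Here \<open>\<Gamma>(f) - \<Delta>(f\<^sup>2)/2 = -f \<Delta>f \<le> -f\<^sup>2 \<Delta> log f\<close>. Where the left side is nonnegative both sides may be
squared, and the curvature condition bounds the square of the right side.\<close>

lemma cde_bound:
  assumes f: "\<And>x. 0 < f x" and H: "0 \<le> \<Gamma> f x - L (\<lambda>x. (f x)\<^sup>2) x / 2"
  shows "(\<Gamma> f x - L (\<lambda>x. (f x)\<^sup>2) x / 2)\<^sup>2 / (n * (f x)\<^sup>2) \<le> Gamma2_tilde G f x"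
proof -
  let ?H = "\<Gamma> f x - L (\<lambda>x. (f x)\<^sup>2) x / 2" and ?l = "L (\<lambda>y. ln (f y)) x"
  have H_eq: "?H = - (f x * L f x)" unfolding laplacian_square by (simp add: algebra_simps)
  have "(f x)\<^sup>2 * ?l \<le> (f x)\<^sup>2 * (L f x / f x)" by (intro mult_left_mono laplacian_ln_le f) simp
  also have "\<dots> = f x * L f x" using f[of x] by (simp add: power2_eq_square)
  finally have "?H \<le> - ((f x)\<^sup>2 * ?l)" using H_eq by simp
  then have "?H\<^sup>2 \<le> (- ((f x)\<^sup>2 * ?l))\<^sup>2" using H by (intro power_mono) auto
  then have "?H\<^sup>2 / (n * (f x)\<^sup>2) \<le> ((f x)\<^sup>2 * ?l)\<^sup>2 / (n * (f x)\<^sup>2)"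
    using n_pos by (intro divide_right_mono) auto
  also have "\<dots> = 1 / n * (f x)\<^sup>2 * ?l\<^sup>2" using f[of x] by (simp add: power2_eq_square)
  also have "\<dots> \<le> Gamma2_tilde G f x"
    using cde f unfolding CDE'_def by (metis add.right_neutral mult_zero_left)
  finally show ?thesis .
qed

text \<open>With the notation of the proof, \<open>(\<Delta> - \<partial>\<^sub>t) \<Gamma>(h)\<close> is twice the curvature term
\<open>Gamma2_tilde\<close> of \<open>h\<close>, because \<open>\<partial>\<^sub>t h = \<Delta>(h\<^sup>2)/(2h)\<close>, and \<open>\<Delta>v\<close> solves the heat equation. Hence
\<open>(\<Delta> - \<partial>\<^sub>t) K = 2t Gamma2_tilde - H \<ge> H (2tH - n v)/(n v)\<close>, which is positive where \<open>K\<close> is. The factor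
\<open>t\<close> in \<open>K\<close> provides the initial condition.\<close>

lemma li_yau:
  assumes \<phi>: "\<phi> \<in> C0" "\<And>x. 0 \<le> \<phi> x" and \<epsilon>: "0 < \<epsilon>" and T: "0 < T"
  shows "\<Gamma> (\<lambda>x. sqrt (heat T \<phi> x + \<epsilon>)) x - L (heat T \<phi>) x / 2 \<le> n / (2 * T) * (heat T \<phi> x + \<epsilon>)"
proof -
  define v where "v t x = heat t \<phi> x + \<epsilon>" for t x
  define h where "h t x = sqrt (v t x)" for t x
  define H where "H t x = \<Gamma> (h t) x - L (v t) x / 2" for t x
  define K where "K t x = t * H t x - n / 2 * v t x" for t x
  define K' where "K' t x = t * (L (H t) x - 2 * Gamma2_tilde G (h t) x) + H t x - n / 2 * L (v t) x" for t x
  have u0: "0 \<le> heat t \<phi> x" if "0 \<le> t" for t x using heat_nonneg[OF that \<phi>] .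
  have v0: "\<epsilon> \<le> v t x" "0 < v t x" if "0 \<le> t" for t x using u0[OF that, of x] \<epsilon> by (auto simp: v_def)
  have h0: "0 < h t x" "(h t x)\<^sup>2 = v t x" if "0 \<le> t" for t x using v0[OF that, of x] by (auto simp: h_def)
  have sq: "(\<lambda>z. (h t z)\<^sup>2) = v t" if "0 \<le> t" for t
    by (rule ext) (rule h0(2)[OF that])
  have Lv: "L (v t) x = L (heat t \<phi>) x" for t x unfolding v_def by (rule laplacian_add_const)
  have dv: "((\<lambda>t. v t x) has_real_derivative L (v t) x) (at t within {0..})" if "0 \<le> t" for t x
    using DERIV_add[OF heat_point_derivative[OF that \<phi>(1), of x] DERIV_const[of \<epsilon>]] by (simp add: Lv v_def)
  have dLv: "((\<lambda>t. L (v t) x) has_real_derivative L (L (v t)) x) (at t within {0..})" if "0 \<le> t" for t x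
    by (rule laplacian_has_derivative) (rule dv[OF that])
  have dh: "((\<lambda>t. h t x) has_real_derivative L (\<lambda>z. (h t z)\<^sup>2) x / (2 * h t x)) (at t within {0..})" if t: "0 \<le> t" for t x
  proof -
    have "((\<lambda>t. sqrt (v t x)) has_real_derivative inverse (sqrt (v t x)) / 2 * L (v t) x) (at t within {0..})"
      by (rule DERIV_chain2[OF DERIV_real_sqrt[OF v0(2)[OF t]] dv[OF t]])
    also have "(\<lambda>t. sqrt (v t x)) = (\<lambda>t. h t x)" unfolding h_def ..
    also have "inverse (h t x) / 2 * L (v t) x = L (\<lambda>z. (h t z)\<^sup>2) x / (2 * h t x)"
      unfolding sq[OF t] by (simp add: field_simps)
    finally show ?thesis .
  qed
  have dH: "((\<lambda>t. H t x) has_real_derivative L (H t) x - 2 * Gamma2_tilde G (h t) x) (at t within {0..})" if t: "0 \<le> t" for t x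
  proof -
    let ?h' = "\<lambda>x. L (\<lambda>z. (h t z)\<^sup>2) x / (2 * h t x)"
    have "((\<lambda>t. H t x) has_real_derivative 2 * grad_form G (h t) ?h' x - L (L (v t)) x / 2) (at t within {0..})"
      unfolding H_def by (intro DERIV_diff DERIV_cdivide grad_form_has_derivative dh dLv t)
    moreover have "2 * grad_form G (h t) ?h' x - L (L (v t)) x / 2 = L (H t) x - 2 * Gamma2_tilde G (h t) x"
    proof -
      have "H t = (\<lambda>x. 1 * \<Gamma> (h t) x + (- 1 / 2) * L (v t) x)" by (auto simp: H_def)
      then have "L (H t) x = 1 * L (\<Gamma> (h t)) x + (- 1 / 2) * L (L (v t)) x" by (simp only: laplacian_lin)
      then show ?thesis by (simp add: Gamma2_tilde_def)
    qed
    ultimately show ?thesis by simp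
  qed
  have dK: "((\<lambda>t. K t x) has_real_derivative K' t x) (at t within {0..})" if t: "0 \<le> t" for t x
    unfolding K_def K'_def
    by (rule DERIV_diff[OF _ DERIV_cmult[OF dv[OF t]]])
      (use DERIV_mult'[OF DERIV_ident dH[OF t], of x] in simp)
  obtain m0 where m0: "0 < m0" "\<And>x. m0 \<le> m x" using measure_lower_bound by blast
  define E where "E = N \<phi> * N (L \<phi>) / (4 * \<epsilon>)"
  have "K T x \<le> 0"
  proof (rule parabolic_maximum_principle[OF dK, of T])
    fix x t assume t: "0 < t" "t \<le> T" and K0: "0 < K t x"
    have t0: "0 \<le> t" using t by simp
    have vp: "0 < v t x" by (rule v0[OF t0])
    have tH: "n / 2 * v t x < t * H t x" using K0 by (simp add: K_def)
    moreover have "0 < n / 2 * v t x" using n_pos vp by simp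
    ultimately have "0 < t * H t x" by linarith
    then have Hp: "0 < H t x" using t by (simp add: zero_less_mult_iff)
    have "(H t x)\<^sup>2 / (n * v t x) \<le> Gamma2_tilde G (h t) x"
      using cde_bound[of "h t" x, OF h0(1)[OF t0]] Hp unfolding sq[OF t0] h0(2)[OF t0] H_def by simp
    then have "2 * t * ((H t x)\<^sup>2 / (n * v t x)) \<le> 2 * t * Gamma2_tilde G (h t) x"
      using t by (intro mult_left_mono) auto
    moreover have "H t x \<le> 2 * t * ((H t x)\<^sup>2 / (n * v t x))"
    proof -
      have "n * v t x \<le> 2 * (t * H t x)" using tH by simp
      then have "H t x * (n * v t x) \<le> H t x * (2 * (t * H t x))" using Hp by (intro mult_left_mono) auto
      then show ?thesis using n_pos vp by (simp add: pos_le_divide_eq power2_eq_square mult_ac)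
    qed
    moreover have "L (K t) x = t * L (H t) x - n / 2 * L (v t) x"
    proof -
      have "K t = (\<lambda>x. t * H t x + (- (n / 2)) * v t x)" by (auto simp: K_def)
      then have "L (K t) x = t * L (H t) x + (- (n / 2)) * L (v t) x" by (simp only: laplacian_lin)
      then show ?thesis by simp
    qed
    ultimately show "K' t x \<le> L (K t) x" unfolding K'_def right_diff_distrib by linarith
  next
    fix x show "K 0 x \<le> 0" using v0(2)[of 0 x] n_pos by (simp add: K_def)
  next
    fix t and F :: "'v set" assume t: "0 < t" "t \<le> T" and F: "finite F"
    have t0: "0 \<le> t" using t by simp
    let ?u = "heat t \<phi>"
    have uD: "?u \<in> Dmax" by (rule heat_Dmax[OF t0 \<phi>(1)])
    have Gh: "\<Gamma> (h t) x \<le> \<Gamma> ?u x / (4 * \<epsilon>)" for x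
    proof -
      have "(\<Sum>y\<in>nbrs G x. w x y * (h t y - h t x)\<^sup>2) \<le> (\<Sum>y\<in>nbrs G x. w x y * ((?u y - ?u x)\<^sup>2 / (4 * \<epsilon>)))"
        unfolding h_def v_def by (intro sum_mono mult_left_mono sqrt_diff_square_le \<epsilon> u0 t0) auto
      also have "\<dots> = (\<Sum>y\<in>nbrs G x. w x y * (?u y - ?u x)\<^sup>2) / (4 * \<epsilon>)"
        by (simp add: sum_divide_distrib)
      finally have "(\<Sum>y\<in>nbrs G x. w x y * (h t y - h t x)\<^sup>2) / (2 * m x)
          \<le> (\<Sum>y\<in>nbrs G x. w x y * (?u y - ?u x)\<^sup>2) / (4 * \<epsilon>) / (2 * m x)"
        by (intro divide_right_mono) auto
      then show ?thesis by (simp add: grad_form_def power2_eq_square mult.assoc mult.commute[of _ "m x * _"] mult.commute[of _ "4 * \<epsilon>"] mult.left_commute[of "m x"])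
    qed
    have NL: "N (L ?u) \<le> N (L \<phi>)"
      unfolding heat_laplacian[OF t0 \<phi>(1)] by (intro heat_l2 t0 C0_l2 laplacian_C0 \<phi>)
    \<comment> \<open>Here \<open>\<epsilon> > 0\<close> turns the energy bound for \<open>u\<close> into one for \<open>h\<close> that is uniform in time.\<close>
    have sumG: "(\<Sum>x\<in>F. m x * \<Gamma> (h t) x) \<le> E"
    proof -
      have "(\<Sum>x\<in>F. m x * \<Gamma> (h t) x) \<le> (\<Sum>x\<in>F. m x * (\<Gamma> ?u x / (4 * \<epsilon>)))"
        by (intro sum_mono mult_left_mono Gh) auto
      also have "\<dots> = (\<Sum>x\<in>F. m x * \<Gamma> ?u x) / (4 * \<epsilon>)" by (simp add: sum_divide_distrib)
      also have "\<dots> \<le> (N ?u * N (L ?u)) / (4 * \<epsilon>)"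
        using \<epsilon> by (intro divide_right_mono grad_form_sum_bound uD F) auto
      also have "\<dots> \<le> (N \<phi> * N (L \<phi>)) / (4 * \<epsilon>)"
        using \<epsilon> by (intro divide_right_mono mult_mono NL heat_l2 t0 C0_l2 \<phi>) auto
      finally show ?thesis by (simp add: E_def)
    qed
    have E0: "0 \<le> E" using \<epsilon> by (simp add: E_def)
    \<comment> \<open>A measure bounded below makes summable functions square summable.\<close>
    have nG: "nrm F (\<Gamma> (h t)) \<le> E / sqrt m0"
    proof (rule power2_le_imp_le)
      have "(nrm F (\<Gamma> (h t)))\<^sup>2 \<le> (\<Sum>x\<in>F. (E / m0) * (m x * \<Gamma> (h t) x))"
        unfolding nrm_square
      proof (rule sum_mono)
        fix x assume x: "x \<in> F"
        have "m x * \<Gamma> (h t) x \<le> (\<Sum>x\<in>F. m x * \<Gamma> (h t) x)"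
          using F x by (intro member_le_sum[of x F "\<lambda>x. m x * \<Gamma> (h t) x"]) auto
        then have "m x * \<Gamma> (h t) x \<le> E" using sumG by linarith
        moreover have "m0 * \<Gamma> (h t) x \<le> m x * \<Gamma> (h t) x" by (intro mult_right_mono m0) auto
        ultimately have "\<Gamma> (h t) x \<le> E / m0" using m0(1) by (simp add: pos_le_divide_eq mult.commute)
        then have "\<Gamma> (h t) x * (m x * \<Gamma> (h t) x) \<le> (E / m0) * (m x * \<Gamma> (h t) x)"
          by (intro mult_right_mono) auto
        then show "(\<Gamma> (h t) x)\<^sup>2 * m x \<le> (E / m0) * (m x * \<Gamma> (h t) x)" by (simp add: power2_eq_square mult_ac)
      qed
      also have "\<dots> = (E / m0) * (\<Sum>x\<in>F. m x * \<Gamma> (h t) x)" by (simp add: sum_distrib_left)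
      also have "\<dots> \<le> (E / m0) * E" using m0 E0 by (intro mult_left_mono sumG) auto
      also have "\<dots> = (E / sqrt m0)\<^sup>2" using m0 by (simp add: power_divide power2_eq_square)
      finally show "(nrm F (\<Gamma> (h t)))\<^sup>2 \<le> (E / sqrt m0)\<^sup>2" .
    qed (use E0 m0 in auto)
    have "nrm F (\<lambda>x. max 0 (K t x)) \<le> nrm F (\<lambda>x. t * (\<Gamma> (h t) x + \<bar>L ?u x\<bar> / 2))"
    proof (rule power2_le_imp_le)
      have "max 0 (K t x) \<le> t * (\<Gamma> (h t) x + \<bar>L ?u x\<bar> / 2)" for x
      proof -
        have "K t x \<le> t * H t x" using n_pos v0(2)[OF t0, of x] by (simp add: K_def)
        also have "\<dots> \<le> t * (\<Gamma> (h t) x + \<bar>L ?u x\<bar> / 2)"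
          unfolding H_def Lv using t by (intro mult_left_mono) auto
        finally show ?thesis using t by simp
      qed
      then show "(nrm F (\<lambda>x. max 0 (K t x)))\<^sup>2 \<le> (nrm F (\<lambda>x. t * (\<Gamma> (h t) x + \<bar>L ?u x\<bar> / 2)))\<^sup>2"
        unfolding nrm_square by (intro sum_mono mult_right_mono power_mono) auto
    qed simp
    also have "\<dots> = t * nrm F (\<lambda>x. \<Gamma> (h t) x + (1 / 2) * \<bar>L ?u x\<bar>)"
      unfolding nrm_scale using t by simp
    also have "\<dots> \<le> T * (E / sqrt m0 + 1 / 2 * N (L \<phi>))"
    proof (rule mult_mono)
      have "nrm F (\<lambda>x. \<Gamma> (h t) x + (1 / 2) * \<bar>L ?u x\<bar>)
          \<le> nrm F (\<Gamma> (h t)) + nrm F (\<lambda>x. (1 / 2) * \<bar>L ?u x\<bar>)" by (rule nrm_triangle)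
      also have "nrm F (\<lambda>x. (1 / 2) * \<bar>L ?u x\<bar>) = 1 / 2 * nrm F (L ?u)"
        unfolding nrm_scale by (simp add: nrm_def L2_set_def power_mult_distrib)
      also have "nrm F (L ?u) \<le> N (L \<phi>)"
        using nrm_le_N[OF DmaxD(2)[OF uD] F] NL by linarith
      finally show "nrm F (\<lambda>x. \<Gamma> (h t) x + (1 / 2) * \<bar>L ?u x\<bar>) \<le> E / sqrt m0 + 1 / 2 * N (L \<phi>)"
        using nG by linarith
    qed (use t in auto)
    finally show "nrm F (\<lambda>x. max 0 (K t x)) \<le> T * (E / sqrt m0 + 1 / 2 * N (L \<phi>))" .
  qed (use T in auto)
  then have "T * H T x \<le> n / 2 * v T x" by (simp add: K_def)
  then have "H T x \<le> n / (2 * T) * v T x" using T by (simp add: field_simps)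
  then show ?thesis by (simp add: H_def Lv h_def[abs_def] v_def[abs_def] laplacian_add_const)
qed

end

section \<open>The Harnack inequality\<close>

text \<open>By convexity of the reciprocal, \<open>(1 - l)/a + l/b \<ge> 1/V\<close>; after this replacement the expression is the perfect square
\<open>\<alpha>/(2V) (a - b - V/(\<alpha>\<tau>))\<^sup>2\<close>.\<close>

lemma harnack_algebra:
  fixes a b l \<alpha> \<tau> :: real
  assumes a: "0 < a" and b: "0 < b" and l: "0 \<le> l" "l \<le> 1" and \<alpha>: "0 < \<alpha>" and \<tau>: "0 < \<tau>"
  defines "V \<equiv> (1 - l) * a + l * b"
  shows "0 \<le> \<alpha> / 2 * (a - b)\<^sup>2 * ((1 - l) / a + l / b) - (a - b) / \<tau> + V / (2 * \<alpha> * \<tau>\<^sup>2)"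
proof -
  have V: "0 < V"
  proof (cases "l = 0")
    case False
    then have "0 < l * b" "0 \<le> (1 - l) * a" using a b l by auto
    then show ?thesis by (simp add: V_def)
  qed (simp add: V_def a)
  have "1 \<le> V * ((1 - l) / a + l / b)"
  proof -
    have "2 \<le> a / b + b / a"
    proof -
      have "2 * a * b \<le> a\<^sup>2 + b\<^sup>2" by (rule sum_squares_bound)
      then show ?thesis using a b by (simp add: field_simps power2_eq_square)
    qed
    then have "l * (1 - l) * 2 \<le> l * (1 - l) * (a / b + b / a)" using l by (intro mult_left_mono) auto
    moreover have "V * ((1 - l) / a + l / b) = (1 - l)\<^sup>2 + l\<^sup>2 + l * (1 - l) * (a / b + b / a)"
      unfolding V_def using a b by (simp add: field_simps power2_eq_square)
    ultimately show ?thesis by (simp add: power2_eq_square algebra_simps)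
  qed
  then have "1 / V \<le> (1 - l) / a + l / b" using V by (simp add: pos_divide_le_eq mult.commute)
  then have "\<alpha> / 2 * (a - b)\<^sup>2 * (1 / V) \<le> \<alpha> / 2 * (a - b)\<^sup>2 * ((1 - l) / a + l / b)"
    using \<alpha> by (intro mult_left_mono) auto
  moreover have "\<alpha> / 2 * (a - b)\<^sup>2 * (1 / V) - (a - b) / \<tau> + V / (2 * \<alpha> * \<tau>\<^sup>2)
      = \<alpha> / (2 * V) * ((a - b) - V / (\<alpha> * \<tau>))\<^sup>2"
    using V \<alpha> \<tau> by (simp add: power2_diff power2_eq_square field_simps)
  moreover have "0 \<le> \<alpha> / (2 * V) * ((a - b) - V / (\<alpha> * \<tau>))\<^sup>2" using V \<alpha> by simp
  ultimately show ?thesis by linarith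
qed

context cde_graph begin

text \<open>The Harnack inequalities are proved for solutions lifted by \<open>\<epsilon> > 0\<close>, whose logarithms are defined. The constant
\<open>\<alpha>\<close> converts the gradient form at a vertex into squared increments along single edges.\<close>

context
  fixes \<phi> :: "'v \<Rightarrow> real" and \<epsilon> \<alpha> :: real
  assumes \<phi>: "\<phi> \<in> C0" "\<And>x. 0 \<le> \<phi> x" and \<epsilon>: "0 < \<epsilon>" and \<alpha>: "0 < \<alpha>"
    and edge: "\<And>x y. (x, y) \<in> edges G \<Longrightarrow> \<alpha> * m x \<le> w x y"
begin

definition lifted :: "real \<Rightarrow> 'v \<Rightarrow> real" where "lifted t x = heat t \<phi> x + \<epsilon>"

lemma lifted_pos: "0 < t \<Longrightarrow> 0 < lifted t x"
  using heat_nonneg[OF _ \<phi>, of t x] \<epsilon> by (simp add: lifted_def)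

lemma lifted_derivative: assumes "0 < t"
  shows "((\<lambda>t. lifted t x) has_real_derivative L (heat t \<phi>) x) (at t)"
proof -
  have "((\<lambda>t. heat t \<phi> x) has_real_derivative L (heat t \<phi>) x) (at t)"
    using heat_point_derivative[of t, OF _ \<phi>(1), of x] at_within_interior[of t "{0..}"] assms by simp
  from DERIV_add[OF this DERIV_const[of \<epsilon>]] show ?thesis by (simp add: lifted_def)
qed

lemma lifted_li_yau: "0 < t \<Longrightarrow> 2 * \<Gamma> (\<lambda>x. sqrt (lifted t x)) x - n / t * lifted t x \<le> L (heat t \<phi>) x"
  using li_yau[OF \<phi> \<epsilon>, of t x] by (simp add: lifted_def[abs_def] field_simps)

lemma harnack_same_vertex:
  assumes s: "0 < s" and r: "s \<le> r"
  shows "ln (lifted s x) \<le> ln (lifted r x) + n * (ln r - ln s)"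
proof -
  let ?g = "\<lambda>t. ln (lifted t x) + n * ln t"
  have "?g s \<le> ?g r"
  proof (rule DERIV_nonneg_imp_nondecreasing[OF r])
    fix t assume "s \<le> t" "t \<le> r"
    then have t: "0 < t" using s by simp
    have "(?g has_real_derivative (1 / lifted t x * L (heat t \<phi>) x + n * (1 / t))) (at t)"
      by (intro DERIV_add DERIV_cmult DERIV_chain2[OF DERIV_ln_divide[OF lifted_pos[OF t]] lifted_derivative[OF t]] DERIV_ln_divide t)
    moreover have "0 \<le> 1 / lifted t x * L (heat t \<phi>) x + n * (1 / t)"
    proof -
      have "- (n / t * lifted t x) \<le> L (heat t \<phi>) x" using lifted_li_yau[OF t, of x] grad_form_nonneg[of "\<lambda>x. sqrt (lifted t x)" x] by linarith
      then have "1 / lifted t x * - (n / t * lifted t x) \<le> 1 / lifted t x * L (heat t \<phi>) x"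
        using lifted_pos[OF t, of x] by (intro mult_left_mono) auto
      then show ?thesis using lifted_pos[OF t, of x] by simp
    qed
    ultimately show "\<exists>y. (?g has_real_derivative y) (at t) \<and> 0 \<le> y" by blast
  qed
  then show ?thesis by (simp add: right_diff_distrib)
qed

text \<open>Instead of choosing a jump time, the value is interpolated: \<open>V = (1 - l) h(x) + l h(z)\<close> with
\<open>h\<close> the square root of the solution and \<open>l\<close> growing linearly from 0 to 1 during the time
\<open>\<tau>\<close>. The Li-Yau inequality bounds \<open>\<partial>\<^sub>t h\<close> at both ends below by \<open>\<alpha> (h(x) - h(z))\<^sup>2/(2h) - n h/(2t)\<close>, and the
quadratic term outweighs the transport term \<open>(h(x) - h(z))/\<tau>\<close> up to \<open>V/(2\<alpha>\<tau>\<^sup>2)\<close>. So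
\<open>log V\<close> decreases by at most the integral of \<open>n/(2t) + 1/(2\<alpha>\<tau>\<^sup>2)\<close>.\<close>

lemma harnack_edge:
  assumes s: "0 < s" and \<tau>: "0 < \<tau>" and xz: "(x, z) \<in> edges G"
  shows "ln (lifted s x) \<le> ln (lifted (s + \<tau>) z) + n * (ln (s + \<tau>) - ln s) + 1 / (\<alpha> * \<tau>)"
proof -
  define h where "h t y = sqrt (lifted t y)" for t y
  define l where "l t = (t - s) / \<tau>" for t
  define V where "V t = (1 - l t) * h t x + l t * h t z" for t
  let ?g = "\<lambda>t. ln (V t) + n / 2 * ln t + t / (2 * \<alpha> * \<tau>\<^sup>2)"
  have h: "0 < h t y" if "0 < t" for t y using lifted_pos[OF that] by (simp add: h_def)
  have hv: "ln (h t y) = ln (lifted t y) / 2" if "0 < t" for t y using lifted_pos[OF that, of y] by (simp add: h_def ln_sqrt)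
  have "?g s \<le> ?g (s + \<tau>)"
  proof (rule DERIV_nonneg_imp_nondecreasing[of s "s + \<tau>" ?g])
    show "s \<le> s + \<tau>" using \<tau> by simp
  next
    fix t assume st: "s \<le> t" "t \<le> s + \<tau>"
    then have t: "0 < t" using s by simp
    have l01: "0 \<le> l t" "l t \<le> 1" using st \<tau> by (auto simp: l_def pos_divide_le_eq)
    have V: "0 < V t"
    proof (cases "l t = 0")
      case False
      then have "0 < l t * h t z" "0 \<le> (1 - l t) * h t x" using l01 h[OF t] by (auto simp: less_imp_le)
      then show ?thesis by (simp add: V_def)
    qed (simp add: V_def h[OF t])
    define hp where "hp y = L (heat t \<phi>) y / (2 * h t y)" for y
    have dh: "((\<lambda>t. h t y) has_real_derivative hp y) (at t)" for y
    proof -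
      have "((\<lambda>t. sqrt (lifted t y)) has_real_derivative inverse (sqrt (lifted t y)) / 2 * L (heat t \<phi>) y) (at t)"
        by (rule DERIV_chain2[OF DERIV_real_sqrt[OF lifted_pos[OF t]] lifted_derivative[OF t]])
      also have "(\<lambda>t. sqrt (lifted t y)) = (\<lambda>t. h t y)" unfolding h_def ..
      also have "inverse (h t y) / 2 * L (heat t \<phi>) y = hp y"
        unfolding hp_def by (simp add: field_simps)
      finally show ?thesis .
    qed
    have dl: "(l has_real_derivative 1 / \<tau>) (at t)"
      unfolding l_def using \<tau> by (auto intro!: derivative_eq_intros)
    define V' where "V' = (1 - l t) * hp x + l t * hp z - (h t x - h t z) / \<tau>"
    have dV: "(V has_real_derivative V') (at t)"
    proof -
      have "(V has_real_derivative ((1 - l t) * hp x + (0 - 1 / \<tau>) * h t x) + (l t * hp z + 1 / \<tau> * h t z)) (at t)"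
        unfolding V_def by (intro DERIV_add DERIV_mult' DERIV_diff DERIV_const dl dh)
      then show ?thesis by (simp add: V'_def diff_divide_distrib algebra_simps)
    qed
    have "(?g has_real_derivative (1 / V t * V' + n / 2 * (1 / t) + 1 / (2 * \<alpha> * \<tau>\<^sup>2))) (at t)"
      by (intro DERIV_add DERIV_cmult DERIV_cdivide DERIV_ident DERIV_chain2[OF DERIV_ln_divide[OF V] dV] DERIV_ln_divide t)
    moreover have "0 \<le> 1 / V t * V' + n / 2 * (1 / t) + 1 / (2 * \<alpha> * \<tau>\<^sup>2)"
    proof -
      let ?q = "\<alpha> / 2 * (h t x - h t z)\<^sup>2"
      have lower: "?q / h t y - n / (2 * t) * h t y \<le> hp y" if yy: "(y, y') \<in> edges G" "{y, y'} = {x, z}" for y y'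
      proof -
        have "\<alpha> * m y * (h t y' - h t y)\<^sup>2 \<le> w y y' * (h t y' - h t y)\<^sup>2"
          by (intro mult_right_mono edge yy) auto
        also have "\<dots> \<le> (\<Sum>y'\<in>nbrs G y. w y y' * (h t y' - h t y)\<^sup>2)"
        proof (rule member_le_sum[of y' "nbrs G y" "\<lambda>y'. w y y' * (h t y' - h t y)\<^sup>2"])
          show "y' \<in> nbrs G y" using yy by (simp add: nbrs_def)
        qed auto
        finally have "\<alpha> * m y * (h t y' - h t y)\<^sup>2 / (2 * m y) \<le> \<Gamma> (h t) y"
          unfolding grad_form_def by (intro divide_right_mono) (auto simp: power2_eq_square mult.assoc)
        moreover have "(h t y' - h t y)\<^sup>2 = (h t x - h t z)\<^sup>2"
          using yy(2) by (auto simp: doubleton_eq_iff power2_commute)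
        ultimately have "?q \<le> \<Gamma> (h t) y" by simp
        moreover have "2 * \<Gamma> (h t) y - n / t * (h t y)\<^sup>2 \<le> L (heat t \<phi>) y"
          using lifted_li_yau[OF t, of y] lifted_pos[OF t, of y] by (simp add: h_def[abs_def])
        ultimately have "2 * ?q - n / t * (h t y)\<^sup>2 \<le> L (heat t \<phi>) y" by linarith
        then have "(2 * ?q - n / t * (h t y)\<^sup>2) / (2 * h t y) \<le> hp y"
          unfolding hp_def using h[OF t, of y] by (intro divide_right_mono) auto
        moreover have "(2 * ?q - n / t * (h t y)\<^sup>2) / (2 * h t y) = ?q / h t y - n / (2 * t) * h t y"
          using h[OF t, of y] t by (simp add: field_simps power2_eq_square)
        ultimately show ?thesis by simp
      qed
      have zx: "(z, x) \<in> edges G" using xz nbrs_sym[of z x] by (simp add: nbrs_def)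
      have "(1 - l t) * (?q / h t x - n / (2 * t) * h t x) \<le> (1 - l t) * hp x"
        using l01 by (intro mult_left_mono lower[OF xz]) auto
      moreover have "l t * (?q / h t z - n / (2 * t) * h t z) \<le> l t * hp z"
        using l01 by (intro mult_left_mono lower[OF zx]) auto
      moreover have "(1 - l t) * (?q / h t x - n / (2 * t) * h t x) + l t * (?q / h t z - n / (2 * t) * h t z)
          = ?q * ((1 - l t) / h t x + l t / h t z) - n / (2 * t) * V t"
      proof -
        have "(1 - l) * (q / a - c * a) + l * (q / b - c * b) = q * ((1 - l) / a + l / b) - c * ((1 - l) * a + l * b)"
          for l q a b c :: real by (simp add: algebra_simps diff_divide_distrib)
        then show ?thesis unfolding V_def by blast
      qed
      moreover have "0 \<le> ?q * ((1 - l t) / h t x + l t / h t z) - (h t x - h t z) / \<tau> + V t / (2 * \<alpha> * \<tau>\<^sup>2)"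
        unfolding V_def by (rule harnack_algebra[OF h[OF t] h[OF t] l01 \<alpha> \<tau>])
      ultimately have "0 \<le> V' + n / (2 * t) * V t + V t / (2 * \<alpha> * \<tau>\<^sup>2)" unfolding V'_def by linarith
      then have "0 \<le> 1 / V t * (V' + n / (2 * t) * V t + V t / (2 * \<alpha> * \<tau>\<^sup>2))" using V by simp
      also have "\<dots> = 1 / V t * V' + n / 2 * (1 / t) + 1 / (2 * \<alpha> * \<tau>\<^sup>2)"
        using V by (simp add: distrib_left)
      finally show ?thesis .
    qed
    ultimately show "\<exists>y. (?g has_real_derivative y) (at t) \<and> 0 \<le> y" by blast
  qed
  moreover have "V s = h s x" "V (s + \<tau>) = h (s + \<tau>) z" using \<tau> by (auto simp: V_def l_def)
  moreover have "(s + \<tau>) / (2 * \<alpha> * \<tau>\<^sup>2) = s / (2 * \<alpha> * \<tau>\<^sup>2) + 1 / (\<alpha> * \<tau>) / 2"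
    using \<alpha> \<tau> by (simp add: add_divide_distrib power2_eq_square)
  ultimately have "ln (lifted s x) / 2 + n / 2 * ln s + s / (2 * \<alpha> * \<tau>\<^sup>2)
     \<le> ln (lifted (s + \<tau>) z) / 2 + n / 2 * ln (s + \<tau>) + (s / (2 * \<alpha> * \<tau>\<^sup>2) + 1 / (\<alpha> * \<tau>) / 2)"
    using hv[of s x] hv[of "s + \<tau>" z] s \<tau> by simp
  moreover have "a / 2 + n / 2 * b + c \<le> d / 2 + n / 2 * e + (c + f / 2) \<Longrightarrow> a \<le> d + n * (e - b) + f"
    for a b c d e f :: real by (simp add: right_diff_distrib)
  ultimately show ?thesis by blast
qed

lemma harnack_chain:
  assumes s: "0 < s" and \<tau>: "0 < \<tau>"
  shows "(x, z) \<in> edges G ^^ j \<Longrightarrow>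
    ln (lifted s x) \<le> ln (lifted (s + real j * \<tau>) z) + n * (ln (s + real j * \<tau>) - ln s) + real j / (\<alpha> * \<tau>)"
proof (induction j arbitrary: z)
  case (Suc j)
  then obtain y where y: "(x, y) \<in> edges G ^^ j" "(y, z) \<in> edges G" by auto
  let ?r = "s + real j * \<tau>"
  have "0 < ?r" using s \<tau> by (simp add: add_pos_nonneg)
  from harnack_edge[OF this \<tau> y(2)] Suc.IH[OF y(1)]
  have "ln (lifted s x) \<le> ln (lifted (?r + \<tau>) z) + n * (ln (?r + \<tau>) - ln s) + (real j / (\<alpha> * \<tau>) + 1 / (\<alpha> * \<tau>))"
    unfolding right_diff_distrib by linarith
  moreover have "?r + \<tau> = s + real (Suc j) * \<tau>" by (simp add: algebra_simps)
  moreover have "real j / (\<alpha> * \<tau>) + 1 / (\<alpha> * \<tau>) = real (Suc j) / (\<alpha> * \<tau>)"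
    by (simp add: add_divide_distrib)
  ultimately show ?case by simp
qed simp

text \<open>The time \<open>t\<close> is divided evenly among the \<open>d\<close> edges of a shortest path, at a cost of
\<open>d\<^sup>2/(\<alpha>t)\<close> in the exponent. For \<open>d = 0\<close> there is no edge to cross, and only the factor
\<open>2\<^sup>n\<close> remains; this covers small times, where the ball is a single vertex.\<close>

lemma harnack_ball:
  assumes t: "0 < t" and z: "(x, z) \<in> edges G ^^ d" and d: "real d \<le> sqrt t"
  shows "lifted t x \<le> exp (n * ln 2 + 1 / \<alpha>) * lifted (2 * t) z"
proof -
  have ln2: "ln (2 * t) - ln t = ln 2" using t by (simp add: ln_mult)
  have "ln (lifted t x) \<le> ln (lifted (2 * t) z) + (n * ln 2 + 1 / \<alpha>)"
  proof (cases "d = 0")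
    case True
    then have "x = z" using z by simp
    then have "ln (lifted t x) \<le> ln (lifted (2 * t) z) + n * ln 2"
      using harnack_same_vertex[of t "2 * t" x] t ln2 by simp
    moreover have "0 < 1 / \<alpha>" using \<alpha> by simp
    ultimately show ?thesis by linarith
  next
    case False
    define \<tau> where "\<tau> = t / real d"
    have \<tau>: "0 < \<tau>" using False t by (simp add: \<tau>_def)
    have "t + real d * \<tau> = 2 * t" using False by (simp add: \<tau>_def)
    then have "ln (lifted t x) \<le> ln (lifted (2 * t) z) + n * ln 2 + real d / (\<alpha> * \<tau>)"
      using harnack_chain[OF t \<tau> z] ln2 by simp
    moreover have "real d / (\<alpha> * \<tau>) \<le> 1 / \<alpha>"
    proof -
      have "(real d)\<^sup>2 \<le> (sqrt t)\<^sup>2" using d by (intro power_mono) auto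
      then have "(real d)\<^sup>2 / t \<le> 1" using t by simp
      then have "(real d)\<^sup>2 / t / \<alpha> \<le> 1 / \<alpha>" using \<alpha> by (intro divide_right_mono) auto
      moreover have "real d / (\<alpha> * \<tau>) = (real d)\<^sup>2 / t / \<alpha>" by (simp add: \<tau>_def power2_eq_square)
      ultimately show ?thesis by simp
    qed
    ultimately show ?thesis by linarith
  qed
  then have "exp (ln (lifted t x)) \<le> exp (ln (lifted (2 * t) z) + (n * ln 2 + 1 / \<alpha>))" by simp
  then show ?thesis using lifted_pos[of t x] lifted_pos[of "2 * t" z] t by (simp add: exp_add mult.commute)
qed

end

section \<open>The heat kernel bound\<close>

lemma gdist_path: "(x, z) \<in> edges G ^^ gdist G x z"
proof -
  obtain k where "(x, z) \<in> edges G ^^ k" using connected_edges rtrancl_imp_relpow by blast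
  then show ?thesis unfolding gdist_def by (rule LeastI)
qed

lemma finite_gball: "finite (gball G x r)"
proof -
  have fin: "finite {z. (x, z) \<in> edges G ^^ k}" for k
  proof (induction k)
    case (Suc k)
    have "{z. (x, z) \<in> edges G ^^ Suc k} \<subseteq> (\<Union>y\<in>{z. (x, z) \<in> edges G ^^ k}. nbrs G y)"
      by (auto simp: nbrs_def)
    then show ?case by (rule finite_subset) (use Suc in auto)
  qed simp
  have "gball G x r \<subseteq> (\<Union>k\<le>nat \<lfloor>r\<rfloor>. {z. (x, z) \<in> edges G ^^ k})"
  proof
    fix z assume "z \<in> gball G x r"
    then have "real (gdist G x z) \<le> r" by (simp add: gball_def)
    then have "gdist G x z \<le> nat \<lfloor>r\<rfloor>" by (simp add: le_nat_floor)
    then show "z \<in> (\<Union>k\<le>nat \<lfloor>r\<rfloor>. {z. (x, z) \<in> edges G ^^ k})" using gdist_path by blast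
  qed
  then show ?thesis by (rule finite_subset) (use fin in auto)
qed

lemma vol_pos: assumes "0 \<le> r" shows "0 < vol G x r"
proof -
  have "gdist G x x = 0" unfolding gdist_def by (rule Least_eq_0) simp
  then have "x \<in> gball G x r" using assms by (simp add: gball_def)
  then show ?thesis unfolding vol_def by (intro sum_pos2[OF finite_gball]) auto
qed

text \<open>The Harnack inequality is averaged over the ball. The lift \<open>\<epsilon>\<close> is chosen so that its contribution, which
involves the volume of the ball, is the prescribed \<open>e\<close>.\<close>

lemma heat_kernel_upper_bound:
  assumes \<alpha>: "0 < \<alpha>" and edge: "\<And>x y. (x, y) \<in> edges G \<Longrightarrow> \<alpha> * m x \<le> w x y" and t: "0 < t"
  shows "heat_kernel G t x y \<le> exp (n * ln 2 + 1 / \<alpha>) / vol G x (sqrt t)"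
proof -
  let ?C = "exp (n * ln 2 + 1 / \<alpha>)" and ?B = "gball G x (sqrt t)" and ?V = "vol G x (sqrt t)"
  have V: "0 < ?V" using t by (intro vol_pos) auto
  have le: "?V * kern t x y \<le> ?C + e" if e: "0 < e" for e
  proof -
    define \<epsilon> where "\<epsilon> = e / (?C * ?V)"
    have \<epsilon>: "0 < \<epsilon>" using e V by (simp add: \<epsilon>_def)
    have step: "kern t x y + \<epsilon> \<le> ?C * (kern (2 * t) z y + \<epsilon>)" if "z \<in> ?B" for z
      using harnack_ball[OF unit_mass_C0[of y] unit_mass_nonneg \<epsilon> \<alpha> edge t gdist_path[of x z]] that
        lifted_def[OF unit_mass_C0[of y] unit_mass_nonneg \<epsilon> \<alpha> edge] by (simp add: gball_def heat_unit_mass)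
    have "?V * (kern t x y + \<epsilon>) = (\<Sum>z\<in>?B. (kern t x y + \<epsilon>) * m z)"
      unfolding vol_def by (subst mult.commute) (rule sum_distrib_left)
    also have "\<dots> \<le> (\<Sum>z\<in>?B. (?C * (kern (2 * t) z y + \<epsilon>)) * m z)"
      by (intro sum_mono mult_right_mono step) auto
    also have "\<dots> = ?C * ((\<Sum>z\<in>?B. kern (2 * t) z y * m z) + \<epsilon> * ?V)"
      by (simp add: vol_def sum_distrib_left sum.distrib algebra_simps)
    also have "\<dots> \<le> ?C * (1 + \<epsilon> * ?V)"
      using kern_mass[of "2 * t" ?B y] t finite_gball by (intro mult_left_mono add_right_mono) auto
    also have "\<dots> = ?C + e" using V by (simp add: \<epsilon>_def distrib_left)
    finally have "?V * kern t x y + ?V * \<epsilon> \<le> ?C + e" by (simp add: distrib_left)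
    moreover have "0 \<le> ?V * \<epsilon>" using V \<epsilon> by simp
    ultimately show ?thesis by linarith
  qed
  have "?V * kern t x y \<le> ?C" by (rule field_le_epsilon) (use le in auto)
  then show ?thesis using V t by (simp add: heat_kernel_eq pos_le_divide_eq mult.commute)
qed

end

theorem theorem1p3:
  fixes n mmax wmin :: real
  assumes "0 < n"
  shows "\<exists>C>0. \<forall>G :: 'v wgraph.
    weighted_graph G \<and> complete_graph G \<and> nondegenerate_measure G \<and>
    0 < omega_min G \<and> omega_min G = wmin \<and>
    bdd_above (range (vmeas G)) \<and> m_max G = mmax \<and>
    CDE' G n 0 \<longrightarrow>
    (\<forall>x y t. 0 < t \<longrightarrow> heat_kernel G t x y \<le> C / vol G x (sqrt t))"
proof (intro exI[of _ "exp (n * ln 2 + mmax / wmin)"] conjI allI impI, goal_cases)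
  case (2 G x y t)
  then interpret cde_graph G n
    using assms by unfold_locales auto
  have m_le: "vmeas G z \<le> mmax" for z
    using 2 unfolding m_max_def by (auto intro: cSUP_upper)
  have mmax: "0 < mmax" using m_le[of x] m_pos[of x] by linarith
  have w_ge: "wmin \<le> weight G a b" if "(a, b) \<in> edges G" for a b
  proof -
    have "bdd_below ((\<lambda>(x, y). weight G x y) ` edges G)" by (rule bdd_belowI[of _ 0]) auto
    from cINF_lower[OF this that] show ?thesis using 2 by (simp add: omega_min_def)
  qed
  have wmin: "0 < wmin" using 2 by auto
  have "heat_kernel G t x y \<le> exp (n * ln 2 + 1 / (wmin / mmax)) / vol G x (sqrt t)"
  proof (rule heat_kernel_upper_bound)
    show "0 < wmin / mmax" using wmin mmax by simp
    fix a b assume "(a, b) \<in> edges G"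
    have "wmin / mmax * vmeas G a \<le> wmin / mmax * mmax"
      using wmin mmax by (intro mult_left_mono m_le) auto
    also have "\<dots> = wmin" using mmax by simp
    also have "\<dots> \<le> weight G a b" by (rule w_ge) fact
    finally show "wmin / mmax * vmeas G a \<le> weight G a b" .
  qed (use 2 in auto)
  then show ?case by simp
qed simp

end
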